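(* Let $q\in\Bbbk^\times$, let $n$ be a positive integer, and consider the algebra $A:=S_{q,0,1}=\Bbbk\langle x,y,z\rangle/(x^2+qyz,\ y^2+qzx,\ z^2+qxy)$ graded by the nonabelian group $$\Delta_n=\langle a,b,c\mid ab=c^2,\ bc=a^2,\ ca=b^2,\ (acb)^n=e\rangle,$$ with $x,y,z$ of degrees $a,b,c$ respectively. Put $u:=xzy$, $v:=yxz$, $w:=zyx$. Then $A_e$ is generated by the three elements $u^n$, $v^n$, $w^n$. Consequently, $A_e\cong A_{p^{n^2},\,p^{-n^2},\,p^{n^2}}$ is AS regular, where $p:=-q^{-9}$.
   Context: $\Bbbk$ is an algebraically closed field of characteristic zero. $A_{rst}=\Bbbk\langle x_1,x_2,x_3\rangle/(x_2x_1-rx_1x_2,\ x_3x_1-sx_1x_3,\ x_3x_2-tx_2x_3)$ for $r,s,t\in\Bbbk^\times$. A connected $\mathbb{N}$-graded $\Bbbk$-algebra $A$ ($A_0=\Bbbk$) is AS regular of dimension $d$ if it has finite global dimension $d$, finite GK-dimension, and $\operatorname{Ext}^i_A(\Bbbk,A)$ is $0$ for $i\ne d$ and $\Bbbk(\ell)$ for $i=d$ (some $\ell\in\mathbb{Z}$), both as left and right modules. $A_e$ is the component of the grading at the identity $e$. *)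

theory Defs
  imports
    "HOL-Library.Poly_Mapping"
    "HOL-Analysis.Extended_Real_Limits"
    "HOL-Computational_Algebra.Polynomial"
    "HOL-Algebra.Algebra"
begin

section \<open>Algebras over a field\<close>

text \<open>
  An algebra over the type-class field \<^typ>\<open>'k\<close> is a HOL-Algebra \<^typ>\<open>('k, 'a) module\<close> record, all of
  whose fields are used. The locale \<^locale>\<open>Module.algebra\<close> is restricted to commutative algebras.
\<close>

definition base :: "'k::field ring"
  where "base =
    \<lparr>carrier = UNIV, monoid.mult = (*), one = 1, ring.zero = 0, add = (+)\<rparr>"

locale k_algebra = module "base :: 'k::field ring" A + ring A
  for A :: "('k::field, 'a) module" (structure) +
  assumes smult_mult_left: "\<lbrakk>x \<in> carrier A; y \<in> carrier A\<rbrakk> \<Longrightarrow> (c \<odot> x) \<otimes> y = c \<odot> (x \<otimes> y)"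
    and smult_mult_right: "\<lbrakk>x \<in> carrier A; y \<in> carrier A\<rbrakk> \<Longrightarrow> x \<otimes> (c \<odot> y) = c \<odot> (x \<otimes> y)"

definition k_span :: "('k::field, 'a) module \<Rightarrow> 'a set \<Rightarrow> 'a set"
  where "k_span A S = \<Inter> {W. submodule W (base :: 'k ring) A \<and> S \<subseteq> W}"

definition subalgebra_generated :: "('k::field, 'a) module \<Rightarrow> 'a set \<Rightarrow> 'a set"
  where "subalgebra_generated A S =
    \<Inter> {B. subring B A \<and> submodule B (base :: 'k ring) A \<and> S \<subseteq> B}"

definition k_algebra_iso :: "('k::field, 'a) module \<Rightarrow> ('k, 'b) module \<Rightarrow> ('a \<Rightarrow> 'b) \<Rightarrow> bool"
  where "k_algebra_iso A B \<phi> \<longleftrightarrow> \<phi> \<in> ring_iso A B \<and>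
    (\<forall>c. \<forall>x \<in> carrier A. \<phi> (c \<odot>\<^bsub>A\<^esub> x) = c \<odot>\<^bsub>B\<^esub> \<phi> x)"

definition op_algebra :: "('k, 'a) module \<Rightarrow> ('k, 'a) module"
  where "op_algebra A = A\<lparr>monoid.mult := (\<lambda>x y. y \<otimes>\<^bsub>A\<^esub> x)\<rparr>"

text \<open>
  Quotient of an algebra by a two-sided ideal, or of a module by a submodule (in the latter case the
  \<open>mult\<close> and \<open>one\<close> fields carry no meaning).
\<close>

definition quotient_by :: "('r, 'a) module \<Rightarrow> 'a set \<Rightarrow> ('r, 'a set) module"
  where "quotient_by M I =
    ring.extend (M Quot I) (module.fields (\<lambda>c C. \<Union>x\<in>C. I +>\<^bsub>M\<^esub> (c \<odot>\<^bsub>M\<^esub> x)))"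

section \<open>Finitely presented algebras\<close>

text \<open>The free monoid on \<^typ>\<open>'g\<close>, so that \<^typ>\<open>'g list \<Rightarrow>\<^sub>0 'k\<close> is the free algebra.\<close>

instantiation list :: (type) monoid_add
begin
definition zero_list :: "'a list" where "zero_list = []"
definition plus_list :: "'a list \<Rightarrow> 'a list \<Rightarrow> 'a list" where "plus_list = (@)"
instance by standard (simp_all add: zero_list_def plus_list_def)
end

definition free_algebra :: "('k::field, 'g list \<Rightarrow>\<^sub>0 'k) module"
  where "free_algebra =
    \<lparr>carrier = UNIV, monoid.mult = (*), one = 1, ring.zero = 0, add = (+),
     module.smult = (\<lambda>c f. Poly_Mapping.single [] c * f)\<rparr>"

definition presented_algebra ::
    "('g list \<Rightarrow>\<^sub>0 'k::field) set \<Rightarrow> ('k, ('g list \<Rightarrow>\<^sub>0 'k) set) module"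
  where "presented_algebra R = quotient_by free_algebra (Idl\<^bsub>free_algebra\<^esub> R)"

definition word_class ::
    "('g list \<Rightarrow>\<^sub>0 'k::field) set \<Rightarrow> 'g list \<Rightarrow> ('g list \<Rightarrow>\<^sub>0 'k) set"
  where "word_class R w =
    (Idl\<^bsub>free_algebra\<^esub> R) +>\<^bsub>free_algebra\<^esub> Poly_Mapping.single w 1"

text \<open>
  The component of degree \<open>g\<close> of a presented algebra whose relators are homogeneous with respect to
  the degree function \<open>dg\<close> on monomials.
\<close>

definition component ::
    "('g list \<Rightarrow>\<^sub>0 'k::field) set \<Rightarrow> ('g list \<Rightarrow> 'd) \<Rightarrow> 'd \<Rightarrow> ('g list \<Rightarrow>\<^sub>0 'k) set set"
  where "component R dg g = k_span (presented_algebra R) {word_class R w |w. dg w = g}"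

section \<open>Groups given by generators and relations\<close>

text \<open>
  The letter \<open>(g, True)\<close> is the generator \<open>g\<close> and \<open>(g, False)\<close> is its inverse; a pair \<open>(u, v) \<in> R\<close>
  is the relation \<open>u = v\<close>.
\<close>

inductive pres_eq ::
    "(('g \<times> bool) list \<times> ('g \<times> bool) list) set \<Rightarrow> ('g \<times> bool) list \<Rightarrow> ('g \<times> bool) list \<Rightarrow> bool"
  for R where
  refl: "pres_eq R u u"
| sym: "pres_eq R u v \<Longrightarrow> pres_eq R v u"
| trans: "pres_eq R u v \<Longrightarrow> pres_eq R v w \<Longrightarrow> pres_eq R u w"
| cong: "pres_eq R u v \<Longrightarrow> pres_eq R (xs @ u @ ys) (xs @ v @ ys)"
| cancel: "pres_eq R [(g, b), (g, \<not> b)] []"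
| rel: "(u, v) \<in> R \<Longrightarrow> pres_eq R u v"

definition pres_rel ::
    "(('g \<times> bool) list \<times> ('g \<times> bool) list) set \<Rightarrow> (('g \<times> bool) list \<times> ('g \<times> bool) list) set"
  where "pres_rel R = {(u, v). pres_eq R u v}"

definition presented_group ::
    "(('g \<times> bool) list \<times> ('g \<times> bool) list) set \<Rightarrow> ('g \<times> bool) list set monoid"
  where "presented_group R =
    \<lparr>carrier = UNIV // pres_rel R,
     monoid.mult = (\<lambda>U V. \<Union>u\<in>U. \<Union>v\<in>V. pres_rel R `` {u @ v}),
     one = pres_rel R `` {[]}\<rparr>"

definition word_degree :: "('d, 'e) monoid_scheme \<Rightarrow> ('g \<Rightarrow> 'd) \<Rightarrow> 'g list \<Rightarrow> 'd"
  where "word_degree \<Gamma> \<delta> w = foldr (\<lambda>g h. \<delta> g \<otimes>\<^bsub>\<Gamma>\<^esub> h) w \<one>\<^bsub>\<Gamma>\<^esub>"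

lemma equiv_pres_rel: "equiv UNIV (pres_rel R)"
proof (rule equivI)
  show "refl (pres_rel R)"
    by (simp add: pres_rel_def refl_on_def pres_eq.refl)
  show "sym (pres_rel R)"
    unfolding pres_rel_def by (rule symI) (simp, rule pres_eq.sym)
  show "trans (pres_rel R)"
    unfolding pres_rel_def by (rule transI) (simp, rule pres_eq.trans)
qed simp

lemma pres_rel_class_eq_iff: "pres_rel R `` {u} = pres_rel R `` {v} \<longleftrightarrow> pres_eq R u v"
  using eq_equiv_class_iff[OF equiv_pres_rel[of R], of u v] by (simp add: pres_rel_def)

lemma pres_eq_append:
  assumes "pres_eq R u u'" "pres_eq R v v'"
  shows "pres_eq R (u @ v) (u' @ v')"
proof -
  have "pres_eq R (u @ v) (u' @ v)"
    using pres_eq.cong[OF assms(1), of "[]" v] by simp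
  moreover have "pres_eq R (u' @ v) (u' @ v')"
    using pres_eq.cong[OF assms(2), of u' "[]"] by simp
  ultimately show ?thesis by (rule pres_eq.trans)
qed

lemma presented_group_mult:
  "pres_rel R `` {u} \<otimes>\<^bsub>presented_group R\<^esub> pres_rel R `` {v} = pres_rel R `` {u @ v}"
proof -
  have "pres_rel R `` {u' @ v'} = pres_rel R `` {u @ v}"
    if "u' \<in> pres_rel R `` {u}" "v' \<in> pres_rel R `` {v}" for u' v'
  proof -
    have "pres_eq R u u'" "pres_eq R v v'" using that by (simp_all add: pres_rel_def)
    from pres_eq.sym[OF pres_eq_append[OF this]] show ?thesis
      by (simp only: pres_rel_class_eq_iff)
  qed
  then have "(\<Union>u'\<in>pres_rel R `` {u}. \<Union>v'\<in>pres_rel R `` {v}. pres_rel R `` {u' @ v'}) =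
      (\<Union>u'\<in>pres_rel R `` {u}. \<Union>v'\<in>pres_rel R `` {v}. pres_rel R `` {u @ v})"
    by (intro SUP_cong HOL.refl)
  moreover have "pres_rel R `` {u} \<noteq> {}" "pres_rel R `` {v} \<noteq> {}"
    using equiv_class_self[OF equiv_pres_rel, of _ R] by blast+
  ultimately show ?thesis
    by (simp only: presented_group_def monoid.simps UN_constant if_False)
qed

lemma pres_eq_inverse:
  "pres_eq R (rev (map (\<lambda>(g, b). (g, \<not> b)) u) @ u) []"
proof (induction u)
  case Nil
  show ?case by (simp add: pres_eq.refl)
next
  case (Cons x u)
  obtain g b where x: "x = (g, b)" by force
  let ?r = "rev (map (\<lambda>(g, b). (g, \<not> b)) u)"
  have "pres_eq R [(g, \<not> b), (g, b)] []"
    using pres_eq.cancel[of R g "\<not> b"] by simp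
  from pres_eq.cong[OF this, of ?r u]
  have "pres_eq R (?r @ [(g, \<not> b), (g, b)] @ u) (?r @ u)" by simp
  from pres_eq.trans[OF this Cons.IH] show ?case by (simp add: x)
qed

lemma group_presented_group: "group (presented_group R)"
proof (rule groupI)
  have c: "carrier (presented_group R) = range (\<lambda>u. pres_rel R `` {u})"
    by (auto simp: presented_group_def quotient_def)
  have o: "\<one>\<^bsub>presented_group R\<^esub> = pres_rel R `` {[]}"
    by (simp add: presented_group_def)
  show "\<one>\<^bsub>presented_group R\<^esub> \<in> carrier (presented_group R)"
    by (simp add: c o)
  fix x assume "x \<in> carrier (presented_group R)"
  then obtain u where x: "x = pres_rel R `` {u}" by (auto simp: c)
  show "\<one>\<^bsub>presented_group R\<^esub> \<otimes>\<^bsub>presented_group R\<^esub> x = x"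
    by (simp add: o x presented_group_mult)
  show "\<exists>y\<in>carrier (presented_group R). y \<otimes>\<^bsub>presented_group R\<^esub> x = \<one>\<^bsub>presented_group R\<^esub>"
  proof (rule bexI)
    let ?y = "pres_rel R `` {rev (map (\<lambda>(g, b). (g, \<not> b)) u)}"
    show "?y \<otimes>\<^bsub>presented_group R\<^esub> x = \<one>\<^bsub>presented_group R\<^esub>"
      unfolding x o presented_group_mult pres_rel_class_eq_iff by (rule pres_eq_inverse)
    show "?y \<in> carrier (presented_group R)" by (simp add: c)
  qed
  fix y assume "y \<in> carrier (presented_group R)"
  then obtain v where y: "y = pres_rel R `` {v}" by (auto simp: c)
  show "x \<otimes>\<^bsub>presented_group R\<^esub> y \<in> carrier (presented_group R)"
    by (simp add: c x y presented_group_mult)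
  fix z assume "z \<in> carrier (presented_group R)"
  then obtain w where z: "z = pres_rel R `` {w}" by (auto simp: c)
  show "x \<otimes>\<^bsub>presented_group R\<^esub> y \<otimes>\<^bsub>presented_group R\<^esub> z =
      x \<otimes>\<^bsub>presented_group R\<^esub> (y \<otimes>\<^bsub>presented_group R\<^esub> z)"
    by (simp add: x y z presented_group_mult)
qed

section \<open>The algebras and the grading group\<close>

datatype gen = gx | gy | gz

text \<open>\<open>skly_rels q\<close> presents \<open>S\<^bsub>q,0,1\<^esub>\<close>.\<close>

definition skly_rels :: "'k::field \<Rightarrow> (gen list \<Rightarrow>\<^sub>0 'k) set"
  where "skly_rels q =
    {Poly_Mapping.single [gx, gx] 1 + Poly_Mapping.single [gy, gz] q,
     Poly_Mapping.single [gy, gy] 1 + Poly_Mapping.single [gz, gx] q,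
     Poly_Mapping.single [gz, gz] 1 + Poly_Mapping.single [gx, gy] q}"

abbreviation S_alg :: "'k::field \<Rightarrow> ('k, (gen list \<Rightarrow>\<^sub>0 'k) set) module"
  where "S_alg q \<equiv> presented_algebra (skly_rels q)"

text \<open>In \<open>A\<^bsub>rst\<^esub>\<close> the generators \<open>x\<^sub>1, x\<^sub>2, x\<^sub>3\<close> are \<^const>\<open>gx\<close>, \<^const>\<open>gy\<close>, \<^const>\<open>gz\<close>.\<close>

definition skew_poly_rels :: "'k::field \<Rightarrow> 'k \<Rightarrow> 'k \<Rightarrow> (gen list \<Rightarrow>\<^sub>0 'k) set"
  where "skew_poly_rels r s t =
    {Poly_Mapping.single [gy, gx] 1 - Poly_Mapping.single [gx, gy] r,
     Poly_Mapping.single [gz, gx] 1 - Poly_Mapping.single [gx, gz] s,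
     Poly_Mapping.single [gz, gy] 1 - Poly_Mapping.single [gy, gz] t}"

abbreviation A_rst :: "'k::field \<Rightarrow> 'k \<Rightarrow> 'k \<Rightarrow> ('k, (gen list \<Rightarrow>\<^sub>0 'k) set) module"
  where "A_rst r s t \<equiv> presented_algebra (skew_poly_rels r s t)"

text \<open>The generators \<open>a, b, c\<close> of the group are \<^const>\<open>gx\<close>, \<^const>\<open>gy\<close>, \<^const>\<open>gz\<close>.\<close>

definition Delta_rels :: "nat \<Rightarrow> ((gen \<times> bool) list \<times> (gen \<times> bool) list) set"
  where "Delta_rels n =
    {([(gx, True), (gy, True)], [(gz, True), (gz, True)]),
     ([(gy, True), (gz, True)], [(gx, True), (gx, True)]),
     ([(gz, True), (gx, True)], [(gy, True), (gy, True)]),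
     (concat (replicate n [(gx, True), (gz, True), (gy, True)]), [])}"

definition Delta :: "nat \<Rightarrow> (gen \<times> bool) list set monoid"
  where "Delta n = presented_group (Delta_rels n)"

definition Delta_gen :: "nat \<Rightarrow> gen \<Rightarrow> (gen \<times> bool) list set"
  where "Delta_gen n g = pres_rel (Delta_rels n) `` {[(g, True)]}"

text \<open>
  The group is nonabelian: \<open>a, b, c\<close> act on \<open>\<int>/9\<close> by \<open>i \<mapsto> i + 1\<close>, \<open>i \<mapsto> 4 i + 1\<close>, \<open>i \<mapsto> 7 i + 4\<close>.
\<close>

fun letter_act :: "gen \<times> bool \<Rightarrow> int \<Rightarrow> int" where
  "letter_act (gx, True) i = (i + 1) mod 9"
| "letter_act (gx, False) i = (i - 1) mod 9"
| "letter_act (gy, True) i = (4 * i + 1) mod 9"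
| "letter_act (gy, False) i = (7 * (i - 1)) mod 9"
| "letter_act (gz, True) i = (7 * i + 4) mod 9"
| "letter_act (gz, False) i = (4 * (i - 4)) mod 9"

lemma letter_act_range: "i \<in> {0..<9} \<Longrightarrow> letter_act g i \<in> {0..<9}"
  by (induction g i rule: letter_act.induct) auto

lemma word_act_range: "i \<in> {0..<9} \<Longrightarrow> fold letter_act u i \<in> {0..<9}"
proof (induction u arbitrary: i)
  case (Cons g u)
  then show ?case using letter_act_range[of i g] by simp
qed simp

lemma pres_eq_word_act:
  assumes "pres_eq (Delta_rels n) u v"
  shows "i \<in> {0..<9} \<Longrightarrow> fold letter_act u i = fold letter_act v i"
  using assms
proof (induction arbitrary: i)
  case (refl u)
  show ?case ..
next
  case (sym u v)
  from sym.IH[OF sym.prems] show ?case ..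
next
  case (trans u v w)
  from trans.IH(1)[OF trans.prems] trans.IH(2)[OF trans.prems] show ?case by (rule HOL.trans)
next
  case (cong u v xs ys)
  from cong.IH[OF word_act_range[OF cong.prems, of xs]] show ?case by simp
next
  case (cancel g b)
  have "i \<in> {0, 1, 2, 3, 4, 5, 6, 7, 8}" using cancel.prems by auto
  then show ?case by (cases g; cases b) auto
next
  case (rel u v)
  have i: "i \<in> {0, 1, 2, 3, 4, 5, 6, 7, 8}" using rel.prems by auto
  have acb: "fold letter_act (concat (replicate m [(gx, True), (gz, True), (gy, True)])) i = i" for m
  proof (induction m)
    case (Suc m)
    have "fold letter_act [(gx, True), (gz, True), (gy, True)] i = i" using i by auto
    with Suc show ?case
      by (simp only: replicate.simps concat.simps fold_append o_apply)
  qed simp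
  from rel(1) consider
      "u = [(gx, True), (gy, True)]" "v = [(gz, True), (gz, True)]"
    | "u = [(gy, True), (gz, True)]" "v = [(gx, True), (gx, True)]"
    | "u = [(gz, True), (gx, True)]" "v = [(gy, True), (gy, True)]"
    | "u = concat (replicate n [(gx, True), (gz, True), (gy, True)])" "v = []"
    unfolding Delta_rels_def by blast
  then show ?case
  proof cases
    case 4
    with acb[of n] show ?thesis by (simp only: fold.simps id_apply)
  qed (use i in auto)
qed

lemma group_Delta: "group (Delta n)"
  unfolding Delta_def by (rule group_presented_group)

lemma Delta_nonabelian:
  "Delta_gen n gx \<otimes>\<^bsub>Delta n\<^esub> Delta_gen n gy \<noteq> Delta_gen n gy \<otimes>\<^bsub>Delta n\<^esub> Delta_gen n gx"
proof
  assume "Delta_gen n gx \<otimes>\<^bsub>Delta n\<^esub> Delta_gen n gy = Delta_gen n gy \<otimes>\<^bsub>Delta n\<^esub> Delta_gen n gx"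
  then have "pres_eq (Delta_rels n) [(gx, True), (gy, True)] [(gy, True), (gx, True)]"
    by (simp add: Delta_def Delta_gen_def presented_group_mult pres_rel_class_eq_iff)
  from pres_eq_word_act[OF this, of 0] show False by simp
qed

abbreviation Delta_degree :: "nat \<Rightarrow> gen list \<Rightarrow> (gen \<times> bool) list set"
  where "Delta_degree n \<equiv> word_degree (Delta n) (Delta_gen n)"

text \<open>The identity component \<open>A\<^sub>e\<close>, and the grading it inherits from \<open>deg x = deg y = deg z = 1\<close>.\<close>

definition S_e :: "'k::field \<Rightarrow> nat \<Rightarrow> ('k, (gen list \<Rightarrow>\<^sub>0 'k) set) module"
  where "S_e q n = (S_alg q)\<lparr>carrier := component (skly_rels q) (Delta_degree n) \<one>\<^bsub>Delta n\<^esub>\<rparr>"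

definition S_e_grading :: "'k::field \<Rightarrow> nat \<Rightarrow> nat \<Rightarrow> (gen list \<Rightarrow>\<^sub>0 'k) set set"
  where "S_e_grading q n m = component (skly_rels q) length m \<inter> carrier (S_e q n)"

lemma skly_rels_Delta_homogeneous:
  "Delta_degree n [gx, gx] = Delta_degree n [gy, gz]"
  "Delta_degree n [gy, gy] = Delta_degree n [gz, gx]"
  "Delta_degree n [gz, gz] = Delta_degree n [gx, gy]"
proof -
  have one: "\<one>\<^bsub>Delta n\<^esub> = pres_rel (Delta_rels n) `` {[]}"
    by (simp add: Delta_def presented_group_def)
  have deg: "Delta_degree n [g, h] = pres_rel (Delta_rels n) `` {[(g, True), (h, True)]}" for g h
    unfolding word_degree_def foldr.simps o_apply id_apply one Delta_gen_def
    unfolding Delta_def presented_group_mult by simp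
  show "Delta_degree n [gx, gx] = Delta_degree n [gy, gz]"
    "Delta_degree n [gy, gy] = Delta_degree n [gz, gx]"
    "Delta_degree n [gz, gz] = Delta_degree n [gx, gy]"
    unfolding deg pres_rel_class_eq_iff
    by (rule pres_eq.sym, rule pres_eq.rel, simp add: Delta_rels_def)+
qed

section \<open>Modules and projective dimension\<close>

text \<open>
  A left module over a possibly noncommutative ring: the locale \<^locale>\<open>Module.module\<close> without
  commutativity. The \<open>mult\<close> and \<open>one\<close> fields of the module record carry no meaning. Right modules are
  left modules over \<^const>\<open>op_algebra\<close>.
\<close>

locale left_module = R?: ring R + M?: abelian_group M
  for R :: "('a, 'e) ring_scheme" and M :: "('a, 'm) module" (structure) +
  assumes smult_closed: "\<lbrakk>a \<in> carrier R; x \<in> carrier M\<rbrakk> \<Longrightarrow> a \<odot> x \<in> carrier M"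
    and smult_l_distr: "\<lbrakk>a \<in> carrier R; b \<in> carrier R; x \<in> carrier M\<rbrakk> \<Longrightarrow>
      (a \<oplus>\<^bsub>R\<^esub> b) \<odot> x = a \<odot> x \<oplus> b \<odot> x"
    and smult_r_distr: "\<lbrakk>a \<in> carrier R; x \<in> carrier M; y \<in> carrier M\<rbrakk> \<Longrightarrow>
      a \<odot> (x \<oplus> y) = a \<odot> x \<oplus> a \<odot> y"
    and smult_assoc: "\<lbrakk>a \<in> carrier R; b \<in> carrier R; x \<in> carrier M\<rbrakk> \<Longrightarrow>
      (a \<otimes>\<^bsub>R\<^esub> b) \<odot> x = a \<odot> (b \<odot> x)"
    and smult_one: "x \<in> carrier M \<Longrightarrow> \<one>\<^bsub>R\<^esub> \<odot> x = x"

definition regular_module :: "('k, 'a) module \<Rightarrow> ('a, 'a) module"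
  where "regular_module A = ring.extend (ring.truncate A) (module.fields (monoid.mult A))"

definition module_hom ::
    "('a, 'e) ring_scheme \<Rightarrow> ('a, 'm) module \<Rightarrow> ('a, 'n) module \<Rightarrow> ('m \<Rightarrow> 'n) set"
  where "module_hom R M N = {f \<in> carrier M \<rightarrow>\<^sub>E carrier N.
    (\<forall>x \<in> carrier M. \<forall>y \<in> carrier M. f (x \<oplus>\<^bsub>M\<^esub> y) = f x \<oplus>\<^bsub>N\<^esub> f y) \<and>
    (\<forall>a \<in> carrier R. \<forall>x \<in> carrier M. f (a \<odot>\<^bsub>M\<^esub> x) = a \<odot>\<^bsub>N\<^esub> f x)}"

text \<open>
  HOL cannot quantify over all types inside a definition, so the notions below refer to modules whose
  carrier lies in a type \<^typ>\<open>'u\<close>. They have their usual meaning as soon as \<^typ>\<open>'u\<close> is infinite and at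
  least as large as the ring: then every module in \<^typ>\<open>'u\<close> is a quotient of a free module in \<^typ>\<open>'u\<close>,
  and every cyclic module has a copy in \<^typ>\<open>'u\<close>.
\<close>

definition projective :: "('a, 'e) ring_scheme \<Rightarrow> ('a, 'u) module \<Rightarrow> bool"
  where "projective R P \<longleftrightarrow> left_module R P \<and>
    (\<forall>(M :: ('a, 'u) module) (N :: ('a, 'u) module) g f.
      left_module R M \<and> left_module R N \<and>
      g \<in> module_hom R M N \<and> g ` carrier M = carrier N \<and> f \<in> module_hom R P N
      \<longrightarrow> (\<exists>h \<in> module_hom R P M. \<forall>x \<in> carrier P. g (h x) = f x))"

text \<open>\<open>\<dots> \<rightarrow> P 2 \<rightarrow> P 1 \<rightarrow> P 0 \<rightarrow> M \<rightarrow> 0\<close> with differentials \<open>D i : P (i + 1) \<rightarrow> P i\<close> and augmentation \<open>\<epsilon>\<close>.\<close>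

definition projective_resolution ::
    "('a, 'e) ring_scheme \<Rightarrow> (nat \<Rightarrow> ('a, 'u) module) \<Rightarrow> (nat \<Rightarrow> 'u \<Rightarrow> 'u) \<Rightarrow> ('u \<Rightarrow> 'm)
      \<Rightarrow> ('a, 'm) module \<Rightarrow> bool"
  where "projective_resolution R P D \<epsilon> M \<longleftrightarrow>
    (\<forall>i. projective R (P i)) \<and>
    (\<forall>i. D i \<in> module_hom R (P (Suc i)) (P i)) \<and>
    \<epsilon> \<in> module_hom R (P 0) M \<and>
    \<epsilon> ` carrier (P 0) = carrier M \<and>
    a_kernel (P 0) M \<epsilon> = D 0 ` carrier (P 1) \<and>
    (\<forall>i. a_kernel (P (Suc i)) (P i) (D i) = D (Suc i) ` carrier (P (Suc (Suc i))))"

definition proj_dim :: "('a, 'e) ring_scheme \<Rightarrow> ('a, 'u) module \<Rightarrow> enat"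
  where "proj_dim R M = Inf {enat n |n. \<exists>(P :: nat \<Rightarrow> ('a, 'u) module) D \<epsilon>.
    projective_resolution R P D \<epsilon> M \<and> (\<forall>i>n. carrier (P i) = {\<zero>\<^bsub>P i\<^esub>})}"

definition left_gldim :: "'u itself \<Rightarrow> ('a, 'e) ring_scheme \<Rightarrow> enat"
  where "left_gldim _ R = (SUP M \<in> {M :: ('a, 'u) module. left_module R M}. proj_dim R M)"

section \<open>Gelfand-Kirillov dimension\<close>

definition k_dim :: "('k::field, 'a) module \<Rightarrow> 'a set \<Rightarrow> nat"
  where "k_dim A W = (LEAST d. \<exists>S \<subseteq> carrier A. finite S \<and> card S = d \<and> k_span A S = W)"

text \<open>\<open>k + V + V\<^sup>2 + \<dots> + V\<^sup>n\<close>\<close>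

definition power_sum :: "('k::field, 'a) module \<Rightarrow> 'a set \<Rightarrow> nat \<Rightarrow> 'a set"
  where "power_sum A V n =
    k_span A {foldr (monoid.mult A) vs \<one>\<^bsub>A\<^esub> |vs. set vs \<subseteq> V \<and> length vs \<le> n}"

definition gk_dim :: "('k::field, 'a) module \<Rightarrow> ereal"
  where "gk_dim A = (SUP V \<in> {k_span A S |S. S \<subseteq> carrier A \<and> finite S}.
    limsup (\<lambda>n. ereal (log (real n) (real (k_dim A (power_sum A V n))))))"

section \<open>Graded algebras and modules\<close>

definition decomposes ::
    "('b, 'e) ring_scheme \<Rightarrow> ('i \<Rightarrow> 'b set) \<Rightarrow> 'b \<Rightarrow> ('i \<Rightarrow> 'b) \<Rightarrow> bool"
  where "decomposes M H x f \<longleftrightarrow> (\<forall>i. f i \<in> H i) \<and> finite {i. f i \<noteq> \<zero>\<^bsub>M\<^esub>} \<and>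
    x = (\<Oplus>\<^bsub>M\<^esub>i \<in> {i. f i \<noteq> \<zero>\<^bsub>M\<^esub>}. f i)"

definition internal_direct_sum :: "('b, 'e) ring_scheme \<Rightarrow> ('i \<Rightarrow> 'b set) \<Rightarrow> bool"
  where "internal_direct_sum M H \<longleftrightarrow>
    (\<forall>i. additive_subgroup (H i) M) \<and> (\<forall>x \<in> carrier M. \<exists>!f. decomposes M H x f)"

definition connected_graded :: "('k::field, 'a) module \<Rightarrow> (nat \<Rightarrow> 'a set) \<Rightarrow> bool"
  where "connected_graded A G \<longleftrightarrow>
    k_algebra A \<and>
    (\<forall>i. submodule (G i) (base :: 'k ring) A) \<and>
    internal_direct_sum A G \<and>
    (\<forall>i j. \<forall>x \<in> G i. \<forall>y \<in> G j. x \<otimes>\<^bsub>A\<^esub> y \<in> G (i + j)) \<and>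
    bij_betw (\<lambda>c. c \<odot>\<^bsub>A\<^esub> \<one>\<^bsub>A\<^esub>) UNIV (G 0)"

definition graded_module ::
    "('k::field, 'a) module \<Rightarrow> (nat \<Rightarrow> 'a set) \<Rightarrow> ('a, 'm) module \<Rightarrow> (int \<Rightarrow> 'm set) \<Rightarrow> bool"
  where "graded_module A G M H \<longleftrightarrow>
    left_module A M \<and> internal_direct_sum M H \<and>
    (\<forall>i j. \<forall>a \<in> G i. \<forall>x \<in> H j. a \<odot>\<^bsub>M\<^esub> x \<in> H (int i + j))"

definition int_grading :: "('k, 'a) module \<Rightarrow> (nat \<Rightarrow> 'a set) \<Rightarrow> int \<Rightarrow> 'a set"
  where "int_grading A G j = (if j \<ge> 0 then G (nat j) else {\<zero>\<^bsub>A\<^esub>})"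

text \<open>The trivial module \<open>k = A / A\<^bsub>\<ge>1\<^esub>\<close> of a connected graded algebra, on which \<open>A\<close> acts through its
  degree 0 part, and the grading of the shift \<open>k(l)\<close>, where \<open>M(l)\<^sub>j = M\<^bsub>j+l\<^esub>\<close>.\<close>

definition augmentation :: "('k::field, 'a) module \<Rightarrow> (nat \<Rightarrow> 'a set) \<Rightarrow> 'a \<Rightarrow> 'k"
  where "augmentation A G a = (THE c. \<exists>f. decomposes A G a f \<and> f 0 = c \<odot>\<^bsub>A\<^esub> \<one>\<^bsub>A\<^esub>)"

definition trivial_module :: "('k::field, 'a) module \<Rightarrow> (nat \<Rightarrow> 'a set) \<Rightarrow> ('a, 'k) module"
  where "trivial_module A G =
    ring.extend base (module.fields (\<lambda>a c. augmentation A G a * c))"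

definition trivial_grading :: "int \<Rightarrow> int \<Rightarrow> 'k::field set"
  where "trivial_grading l j = (if j + l = 0 then UNIV else {0})"

definition graded_hom ::
    "('a, 'e) ring_scheme \<Rightarrow> ('a, 'm) module \<Rightarrow> (int \<Rightarrow> 'm set) \<Rightarrow> ('a, 'n) module
      \<Rightarrow> (int \<Rightarrow> 'n set) \<Rightarrow> int \<Rightarrow> ('m \<Rightarrow> 'n) set"
  where "graded_hom R M H N K j = {f \<in> module_hom R M N. \<forall>i. f ` H i \<subseteq> K (i + j)}"

definition graded_isomorphic ::
    "('a, 'e) ring_scheme \<Rightarrow> ('a, 'm) module \<Rightarrow> (int \<Rightarrow> 'm set) \<Rightarrow> ('a, 'n) module
      \<Rightarrow> (int \<Rightarrow> 'n set) \<Rightarrow> bool"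
  where "graded_isomorphic R M H N K \<longleftrightarrow>
    (\<exists>f \<in> module_hom R M N. bij_betw f (carrier M) (carrier N) \<and> (\<forall>j. f ` H j = K j))"

section \<open>Ext of the trivial module\<close>

text \<open>
  For a graded left module \<open>M\<close>, the graded right module of all left-linear maps \<open>M \<rightarrow> A\<close> that are
  finite sums of homogeneous ones, with \<open>(f a) x = f x \<cdot> a\<close>; as a record it is a left module over
  \<open>op_algebra A\<close>.
\<close>

definition dual_comp ::
    "('k, 'a) module \<Rightarrow> (nat \<Rightarrow> 'a set) \<Rightarrow> ('a, 'm) module \<Rightarrow> (int \<Rightarrow> 'm set) \<Rightarrow> int \<Rightarrow> ('m \<Rightarrow> 'a) set"
  where "dual_comp A G M H = graded_hom A M H (regular_module A) (int_grading A G)"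

definition dual_module ::
    "('k, 'a) module \<Rightarrow> (nat \<Rightarrow> 'a set) \<Rightarrow> ('a, 'm) module \<Rightarrow> (int \<Rightarrow> 'm set) \<Rightarrow> ('a, 'm \<Rightarrow> 'a) module"
  where "dual_module A G M H =
    \<lparr>carrier = {\<lambda>x \<in> carrier M. \<Oplus>\<^bsub>A\<^esub>j \<in> J. F j x |J F. finite J \<and> (\<forall>j \<in> J. F j \<in> dual_comp A G M H j)},
     monoid.mult = undefined, one = undefined,
     ring.zero = (\<lambda>x \<in> carrier M. \<zero>\<^bsub>A\<^esub>),
     add = (\<lambda>f g. \<lambda>x \<in> carrier M. f x \<oplus>\<^bsub>A\<^esub> g x),
     module.smult = (\<lambda>a f. \<lambda>x \<in> carrier M. f x \<otimes>\<^bsub>A\<^esub> a)\<rparr>"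

definition graded_resolution ::
    "('k::field, 'a) module \<Rightarrow> (nat \<Rightarrow> 'a set) \<Rightarrow> (nat \<Rightarrow> ('a, 'u) module) \<Rightarrow> (nat \<Rightarrow> int \<Rightarrow> 'u set)
      \<Rightarrow> (nat \<Rightarrow> 'u \<Rightarrow> 'u) \<Rightarrow> ('u \<Rightarrow> 'k) \<Rightarrow> bool"
  where "graded_resolution A G P H D \<epsilon> \<longleftrightarrow>
    projective_resolution A P D \<epsilon> (trivial_module A G) \<and>
    (\<forall>i. graded_module A G (P i) (H i)) \<and>
    (\<forall>i j. D i ` H (Suc i) j \<subseteq> H i j) \<and>
    (\<forall>j. \<epsilon> ` H 0 j \<subseteq> trivial_grading 0 j)"

text \<open>The cohomology of the complex \<open>Hom(P 0, A) \<rightarrow> Hom(P 1, A) \<rightarrow> \<dots>\<close>.\<close>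

definition Ext_cocycles ::
    "('k, 'a) module \<Rightarrow> (nat \<Rightarrow> 'a set) \<Rightarrow> (nat \<Rightarrow> ('a, 'u) module) \<Rightarrow> (nat \<Rightarrow> int \<Rightarrow> 'u set)
      \<Rightarrow> (nat \<Rightarrow> 'u \<Rightarrow> 'u) \<Rightarrow> nat \<Rightarrow> ('u \<Rightarrow> 'a) set"
  where "Ext_cocycles A G P H D i =
    {f \<in> carrier (dual_module A G (P i) (H i)). \<forall>x \<in> carrier (P (Suc i)). f (D i x) = \<zero>\<^bsub>A\<^esub>}"

definition Ext_coboundaries ::
    "('k, 'a) module \<Rightarrow> (nat \<Rightarrow> 'a set) \<Rightarrow> (nat \<Rightarrow> ('a, 'u) module) \<Rightarrow> (nat \<Rightarrow> int \<Rightarrow> 'u set)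
      \<Rightarrow> (nat \<Rightarrow> 'u \<Rightarrow> 'u) \<Rightarrow> nat \<Rightarrow> ('u \<Rightarrow> 'a) set"
  where "Ext_coboundaries A G P H D i = (case i of
      0 \<Rightarrow> {\<zero>\<^bsub>dual_module A G (P 0) (H 0)\<^esub>}
    | Suc h \<Rightarrow> {\<lambda>x \<in> carrier (P i). g (D h x) |g. g \<in> carrier (dual_module A G (P h) (H h))})"

definition Ext_module ::
    "('k, 'a) module \<Rightarrow> (nat \<Rightarrow> 'a set) \<Rightarrow> (nat \<Rightarrow> ('a, 'u) module) \<Rightarrow> (nat \<Rightarrow> int \<Rightarrow> 'u set)
      \<Rightarrow> (nat \<Rightarrow> 'u \<Rightarrow> 'u) \<Rightarrow> nat \<Rightarrow> ('a, ('u \<Rightarrow> 'a) set) module"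
  where "Ext_module A G P H D i =
    quotient_by ((dual_module A G (P i) (H i))\<lparr>carrier := Ext_cocycles A G P H D i\<rparr>)
      (Ext_coboundaries A G P H D i)"

definition Ext_grading ::
    "('k, 'a) module \<Rightarrow> (nat \<Rightarrow> 'a set) \<Rightarrow> (nat \<Rightarrow> ('a, 'u) module) \<Rightarrow> (nat \<Rightarrow> int \<Rightarrow> 'u set)
      \<Rightarrow> (nat \<Rightarrow> 'u \<Rightarrow> 'u) \<Rightarrow> nat \<Rightarrow> int \<Rightarrow> ('u \<Rightarrow> 'a) set set"
  where "Ext_grading A G P H D i j =
    (\<lambda>f. Ext_coboundaries A G P H D i +>\<^bsub>dual_module A G (P i) (H i)\<^esub> f) `
      (Ext_cocycles A G P H D i \<inter> dual_comp A G (P i) (H i) j)"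

text \<open>
  \<open>Ext\<^sup>i(k, A)\<close> for left modules is \<open>0\<close> for \<open>i \<noteq> d\<close> and \<open>k(l)\<close> for \<open>i = d\<close>. As usual, Ext may be computed
  from any graded projective resolution of \<open>k\<close>.
\<close>

definition Ext_condition ::
    "'u itself \<Rightarrow> ('k::field, 'a) module \<Rightarrow> (nat \<Rightarrow> 'a set) \<Rightarrow> nat \<Rightarrow> int \<Rightarrow> bool"
  where "Ext_condition _ A G d l \<longleftrightarrow>
    (\<exists>(P :: nat \<Rightarrow> ('a, 'u) module) H D \<epsilon>. graded_resolution A G P H D \<epsilon> \<and>
      (\<forall>i. i \<noteq> d \<longrightarrow> carrier (Ext_module A G P H D i) = {\<zero>\<^bsub>Ext_module A G P H D i\<^esub>}) \<and>
      graded_isomorphic (op_algebra A) (Ext_module A G P H D d) (Ext_grading A G P H D d)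
        (trivial_module (op_algebra A) G) (trivial_grading l))"

definition AS_regular ::
    "'u itself \<Rightarrow> ('k::field, 'a) module \<Rightarrow> (nat \<Rightarrow> 'a set) \<Rightarrow> nat \<Rightarrow> bool"
  where "AS_regular U A G d \<longleftrightarrow>
    connected_graded A G \<and>
    left_gldim U A = enat d \<and> left_gldim U (op_algebra A) = enat d \<and>
    gk_dim A < \<infinity> \<and>
    (\<exists>l. Ext_condition U A G d l \<and> Ext_condition U (op_algebra A) G d l)"

end

theory Submission
  imports Defs
begin

text \<open>
  Reading the letter at position \<open>i\<close> of a word through the \<open>i\<close>-th power of the cyclic permutation
  \<open>x \<rightarrow> y \<rightarrow> z \<rightarrow> x\<close> turns the relations of \<open>S\<^bsub>q,0,1\<^esub>\<close> into \<open>X Y = -q Y X\<close>, \<open>Y Z = -q Z Y\<close>, \<open>Z X = -q X Z\<close>.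
  Hence a word is a scalar multiple of a monomial in \<open>\<nat>\<^sup>3\<close>, and words with the same exponent vector are
  proportional. The same reading shows that a word has degree \<open>e\<close> in \<open>\<Delta>\<^sub>n\<close> iff its exponent vector lies in
  \<open>3n \<nat>\<^sup>3\<close>; as \<open>u, v, w\<close> are the cubes of \<open>X, Y, Z\<close>, the identity component is the skew polynomial ring in
  \<open>u\<^sup>n, v\<^sup>n, w\<^sup>n\<close>.

  Regularity is proved for every algebra with a basis of monomials \<open>X\<^sup>a\<close>, \<open>a \<in> \<nat>\<^sup>3\<close>, whose product is
  twisted by a bicharacter. Every module \<open>M\<close> has the Koszul resolution \<open>A \<otimes> \<Lambda> \<otimes> M\<close>; this complex and the dual
  of the one for \<open>k\<close> are cubes of operators, each of which admits division with remainder in one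
  variable, and this yields exactness. The opposite algebra has the same form, so that one side suffices.
\<close>

text \<open>The cyclic permutation has order 3 and preserves the bicharacter, so the passage from
  words to monomials is a Zhang twist: it is linear but not multiplicative, since a word of length m
  shifts the reading of what follows by the m-th power of the permutation. In degrees divisible by 3
  the shift disappears, and the identity component is an untwisted skew polynomial ring. Commuting
  the 3n-th powers of two variables costs (-q)^(9 n^2), and p = -q^(-9) = (-q)^(-9) turns this
  scalar into p^(-n^2). Two features of the definitions shape the regularity proof. Global dimension
  ranges over all modules in \<open>'u\<close>, whereas polynomials need coefficients in a
  type-class group; hence the coefficients always form a type, and an arbitrary module is cut out of
  it by an idempotent. Projective dimension admits every projective resolution, so the lower bound 3
  comes from comparing a hypothetical shorter resolution with the Koszul one: it would split the
  last Koszul differential, whose entries have no constant term.\<close>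

abbreviation "single \<equiv> Poly_Mapping.single"
abbreviation "lookup \<equiv> Poly_Mapping.lookup"
abbreviation "keys \<equiv> Poly_Mapping.keys"

section \<open>Linear extension of maps from monomials\<close>

lemma single_add_induct [case_names zero add]:
  fixes f :: "'b \<Rightarrow>\<^sub>0 'w::comm_monoid_add"
  assumes "P 0"
    and "\<And>b w f. b \<notin> keys f \<Longrightarrow> w \<noteq> 0 \<Longrightarrow> P f \<Longrightarrow> P (single b w + f)"
  shows "P f"
proof (induction f rule: update_induct)
  case const
  then show ?case by (rule assms(1))
next
  case (update f b w)
  have "Poly_Mapping.update b w f = single b w + f"
    using update(1) by (intro poly_mapping_eqI)
      (auto simp: lookup_update lookup_add lookup_single in_keys_iff when_def)
  with update assms(2) show ?case by metis
qed

lemma keys_single_add: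
  fixes f :: "'b \<Rightarrow>\<^sub>0 'w::comm_monoid_add"
  assumes "b \<notin> keys f" "w \<noteq> 0"
  shows "keys (single b w + f) = insert b (keys f)"
  using assms by (auto simp: in_keys_iff lookup_add lookup_single when_def split: if_splits)

lemma keys_diff_subset:
  fixes f g :: "'b \<Rightarrow>\<^sub>0 'w::ab_group_add"
  shows "keys (f - g) \<subseteq> keys f \<union> keys g"
  by (auto simp: in_keys_iff lookup_minus)

text \<open>Meant for \<open>\<phi> b\<close> additive in the coefficient, so that operators on the
  coefficients are covered as well as scalar multiples.\<close>

definition lext :: "('b \<Rightarrow> 'w::zero \<Rightarrow> 'v::comm_monoid_add) \<Rightarrow> ('b \<Rightarrow>\<^sub>0 'w) \<Rightarrow> 'v"
  where "lext \<phi> f = (\<Sum>b\<in>keys f. \<phi> b (lookup f b))"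

lemma additive_comp: "additive f \<Longrightarrow> additive g \<Longrightarrow> additive (\<lambda>x. f (g x))"
  by (simp add: additive_def)

lemma additive_plus: "additive f \<Longrightarrow> additive g \<Longrightarrow> additive (\<lambda>x. f x + g x)"
  by (simp add: additive_def algebra_simps)

lemma additive_diff: "additive f \<Longrightarrow> additive g \<Longrightarrow> additive (\<lambda>x. f x - g x)"
  by (simp add: additive_def algebra_simps)

lemma additive_id: "additive (\<lambda>x. x)"
  by (simp add: additive_def)

lemma additive_0: "additive (\<lambda>x. 0)"
  by (simp add: additive_def)

lemma additive_single: "additive (single b)"
  by (simp add: additive_def single_add)

lemma additive_lookup: "additive (\<lambda>f. lookup f b)"
  by (simp add: additive_def lookup_add)

lemma lext_superset:
  assumes "\<And>b. \<phi> b 0 = 0" "finite S" "keys f \<subseteq> S"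
  shows "lext \<phi> f = (\<Sum>b\<in>S. \<phi> b (lookup f b))"
  unfolding lext_def using assms by (intro sum.mono_neutral_left) (auto simp: in_keys_iff)

lemma additive_lext:
  fixes \<phi> :: "'b \<Rightarrow> 'w::ab_group_add \<Rightarrow> 'v::ab_group_add"
  assumes "\<And>b. additive (\<phi> b)"
  shows "additive (lext \<phi>)"
proof
  fix f g :: "'b \<Rightarrow>\<^sub>0 'w"
  have z: "\<phi> b 0 = 0" for b using additive.zero[OF assms] .
  let ?S = "keys f \<union> keys g"
  have k: "keys (f + g) \<subseteq> ?S" by (rule keys_add)
  show "lext \<phi> (f + g) = lext \<phi> f + lext \<phi> g"
    unfolding lext_superset[where \<phi>=\<phi>, OF z _ k, simplified]
      lext_superset[where \<phi>=\<phi> and S = ?S and f = f, OF z, simplified]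
      lext_superset[where \<phi>=\<phi> and S = ?S and f = g, OF z, simplified]
    by (simp add: lookup_add additive.add[OF assms] sum.distrib)
qed

lemma lext_single [simp]:
  assumes "\<phi> b 0 = 0"
  shows "lext \<phi> (single b w) = \<phi> b w"
  using assms by (cases "w = 0") (simp_all add: lext_def)

lemma lext_zero [simp]: "lext \<phi> 0 = 0"
  by (simp add: lext_def)

text \<open>Additive maps are determined by their values on single terms. Identities of twisted
  products follow by applying this rule once for each argument.\<close>

lemma additive_eqI:
  assumes "additive S" "additive T"
    and "\<And>b w. b \<in> keys f \<Longrightarrow> S (single b w) = T (single b w)"
  shows "S f = T f"
  using assms(3)
proof (induction f rule: single_add_induct)
  case zero
  show ?case using additive.zero[OF assms(1)] additive.zero[OF assms(2)] by simp
next
  case (add b w f)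
  then show ?case
    by (simp add: keys_single_add additive.add[OF assms(1)] additive.add[OF assms(2)])
qed

section \<open>Exactness of cubes of operators with division\<close>

section \<open>Cubes of operators with division with remainder\<close>

text \<open>The pattern of division by a monic polynomial in one variable: \<open>T\<close> acts
  injectively on the elements satisfying \<open>D\<close>, and \<open>R\<close> singles out the
  remainders, a complement of its image.\<close>

definition split_op :: "('f::ab_group_add \<Rightarrow> bool) \<Rightarrow> ('f \<Rightarrow> bool) \<Rightarrow> ('f \<Rightarrow> 'f) \<Rightarrow> bool"
  where "split_op D R T \<longleftrightarrow> additive T \<and> (\<forall>f. D f \<longrightarrow> D (T f)) \<and>
    (\<forall>f. D f \<longrightarrow> (\<exists>g r. D g \<and> R r \<and> f = T g + r)) \<and>
    (\<forall>g r. D g \<longrightarrow> R r \<longrightarrow> T g + r = 0 \<longrightarrow> g = 0 \<and> r = 0)"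

lemma split_op_additive: "split_op D R T \<Longrightarrow> additive T"
  and split_op_closed: "split_op D R T \<Longrightarrow> D f \<Longrightarrow> D (T f)"
  and split_op_divide: "split_op D R T \<Longrightarrow> D f \<Longrightarrow> \<exists>g r. D g \<and> R r \<and> f = T g + r"
  and split_op_unique: "split_op D R T \<Longrightarrow> D g \<Longrightarrow> R r \<Longrightarrow> T g + r = 0 \<Longrightarrow> g = 0 \<and> r = 0"
  unfolding split_op_def by blast+

text \<open>
  The operator on the edge of the cube that removes the direction \<open>i\<close> from the vertex \<open>S\<close> is called
  \<open>tS_i\<close> (\<open>ti\<close> when \<open>S = {i}\<close>); signs are part of the operators, so that the squares anticommute.
\<close>

locale cube =
  fixes t123_1 t123_2 t123_3 t12_1 t12_2 t13_1 t13_3 t23_2 t23_3 t1 t2 t3 :: "'f::ab_group_add \<Rightarrow> 'f"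
    and R1 R2 R3 :: "'f \<Rightarrow> bool"
  assumes R3_diff: "R3 f \<Longrightarrow> R3 g \<Longrightarrow> R3 (f - g)" and R3_add: "R3 f \<Longrightarrow> R3 g \<Longrightarrow> R3 (f + g)"
    and R_0: "R1 0" "R2 0" "R3 0" and R2_R3: "R2 f \<Longrightarrow> R3 f"
    and s3: "split_op (\<lambda>_. True) R3 t123_3" "split_op (\<lambda>_. True) R3 t13_3"
      "split_op (\<lambda>_. True) R3 t23_3" "split_op (\<lambda>_. True) R3 t3"
    and s2: "split_op R3 R2 t12_2" "split_op R3 R2 t2"
    and s1: "split_op R2 R1 t1"
    and add: "additive t123_2" "additive t123_1" "additive t12_1" "additive t13_1" "additive t23_2"
    and t12_1: "R3 f \<Longrightarrow> R3 (t12_1 f)"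
    and sq: "t1 (t12_2 f) + t2 (t12_1 f) = 0" "t1 (t13_3 f) + t3 (t13_1 f) = 0"
      "t2 (t23_3 f) + t3 (t23_2 f) = 0"
      "t12_2 (t123_3 f) + t13_3 (t123_2 f) = 0" "t12_1 (t123_3 f) + t23_3 (t123_1 f) = 0"
      "t13_1 (t123_2 f) + t23_2 (t123_1 f) = 0"
begin

lemmas ad = add[THEN additive.add] s3[THEN split_op_additive, THEN additive.add]
  s2[THEN split_op_additive, THEN additive.add] s1[THEN split_op_additive, THEN additive.add]
lemmas df = add[THEN additive.diff] s3[THEN split_op_additive, THEN additive.diff]
  s2[THEN split_op_additive, THEN additive.diff] s1[THEN split_op_additive, THEN additive.diff]

text \<open>Divide by \<open>t3\<close>, the remainder by \<open>t2\<close>, and the new remainder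
  by \<open>t1\<close>.\<close>

lemma exact_0: "\<exists>f1 f2 f3 r. R1 r \<and> f = t1 f1 + t2 f2 + t3 f3 + r"
proof -
  obtain f3 r3 where 3: "R3 r3" "f = t3 f3 + r3" using split_op_divide[OF s3(4), of f] by blast
  obtain f2 r2 where 2: "R2 r2" "r3 = t2 f2 + r2" using split_op_divide[OF s2(2) 3(1)] by blast
  obtain f1 r1 where 1: "R1 r1" "r2 = t1 f1 + r1" using split_op_divide[OF s1 2(1)] by blast
  have "f = t1 f1 + t2 f2 + t3 f3 + r1" using 1 2 3 by (simp add: algebra_simps)
  with 1(1) show ?thesis by blast
qed

text \<open>A cycle is reduced modulo boundaries until its entries are so small that uniqueness of
  division forces them to vanish.\<close>

lemma exact_1:
  assumes "t1 f1 + t2 f2 + t3 f3 = 0"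
  shows "\<exists>g12 g13 g23. f1 = t12_2 g12 + t13_3 g13 \<and> f2 = t12_1 g12 + t23_3 g23 \<and>
    f3 = t13_1 g13 + t23_2 g23"
proof -
  obtain g13 r1 where 1: "R3 r1" "f1 = t13_3 g13 + r1"
    using split_op_divide[OF s3(2), of f1] by blast
  obtain g23 r2 where 2: "R3 r2" "f2 = t23_3 g23 + r2"
    using split_op_divide[OF s3(3), of f2] by blast
  \<comment> \<open>The quotient \<open>g12\<close> lies in \<open>R3\<close>, so subtracting its
    boundary keeps the second entry in \<open>R3\<close> as well, because \<open>t12_1\<close>
    preserves that predicate.\<close>
  obtain g12 q1 where q: "R3 g12" "R2 q1" "r1 = t12_2 g12 + q1"
    using split_op_divide[OF s2(1) 1(1)] by blast
  define f2' where "f2' = r2 - t12_1 g12"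
  define f3' where "f3' = f3 - t13_1 g13 - t23_2 g23"
  have R: "R3 f2'" unfolding f2'_def by (intro R3_diff 2 t12_1 q)
  have "t1 q1 + t2 f2' + t3 f3' = (t1 f1 + t2 f2 + t3 f3) - (t1 (t13_3 g13) + t3 (t13_1 g13))
    - (t1 (t12_2 g12) + t2 (t12_1 g12)) - (t2 (t23_3 g23) + t3 (t23_2 g23))"
    unfolding f2'_def f3'_def 1(2) 2(2) q(3) by (simp add: ad df algebra_simps)
  then have e: "t1 q1 + t2 f2' + t3 f3' = 0" by (simp add: assms sq)
  \<comment> \<open>The first two entries now contribute only a remainder of \<open>t3\<close>,
    hence the third entry vanishes. The same argument with \<open>t2\<close> and then with
    \<open>t1\<close> removes the other two.\<close>
  have "R3 (t1 q1 + t2 f2')"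
    by (rule R3_add[OF R2_R3[OF split_op_closed[OF s1 q(2)]] split_op_closed[OF s2(2) R]])
  moreover have "t3 f3' + (t1 q1 + t2 f2') = 0" using e by (simp add: algebra_simps)
  ultimately have "f3' = 0" "t1 q1 + t2 f2' = 0" using split_op_unique[OF s3(4)] by blast+
  moreover from this have "t2 f2' + t1 q1 = 0" by (simp add: algebra_simps)
  ultimately have "f2' = 0" "t1 q1 = 0"
    using split_op_unique[OF s2(2) R split_op_closed[OF s1 q(2)]] by blast+
  then have "q1 = 0" using split_op_unique[OF s1 q(2) R_0(1)] by simp
  from \<open>f2' = 0\<close> \<open>f3' = 0\<close> \<open>q1 = 0\<close> 1 2 q(3) show ?thesis
    unfolding f2'_def f3'_def
    by (intro exI[of _ g12] exI[of _ g13] exI[of _ g23]) (simp add: algebra_simps)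
qed

text \<open>Once the first entry is a remainder \<open>r\<close> of \<open>t123_3\<close>, the first
  equation splits into \<open>f13' = 0\<close> and \<open>t12_2 r = 0\<close>; injectivity of
  \<open>t12_2\<close> on \<open>R3\<close> and of \<open>t23_3\<close> does the rest.\<close>

lemma exact_2:
  assumes "t12_2 f12 + t13_3 f13 = 0" "t12_1 f12 + t23_3 f23 = 0"
  shows "\<exists>g. f12 = t123_3 g \<and> f13 = t123_2 g \<and> f23 = t123_1 g"
proof -
  obtain g r where g: "R3 r" "f12 = t123_3 g + r" using split_op_divide[OF s3(1), of f12] by blast
  define f13' where "f13' = f13 - t123_2 g"
  define f23' where "f23' = f23 - t123_1 g"
  have "t13_3 f13' + t12_2 r = (t12_2 f12 + t13_3 f13) - (t12_2 (t123_3 g) + t13_3 (t123_2 g))"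
    unfolding f13'_def g(2) by (simp add: ad df algebra_simps)
  then have "t13_3 f13' + t12_2 r = 0" by (simp add: assms sq)
  then have 1: "f13' = 0" "t12_2 r = 0"
    using split_op_unique[OF s3(2) _ split_op_closed[OF s2(1) g(1)]] by blast+
  then have r: "r = 0" using split_op_unique[OF s2(1) g(1) R_0(2)] by simp
  have "t23_3 f23' + 0 = (t12_1 f12 + t23_3 f23) - (t12_1 (t123_3 g) + t23_3 (t123_1 g))"
    unfolding f23'_def g(2) r by (simp add: ad df algebra_simps)
  then have "t23_3 f23' + 0 = 0" by (simp only: assms sq diff_self)
  then have "f23' = 0" using split_op_unique[OF s3(3) _ R_0(3)] by blast
  with 1 g r show ?thesis unfolding f13'_def f23'_def by auto
qed

lemma exact_3: "t123_3 f = 0 \<Longrightarrow> f = 0"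
  using split_op_unique[OF s3(1) _ R_0(3), of f] by simp

end

section \<open>Shift operators\<close>

type_synonym expo = "nat \<times> nat \<times> nat"
type_synonym 'l poly3 = "(expo \<Rightarrow>\<^sub>0 'l) \<times> (expo \<Rightarrow>\<^sub>0 'l) \<times> (expo \<Rightarrow>\<^sub>0 'l)"

text \<open>Every index other than 1 and 2 stands for the third coordinate, here and in
  \<open>coord\<close>, so that the lemmas hold for all \<open>i\<close> without a range
  condition.\<close>

definition unit_vec :: "nat \<Rightarrow> expo"
  where "unit_vec i = (if i = 1 then (1, 0, 0) else if i = 2 then (0, 1, 0) else (0, 0, 1))"

definition coord :: "nat \<Rightarrow> expo \<Rightarrow> nat"
  where "coord i b = (if i = 1 then fst b else if i = 2 then fst (snd b) else snd (snd b))"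

lemma coord_add_unit_vec: "coord i (b + unit_vec i) = Suc (coord i b)"
  by (cases b) (auto simp: coord_def unit_vec_def)

lemma coord_pos: "0 < coord i b \<Longrightarrow> \<exists>b'. b = b' + unit_vec i"
proof (cases b)
  case (fields x y z)
  assume "0 < coord i b"
  then have "b = (if i = 1 then (x - 1, y, z) else if i = 2 then (x, y - 1, z) else (x, y, z - 1)) + unit_vec i"
    by (auto simp: fields coord_def unit_vec_def)
  then show ?thesis by blast
qed

locale kspace = vector_space scale
  for scale :: "'k::field \<Rightarrow> 'w::ab_group_add \<Rightarrow> 'w"
begin

text \<open>Multiplication by the i-th variable up to scalars, minus an operator on the
  coefficients. With \<open>t\<close> the action of the variable on a module this is an edge of the
  Koszul complex; with \<open>t = 0\<close> it is an edge of the dual one.\<close>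

definition shift_op :: "nat \<Rightarrow> (expo \<Rightarrow> 'k) \<Rightarrow> ('w \<Rightarrow> 'w) \<Rightarrow> (expo \<Rightarrow>\<^sub>0 'w) \<Rightarrow> (expo \<Rightarrow>\<^sub>0 'w)"
  where "shift_op i r t =
    lext (\<lambda>b w. single (b + unit_vec i) (scale (r b) w) - single b (t w))"

lemma additive_scale: "additive (scale c)"
  by (simp add: additive_def scale_right_distrib)

context
  fixes i :: nat and r :: "expo \<Rightarrow> 'k" and t :: "'w \<Rightarrow> 'w"
  assumes t: "additive t"
begin

lemma additive_shift_summand:
  "additive (\<lambda>w. single (b + unit_vec i) (scale (r b) w) - single b (t w))"
  by (intro additive_diff additive_comp[OF additive_single] additive_scale t)

lemma additive_shift_op: "additive (shift_op i r t)"
  unfolding shift_op_def by (rule additive_lext[OF additive_shift_summand])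

lemma shift_op_single:
  "shift_op i r t (single b w) =
    single (b + unit_vec i) (scale (r b) w) - single b (t w)"
  unfolding shift_op_def using additive.zero[OF additive_shift_summand] by (intro lext_single)

lemma lookup_shift_op:
  "lookup (shift_op i r t f) (b + unit_vec i) = scale (r b) (lookup f b) - t (lookup f (b + unit_vec i))"
proof (rule additive_eqI[of "\<lambda>f. lookup (shift_op i r t f) (b + unit_vec i)"])
  show "additive (\<lambda>f. lookup (shift_op i r t f) (b + unit_vec i))"
    by (intro additive_comp[OF additive_lookup] additive_shift_op)
  show "additive (\<lambda>f. scale (r b) (lookup f b) - t (lookup f (b + unit_vec i)))"
    by (intro additive_diff additive_comp[OF additive_scale] additive_comp[OF t] additive_lookup)
  show "lookup (shift_op i r t (single c w)) (b + unit_vec i) =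
     scale (r b) (lookup (single c w) b) - t (lookup (single c w) (b + unit_vec i))"
    for c w
    by (simp add: shift_op_single lookup_minus lookup_single when_def additive.zero[OF t])
qed

lemma keys_shift_op:
  assumes "keys f \<subseteq> S" "\<And>b. b \<in> S \<Longrightarrow> b + unit_vec i \<in> S"
  shows "keys (shift_op i r t f) \<subseteq> S"
  using assms(1)
proof (induction f rule: single_add_induct)
  case zero
  show ?case by (simp add: additive.zero[OF additive_shift_op])
next
  case (add b w f)
  have "keys (shift_op i r t (single b w)) \<subseteq> S"
    unfolding shift_op_single using add.prems assms(2)[of b]
    by (intro order_trans[OF keys_diff_subset]) (auto simp: keys_single_add[OF add.hyps])
  moreover have "keys (shift_op i r t f) \<subseteq> S" using add by (simp add: keys_single_add)
  ultimately show ?case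
    unfolding additive.add[OF additive_shift_op] by (intro order_trans[OF keys_add]) auto
qed

text \<open>The operator is of degree one in the i-th variable, with invertible leading coefficients
  \<open>r b\<close>, and \<open>t\<close> contributes only terms of lower degree. So division works
  as for a monic polynomial, with remainders free of that variable.\<close>

lemma split_op_shift_op:
  assumes r: "\<And>b. r b \<noteq> 0" and S: "\<And>b. b + unit_vec i \<in> S \<longleftrightarrow> b \<in> S"
  shows "split_op (\<lambda>f. keys f \<subseteq> S) (\<lambda>f. keys f \<subseteq> {b \<in> S. coord i b = 0}) (shift_op i r t)"
  unfolding split_op_def
proof (intro conjI allI impI additive_shift_op)
  note a = additive.add[OF additive_shift_op] additive.zero[OF additive_shift_op]
  show "keys (shift_op i r t f) \<subseteq> S" if "keys f \<subseteq> S" for f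
    using keys_shift_op that S by blast
  have single: "\<exists>g f'. keys g \<subseteq> S \<and> keys f' \<subseteq> {b \<in> S. coord i b = 0} \<and>
      single b w = shift_op i r t g + f'" if "b \<in> S" for b w
    using that
  proof (induction "coord i b" arbitrary: b w)
    case 0
    then show ?case
      by (intro exI[of _ 0] exI[of _ "single b w"]) (auto simp: a)
  next
    case (Suc m)
    then obtain b' where b: "b = b' + unit_vec i" using coord_pos[of i b] by auto
    with Suc have b': "b' \<in> S" "coord i b' = m" using S by (auto simp: coord_add_unit_vec)
    \<comment> \<open>The quotient of the leading term. What is left over,
      \<open>single b' (t ?w)\<close>, has a smaller i-th exponent.\<close>
    let ?w = "scale (inverse (r b')) w"
    obtain g f' where g: "keys g \<subseteq> S" "keys f' \<subseteq> {b \<in> S. coord i b = 0}"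
      "single b' (t ?w) = shift_op i r t g + f'"
      using Suc(1)[of b' "t ?w"] b' by metis
    have "single b w = shift_op i r t (single b' ?w) + single b' (t ?w)"
      using r by (simp add: shift_op_single b)
    also have "\<dots> = shift_op i r t (single b' ?w + g) + f'"
      by (simp add: a g(3) add.assoc)
    finally show ?case using g(1,2) b'(1)
      by (intro exI[of _ "single b' ?w + g"] exI[of _ f'] conjI
          order_trans[OF keys_add]) auto
  qed
  show "\<exists>g f'. keys g \<subseteq> S \<and> keys f' \<subseteq> {b \<in> S. coord i b = 0} \<and> f = shift_op i r t g + f'"
    if "keys f \<subseteq> S" for f
    using that
  proof (induction f rule: single_add_induct)
    case zero
    show ?case by (intro exI[of _ 0]) (simp add: a)
  next
    case (add b w f)
    obtain g f' where 1: "keys g \<subseteq> S" "keys f' \<subseteq> {b \<in> S. coord i b = 0}" "f = shift_op i r t g + f'"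
      using add by (auto simp: keys_single_add)
    obtain g' f'' where 2: "keys g' \<subseteq> S" "keys f'' \<subseteq> {b \<in> S. coord i b = 0}"
      "single b w = shift_op i r t g' + f''"
      using single[of b w] add by (auto simp: keys_single_add)
    show ?case
      by (intro exI[of _ "g' + g"] exI[of _ "f'' + f'"] conjI order_trans[OF keys_add])
        (use 1 2 in \<open>auto simp: a algebra_simps\<close>)
  qed
  fix g f' assume f': "keys f' \<subseteq> {b \<in> S. coord i b = 0}" and eq: "shift_op i r t g + f' = 0"
  have g: "g = 0"
  proof (rule ccontr)
    assume "g \<noteq> 0"
    then have "keys g \<noteq> {}" by (auto simp: poly_mapping_eq_iff fun_eq_iff in_keys_iff)
    \<comment> \<open>At an exponent \<open>b\<close> of \<open>g\<close> with maximal i-th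
      coordinate the leading term of the product cannot cancel: neither the \<open>t\<close>-part
      nor \<open>f'\<close> reaches \<open>b + unit_vec i\<close>.\<close>
    define m where "m = Max (coord i ` keys g)"
    obtain b where b: "b \<in> keys g" "coord i b = m"
      using Max_in[of "coord i ` keys g"] \<open>keys g \<noteq> {}\<close>
      unfolding m_def imageE image_is_empty image_iff by (metis (no_types) finite_imageI finite_keys)
    have "coord i c \<le> m" if "c \<in> keys g" for c
      unfolding m_def using that by simp
    then have "b + unit_vec i \<notin> keys g" using b(2) coord_add_unit_vec[of i b] by fastforce
    moreover have "b + unit_vec i \<notin> keys f'" using f' coord_add_unit_vec[of i b] by auto
    ultimately have "lookup (shift_op i r t g + f') (b + unit_vec i) = scale (r b) (lookup g b)"
      by (simp add: lookup_add lookup_shift_op in_keys_iff additive.zero[OF t])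
    with eq b(1) r show False by (simp add: in_keys_iff)
  qed
  then show "g = 0" .
  show "f' = 0" using eq by (simp add: g a)
qed

end

text \<open>On a single term the two composites produce four exponents, with both variables added,
  with \<open>i\<close> only, with \<open>j\<close> only, and with none. The last four hypotheses
  are the vanishing of the respective coefficients, in this order.\<close>

lemma shift_op_anticommute:
  assumes t: "additive t" "additive t'" "additive u" "additive u'"
    and lin: "\<And>c w. t (scale c w) = scale c (t w)" "\<And>c w. u (scale c w) = scale c (u w)"
    and "\<And>b. r (b + unit_vec j) * r' b + s (b + unit_vec i) * s' b = 0"
    and "\<And>b w. scale (r b) (t' w) + u (scale (s' b) w) = 0"
    and "\<And>b w. scale (s b) (u' w) + t (scale (r' b) w) = 0"
    and "\<And>w. t (t' w) + u (u' w) = 0"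
  shows "shift_op i r t (shift_op j r' t' f) + shift_op j s u (shift_op i s' u' f) = 0"
proof (rule additive_eqI[of "\<lambda>f. shift_op i r t (shift_op j r' t' f) + shift_op j s u (shift_op i s' u' f)"
      "\<lambda>_. 0" f])
  show "additive (\<lambda>f. shift_op i r t (shift_op j r' t' f) + shift_op j s u (shift_op i s' u' f))"
    by (intro additive_plus additive_comp[OF additive_shift_op] additive_shift_op t)
  show "additive (\<lambda>_. 0)" by (rule additive_0)
  fix b w
  note si = t[THEN additive_shift_op, THEN additive.diff]
  have c: "b + unit_vec j + unit_vec i = b + unit_vec i + unit_vec j" by (simp add: algebra_simps)
  have "shift_op i r t (shift_op j r' t' (single b w)) +
      shift_op j s u (shift_op i s' u' (single b w)) =
    single (b + unit_vec i + unit_vec j)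
      (scale (r (b + unit_vec j) * r' b + s (b + unit_vec i) * s' b) w)
    - single (b + unit_vec i) (scale (r b) (t' w) + u (scale (s' b) w))
    - single (b + unit_vec j) (scale (s b) (u' w) + t (scale (r' b) w))
    + single b (t (t' w) + u (u' w))"
    unfolding shift_op_single[OF t(1)] shift_op_single[OF t(2)] shift_op_single[OF t(3)]
      shift_op_single[OF t(4)] si single_add single_diff scale_left_distrib scale_scale[symmetric] c
    by (simp add: algebra_simps)
  also have "\<dots> = 0" using assms(7-10) by simp
  finally show "shift_op i r t (shift_op j r' t' (single b w)) +
      shift_op j s u (shift_op i s' u' (single b w)) = 0" .
qed

end

section \<open>Twisted polynomials\<close>

lemma kspace_mult: "kspace ((*) :: 'k::field \<Rightarrow> 'k \<Rightarrow> 'k)"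
  by unfold_locales (simp_all add: algebra_simps)

locale bichar =
  fixes ch :: "expo \<Rightarrow> expo \<Rightarrow> 'k::field"
  assumes ch_add_left: "ch (a + b) c = ch a c * ch b c"
    and ch_add_right: "ch a (b + c) = ch a b * ch a c"
    and ch_nz [simp]: "ch a b \<noteq> 0"
begin

lemma ch_0 [simp]: "ch 0 b = 1" "ch a 0 = 1"
  using ch_add_left[of 0 0 b] ch_add_right[of a 0 0] by simp_all

end

lemma bichar_flip: "bichar ch \<Longrightarrow> bichar (\<lambda>a b. ch b a)"
  by (simp add: bichar_def mult.commute)

locale twist = bichar ch + kspace scale
  for ch :: "expo \<Rightarrow> expo \<Rightarrow> 'k::field" and scale :: "'k \<Rightarrow> 'w::ab_group_add \<Rightarrow> 'w"
begin

text \<open>The action of twisted polynomials, whose product is \<open>X\<^sup>a X\<^sup>b = ch a b X\<^bsup>a+b\<^esup>\<close>, on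
  polynomials with coefficients in a vector space.\<close>

definition tact :: "(expo \<Rightarrow>\<^sub>0 'k) \<Rightarrow> (expo \<Rightarrow>\<^sub>0 'w) \<Rightarrow> (expo \<Rightarrow>\<^sub>0 'w)"
  where "tact a f = lext (\<lambda>b c. lext (\<lambda>d w. single (b + d) (scale (c * ch b d) w)) f) a"

lemma additive_tact_summand: "additive (\<lambda>w. single (b + d) (scale (c * ch b d) w))"
  by (intro additive_comp[OF additive_single] additive_scale)

lemma additive_tact_row: "additive (\<lambda>c. lext (\<lambda>d w. single (b + d) (scale (c * ch b d) w)) f)"
proof
  fix c c'
  show "lext (\<lambda>d w. single (b + d) (scale ((c + c') * ch b d) w)) f =
    lext (\<lambda>d w. single (b + d) (scale (c * ch b d) w)) f +
    lext (\<lambda>d w. single (b + d) (scale (c' * ch b d) w)) f"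
    by (simp add: lext_def sum.distrib distrib_right scale_left_distrib single_add)
qed

lemma additive_tact_left: "additive (\<lambda>a. tact a f)"
  unfolding tact_def by (rule additive_lext[OF additive_tact_row])

lemma tact_single_left:
  "tact (single b c) f = lext (\<lambda>d w. single (b + d) (scale (c * ch b d) w)) f"
  unfolding tact_def using additive.zero[OF additive_tact_row] by (intro lext_single)

lemma additive_tact_right: "additive (tact a)"
proof
  fix f g
  have 1: "additive (\<lambda>a. tact a f + tact a g)" by (intro additive_plus additive_tact_left)
  show "tact a (f + g) = tact a f + tact a g"
    by (rule additive_eqI[OF additive_tact_left 1])
      (simp only: tact_single_left additive.add[OF additive_lext[OF additive_tact_summand]])
qed

lemma tact_single: "tact (single b c) (single d w) = single (b + d) (scale (c * ch b d) w)"
  unfolding tact_single_left using additive.zero[OF additive_tact_summand] by (intro lext_single)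

lemmas tact_add_left = additive.add[OF additive_tact_left]
lemmas tact_add_right = additive.add[OF additive_tact_right]
lemmas tact_zero_left [simp] = additive.zero[OF additive_tact_left]
lemmas tact_zero_right [simp] = additive.zero[OF additive_tact_right]
lemmas tact_diff_right = additive.diff[OF additive_tact_right]

lemma tact_one: "tact 1 f = f"
  unfolding single_one[symmetric]
  by (rule additive_eqI[OF additive_tact_right additive_id]) (simp add: tact_single del: single_one)

text \<open>The hypothesis on \<open>r\<close> says that \<open>r b\<close> is a constant times
  \<open>ch b (unit_vec i)\<close>, that is, the shift multiplies by the variable on the right; this
  commutes with multiplication on the left.\<close>

lemma tact_shift_op:
  assumes t: "additive t" "\<And>c w. t (scale c w) = scale c (t w)"
    and r: "\<And>a b. r (a + b) = ch a (unit_vec i) * r b"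
  shows "shift_op i r t (tact a f) = tact a (shift_op i r t f)"
proof -
  note s = additive_shift_op[OF t(1), of i r]
  have "shift_op i r t (tact (single b c) (single d w)) = tact (single b c) (shift_op i r t (single d w))"
    for b c d w
    by (simp add: tact_single tact_diff_right shift_op_single[OF t(1)] t(2) r ch_add_right ac_simps)
  then have "shift_op i r t (tact (single b c) f) = tact (single b c) (shift_op i r t f)" for b c
    by (rule additive_eqI[OF additive_comp[OF s additive_tact_right]
          additive_comp[OF additive_tact_right s]])
  then show ?thesis
    by (rule additive_eqI[OF additive_comp[OF s additive_tact_left] additive_tact_left])
qed

end

context bichar
begin

sublocale self: twist ch "(*)"
  by (intro twist.intro bichar_axioms kspace_mult)

abbreviation "tmul \<equiv> self.tact"

definition cc :: "nat \<Rightarrow> nat \<Rightarrow> 'k" where "cc i j = ch (unit_vec i) (unit_vec j)"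

lemma cc_nz [simp]: "cc i j \<noteq> 0" by (simp add: cc_def)

lemma tmul_single: "tmul (single b c) (single d w) = single (b + d) (c * ch b d * w)"
  by (rule self.tact_single)

end

context twist
begin

lemma tact_tmul: "tact (tmul a b) f = tact a (tact b f)"
proof -
  have "tact (tmul (single x c) (single y d)) (single z w) = tact (single x c) (tact (single y d) (single z w))"
    for x c y d z w
    by (simp only: tmul_single tact_single ch_add_left ch_add_right scale_scale add.assoc)
      (simp only: mult.assoc mult.commute mult.left_commute)
  then have "tact (tmul (single x c) (single y d)) f = tact (single x c) (tact (single y d) f)" for x c y d
    by (rule additive_eqI[OF additive_tact_right
          additive_comp[OF additive_tact_right additive_tact_right]])
  then have "tact (tmul (single x c) b) f = tact (single x c) (tact b f)" for x c
    by (rule additive_eqI[OF additive_comp[OF additive_tact_left self.additive_tact_right]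
          additive_comp[OF additive_tact_right additive_tact_left]])
  then show ?thesis
    by (rule additive_eqI[OF additive_comp[OF additive_tact_left self.additive_tact_left]
          additive_tact_left])
qed

end

text \<open>Exponents add commutatively, so reversing the product amounts to transposing the
  bicharacter.\<close>

lemma (in bichar) tmul_flip: "bichar.tmul (\<lambda>a b. ch b a) a b = tmul b a"
proof -
  interpret fl: bichar "\<lambda>a b. ch b a" by (rule bichar_flip[OF bichar_axioms])
  have "fl.tmul (single x c) (single y d) = tmul (single y d) (single x c)" for x c y d
    unfolding tmul_single fl.tmul_single add.commute[of x y]
    by (rule arg_cong[of _ _ "single (y + x)"]) (simp only: mult.commute mult.left_commute)
  then have "fl.tmul (single x c) b = tmul b (single x c)" for x c
    by (rule additive_eqI[OF fl.self.additive_tact_right self.additive_tact_left])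
  then show ?thesis
    by (rule additive_eqI[OF fl.self.additive_tact_left self.additive_tact_right])
qed

section \<open>The Koszul complex\<close>

text \<open>\<open>xop i\<close> is the action of the \<open>i\<close>-th variable on \<open>'w\<close>; the vectors fixed by the idempotent \<open>pr\<close> form
  the module to be resolved.\<close>

locale koszul = twist ch scale
  for ch :: "expo \<Rightarrow> expo \<Rightarrow> 'k::field" and scale :: "'k \<Rightarrow> 'w::ab_group_add \<Rightarrow> 'w" +
  fixes xop :: "nat \<Rightarrow> 'w \<Rightarrow> 'w" and pr :: "'w \<Rightarrow> 'w"
  assumes additive_xop: "additive (xop i)" and xop_scale: "xop i (scale c w) = scale c (xop i w)"
    and xop_comm: "scale (ch (unit_vec j) (unit_vec i)) (xop i (xop j w)) =
      scale (ch (unit_vec i) (unit_vec j)) (xop j (xop i w))"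
    and additive_pr: "additive pr" and pr_scale: "pr (scale c w) = scale c (pr w)"
    and pr_pr: "pr (pr w) = pr w" and pr_xop: "pr (xop i w) = xop i (pr w)"
begin

text \<open>On \<open>a \<otimes> w\<close> this is
  \<open>u (a x_i) \<otimes> w - v a \<otimes> (x_i w)\<close>; the factor
  \<open>ch b (unit_vec i)\<close> comes from multiplying the monomial on the right. Two scalars are
  needed because on the two sides of the tensor sign the variables of a relation are split off in
  opposite order.\<close>

definition kz :: "nat \<Rightarrow> 'k \<Rightarrow> 'k \<Rightarrow> (expo \<Rightarrow>\<^sub>0 'w) \<Rightarrow> (expo \<Rightarrow>\<^sub>0 'w)"
  where "kz i u v = shift_op i (\<lambda>b. u * ch b (unit_vec i)) (\<lambda>w. scale v (xop i w))"

lemma additive_sX: "additive (\<lambda>w. scale v (xop i w))"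
  by (rule additive_comp[OF additive_scale additive_xop])

lemma kz_single:
  "kz i u v (single b w) = single (b + unit_vec i) (scale (u * ch b (unit_vec i)) w) - single b (scale v (xop i w))"
  unfolding kz_def by (rule shift_op_single[OF additive_sX])

lemma additive_kz: "additive (kz i u v)"
  unfolding kz_def by (rule additive_shift_op[OF additive_sX])

lemma kz_tact: "kz i u v (tact a f) = tact a (kz i u v f)"
  unfolding kz_def
  by (rule tact_shift_op[OF additive_sX])
    (simp_all only: xop_scale scale_scale ch_add_left mult.commute mult.left_commute)

lemma kz_square:
  assumes "u * u' * cc j i + s * s' * cc i j = 0" "u * v' + z * s' = 0" "s * z' + v * u' = 0"
    "v * v' * cc i j + z * z' * cc j i = 0"
  shows "kz i u v (kz j u' v' f) + kz j s z (kz i s' z' f) = 0"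
  unfolding kz_def
proof (rule shift_op_anticommute[OF additive_sX additive_sX additive_sX additive_sX])
  fix b w
  have "u * ch (b + unit_vec j) (unit_vec i) * (u' * ch b (unit_vec j)) +
      s * ch (b + unit_vec i) (unit_vec j) * (s' * ch b (unit_vec i)) =
    ch b (unit_vec i) * ch b (unit_vec j) * (u * u' * cc j i + s * s' * cc i j)"
    by (simp only: ch_add_left cc_def algebra_simps)
  then show "u * ch (b + unit_vec j) (unit_vec i) * (u' * ch b (unit_vec j)) +
      s * ch (b + unit_vec i) (unit_vec j) * (s' * ch b (unit_vec i)) = 0" by (simp add: assms)
  have "scale (u * ch b (unit_vec i)) (scale v' (xop j w)) + scale z (xop j (scale (s' * ch b (unit_vec i)) w)) =
    scale (ch b (unit_vec i) * (u * v' + z * s')) (xop j w)"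
    by (simp only: xop_scale scale_scale scale_left_distrib[symmetric])
      (simp only: distrib_left mult.assoc mult.commute mult.left_commute)
  then show "scale (u * ch b (unit_vec i)) (scale v' (xop j w)) +
    scale z (xop j (scale (s' * ch b (unit_vec i)) w)) = 0" by (simp add: assms)
  have "scale (s * ch b (unit_vec j)) (scale z' (xop i w)) + scale v (xop i (scale (u' * ch b (unit_vec j)) w)) =
    scale (ch b (unit_vec j) * (s * z' + v * u')) (xop i w)"
    by (simp only: xop_scale scale_scale scale_left_distrib[symmetric])
      (simp only: distrib_left mult.assoc mult.commute mult.left_commute)
  then show "scale (s * ch b (unit_vec j)) (scale z' (xop i w)) +
    scale v (xop i (scale (u' * ch b (unit_vec j)) w)) = 0" by (simp add: assms)
  \<comment> \<open>Both orders of the action are brought to the same one, at the cost of the ratio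
    of the two twist factors.\<close>
  have "xop i (xop j w) = scale (inverse (cc j i)) (scale (cc j i) (xop i (xop j w)))" by simp
  also have "\<dots> = scale (inverse (cc j i) * cc i j) (xop j (xop i w))"
    by (simp only: cc_def xop_comm scale_scale)
  finally have "scale v (xop i (scale v' (xop j w))) + scale z (xop j (scale z' (xop i w))) =
      scale (v * v' * (inverse (cc j i) * cc i j) + z * z') (xop j (xop i w))"
    by (simp only: xop_scale scale_scale scale_left_distrib mult.assoc)
  also have "v * v' * (inverse (cc j i) * cc i j) + z * z' =
      inverse (cc j i) * (v * v' * cc i j + z * z' * cc j i)"
    by (simp add: distrib_left)
  finally have "scale v (xop i (scale v' (xop j w))) + scale z (xop j (scale z' (xop i w))) =
    scale (inverse (cc j i) * (v * v' * cc i j + z * z' * cc j i)) (xop j (xop i w))" .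
  then show "scale v (xop i (scale v' (xop j w))) + scale z (xop j (scale z' (xop i w))) = 0" by (simp add: assms)
qed (simp_all add: xop_scale mult.commute)

lemma split_op_kz:
  assumes "u \<noteq> 0" "\<And>b. b + unit_vec i \<in> S \<longleftrightarrow> b \<in> S"
  shows "split_op (\<lambda>f. keys f \<subseteq> S) (\<lambda>f. keys f \<subseteq> {b \<in> S. coord i b = 0}) (kz i u v)"
  unfolding kz_def using assms by (intro split_op_shift_op[OF additive_sX]) auto

text \<open>The scalars are chosen such that the squares of the Koszul cube anticommute; note that
  \<open>cc j i x\<^sub>i x\<^sub>j = cc i j x\<^sub>j x\<^sub>i\<close>.\<close>

abbreviation "k1 \<equiv> kz 1 1 1"
abbreviation "k2 \<equiv> kz 2 1 1"
abbreviation "k3 \<equiv> kz 3 1 1"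
abbreviation "k12_2 \<equiv> kz 2 (cc 1 2) (cc 2 1)"
abbreviation "k12_1 \<equiv> kz 1 (- cc 2 1) (- cc 1 2)"
abbreviation "k13_3 \<equiv> kz 3 (cc 1 3) (cc 3 1)"
abbreviation "k13_1 \<equiv> kz 1 (- cc 3 1) (- cc 1 3)"
abbreviation "k23_3 \<equiv> kz 3 (cc 2 3) (cc 3 2)"
abbreviation "k23_2 \<equiv> kz 2 (- cc 3 2) (- cc 2 3)"
abbreviation "k123_3 \<equiv> kz 3 (cc 1 3 * cc 2 3) (cc 3 1 * cc 3 2)"
abbreviation "k123_2 \<equiv> kz 2 (- (cc 1 2 * cc 3 2)) (- (cc 2 1 * cc 2 3))"
abbreviation "k123_1 \<equiv> kz 1 (cc 2 1 * cc 3 1) (cc 1 2 * cc 1 3)"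

end

text \<open>The exponents that may occur in the successive remainders of division by the third,
  second and first variable.\<close>

abbreviation "levels_3 \<equiv> {b. coord 3 b = 0}"
abbreviation "levels_2 \<equiv> {b \<in> levels_3. coord 2 b = 0}"
abbreviation "levels_1 \<equiv> {b \<in> levels_2. coord 1 b = 0}"

lemma levels_1: "levels_1 = {0}"
  by (auto simp: coord_def zero_prod_def)

lemma levels_closed: "b + unit_vec 2 \<in> levels_3 \<longleftrightarrow> b \<in> levels_3"
  "b + unit_vec 1 \<in> levels_3 \<longleftrightarrow> b \<in> levels_3" "b + unit_vec 1 \<in> levels_2 \<longleftrightarrow> b \<in> levels_2"
  by (cases b; auto simp: coord_def unit_vec_def)+

context koszul
begin

sublocale kc: cube k123_1 k123_2 k123_3 k12_1 k12_2 k13_1 k13_3 k23_2 k23_3 k1 k2 k3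
  "\<lambda>f. keys f \<subseteq> levels_1" "\<lambda>f. keys f \<subseteq> levels_2" "\<lambda>f. keys f \<subseteq> levels_3"
proof (unfold_locales, goal_cases)
  case (1 f g)
  then show ?case by (intro order_trans[OF keys_diff_subset]) auto
next
  case (2 f g)
  then show ?case by (intro order_trans[OF keys_add]) auto
next
  case (7)
  then show ?case using split_op_kz[of "cc 1 3 * cc 2 3" 3 UNIV] by simp
next
  case (8)
  then show ?case using split_op_kz[of "cc 1 3" 3 UNIV] by simp
next
  case (9)
  then show ?case using split_op_kz[of "cc 2 3" 3 UNIV] by simp
next
  case (10)
  then show ?case using split_op_kz[of 1 3 UNIV] by simp
next
  case 11
  then show ?case by (rule split_op_kz) (simp, rule levels_closed)
next
  case 12
  then show ?case by (rule split_op_kz) (simp, rule levels_closed)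
next
  case 13
  then show ?case by (rule split_op_kz) (simp, rule levels_closed)
next
  case (19 f)
  then show ?case unfolding kz_def
    by (rule keys_shift_op[OF additive_sX]) (simp only: levels_closed)
next
  case 20 show ?case by (rule kz_square) simp_all
next
  case 21 show ?case by (rule kz_square) simp_all
next
  case 22 show ?case by (rule kz_square) simp_all
next
  case 23 show ?case by (rule kz_square) simp_all
next
  case 24 show ?case by (rule kz_square) simp_all
next
  case 25 show ?case by (rule kz_square) simp_all
next
  case (6 f) then show ?case by (rule order_trans) blast
qed (simp, simp, simp, (rule additive.add[OF additive_kz])+)

text \<open>The entries of a triple are the coefficients of \<open>e\<^sub>1, e\<^sub>2, e\<^sub>3\<close> in degree 1 and of \<open>e\<^sub>1\<^sub>2, e\<^sub>1\<^sub>3, e\<^sub>2\<^sub>3\<close> in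
  degree 2; degrees 0 and 3 use the first entry only. The map \<open>dd i\<close> goes from degree \<open>i + 1\<close> to degree \<open>i\<close>.\<close>

definition dd :: "nat \<Rightarrow> 'w poly3 \<Rightarrow> 'w poly3"
  where "dd i = (\<lambda>(f, g, h).
    if i = 0 then (k1 f + k2 g + k3 h, 0, 0)
    else if i = 1 then (k12_2 f + k13_3 g, k12_1 f + k23_3 h, k13_1 g + k23_2 h)
    else if i = 2 then (k123_3 f, k123_2 f, k123_1 f) else 0)"

definition PR :: "(expo \<Rightarrow>\<^sub>0 'w) \<Rightarrow> (expo \<Rightarrow>\<^sub>0 'w)"
  where "PR = lext (\<lambda>b w. single b (pr w))"

definition PT :: "'w poly3 \<Rightarrow> 'w poly3"
  where "PT = map_prod PR (map_prod PR PR)"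

definition tactT :: "(expo \<Rightarrow>\<^sub>0 'k) \<Rightarrow> 'w poly3 \<Rightarrow> 'w poly3"
  where "tactT a = map_prod (tact a) (map_prod (tact a) (tact a))"

definition KC :: "nat \<Rightarrow> 'w poly3 set"
  where "KC i = {(f, g, h). (i = 1 \<or> i = 2 \<or> g = 0 \<and> h = 0) \<and> (i \<le> 3 \<or> f = 0)}"

definition KE :: "nat \<Rightarrow> 'w poly3 set"
  where "KE i = {z \<in> KC i. PT z = z}"

lemma additive_PR: "additive PR"
  unfolding PR_def by (rule additive_lext[OF additive_comp[OF additive_single additive_pr]])

lemma PR_single: "PR (single b w) = single b (pr w)"
  unfolding PR_def using additive.zero[OF additive_pr] by (intro lext_single) simp

lemma lookup_PR: "lookup (PR f) b = pr (lookup f b)"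
  by (rule additive_eqI[OF additive_comp[OF additive_lookup additive_PR]
      additive_comp[OF additive_pr additive_lookup]])
    (simp add: PR_single lookup_single when_def additive.zero[OF additive_pr])

lemma PR_PR: "PR (PR f) = PR f"
  by (rule poly_mapping_eqI) (simp add: lookup_PR pr_pr)

lemma PR_tact: "PR (tact a f) = tact a (PR f)"
proof -
  have "PR (tact (single b c) f) = tact (single b c) (PR f)" for b c
    by (rule additive_eqI[OF additive_comp[OF additive_PR additive_tact_right]
          additive_comp[OF additive_tact_right additive_PR]])
      (simp add: PR_single tact_single pr_scale)
  then show ?thesis
    by (rule additive_eqI[OF additive_comp[OF additive_PR additive_tact_left] additive_tact_left])
qed

lemma PR_kz: "PR (kz i u v f) = kz i u v (PR f)"
  by (rule additive_eqI[OF additive_comp[OF additive_PR additive_kz] additive_comp[OF additive_kz additive_PR]])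
    (simp add: PR_single kz_single additive.diff[OF additive_PR] pr_scale pr_xop)

lemma additive_PT: "additive PT"
  by (auto simp: additive_def PT_def additive.add[OF additive_PR])

lemma PT_PT: "PT (PT z) = PT z"
  by (cases z) (simp add: PT_def PR_PR)

lemma additive_dd: "additive (dd i)"
  by (auto simp: additive_def dd_def additive.add[OF additive_kz] zero_prod_def)

lemma PT_dd: "PT (dd i z) = dd i (PT z)"
  by (cases z) (auto simp: PT_def dd_def PR_kz additive.add[OF additive_PR] additive.zero[OF additive_PR] zero_prod_def)

lemma PT_tactT: "PT (tactT a z) = tactT a (PT z)"
  by (cases z) (simp add: PT_def tactT_def PR_tact)

lemma dd_tactT: "dd i (tactT a z) = tactT a (dd i z)"
  by (cases z) (auto simp: tactT_def dd_def kz_tact tact_add_right zero_prod_def)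

lemma PT_KC: "z \<in> KC i \<Longrightarrow> PT z \<in> KC i"
  by (auto simp: KC_def PT_def additive.zero[OF additive_PR])

lemma dd_KC: "z \<in> KC (Suc i) \<Longrightarrow> dd i z \<in> KC i"
  by (cases z) (auto simp: KC_def dd_def additive.zero[OF additive_kz] zero_prod_def split: if_splits)

lemma dd_KE: "z \<in> KE (Suc i) \<Longrightarrow> dd i z \<in> KE i"
  by (simp add: KE_def dd_KC PT_dd)

lemma zero_KE: "0 \<in> KE i"
  by (simp add: KE_def KC_def additive.zero[OF additive_PT]) (simp add: zero_prod_def)

lemma PT_KE: "z \<in> KC i \<Longrightarrow> PT z \<in> KE i"
  by (simp add: KE_def PT_KC PT_PT)

lemma dd_dd: "dd i (dd (Suc i) z) = 0"
proof (cases z)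
  case (fields f g h)
  note a = additive.add[OF additive_kz] additive.zero[OF additive_kz]
  consider "i = 0" | "i = 1" | "i \<ge> 2" by linarith
  then show ?thesis
  proof cases
    case 1
    have "k1 (k12_2 f + k13_3 g) + k2 (k12_1 f + k23_3 h) + k3 (k13_1 g + k23_2 h) =
      (k1 (k12_2 f) + k2 (k12_1 f)) + (k1 (k13_3 g) + k3 (k13_1 g)) + (k2 (k23_3 h) + k3 (k23_2 h))"
      by (simp only: a add.assoc add.commute add.left_commute)
    also have "\<dots> = 0" by (simp only: kc.sq add_0_left)
    finally show ?thesis by (simp add: fields 1 dd_def zero_prod_def)
  next
    case 2
    then show ?thesis using kc.sq[of f] by (simp add: fields dd_def zero_prod_def)
  next
    case 3
    then show ?thesis by (auto simp: fields dd_def zero_prod_def a)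
  qed
qed

text \<open>Exactness is first obtained with coefficients in all of \<open>'w\<close>, from the
  cube. Since \<open>PT\<close> commutes with the differential and fixes \<open>z\<close>, it
  carries any preimage to one in \<open>KE\<close>.\<close>

lemma dd_exact:
  assumes "z \<in> KE (Suc i)" "dd i z = 0"
  shows "\<exists>y \<in> KE (Suc (Suc i)). z = dd (Suc i) y"
proof -
  obtain f g h where z: "z = (f, g, h)" by (cases z)
  have "\<exists>y \<in> KC (Suc (Suc i)). z = dd (Suc i) y"
  proof -
    consider "i = 0" | "i = 1" | "i = 2" | "i > 2" by linarith
    then show ?thesis
    proof cases
      case 1
      then have "k1 f + k2 g + k3 h = 0" using assms(2) by (simp add: z dd_def zero_prod_def)
      from kc.exact_1[OF this] obtain a b d where
        "f = k12_2 a + k13_3 b" "g = k12_1 a + k23_3 d" "h = k13_1 b + k23_2 d" by blast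
      then show ?thesis by (intro bexI[of _ "(a, b, d)"]) (auto simp: z 1 dd_def KC_def)
    next
      case 2
      then have "k12_2 f + k13_3 g = 0" "k12_1 f + k23_3 h = 0"
        using assms(2) by (simp_all add: z dd_def zero_prod_def)
      from kc.exact_2[OF this] obtain a where "f = k123_3 a" "g = k123_2 a" "h = k123_1 a" by blast
      then show ?thesis using 2 by (intro bexI[of _ "(a, 0, 0)"]) (auto simp: z dd_def KC_def)
    next
      case 3
      then have "k123_3 f = 0" "g = 0" "h = 0"
        using assms by (auto simp: z dd_def KE_def KC_def zero_prod_def)
      with kc.exact_3 have "z = 0" by (auto simp: z zero_prod_def)
      then show ?thesis
        using zero_KE by (intro bexI[of _ 0]) (simp_all add: additive.zero[OF additive_dd] KE_def)
    next
      case 4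
      then have "z = 0" using assms(1) by (auto simp: z KE_def KC_def zero_prod_def)
      then show ?thesis
        using zero_KE by (intro bexI[of _ 0]) (simp_all add: additive.zero[OF additive_dd] KE_def)
    qed
  qed
  then obtain y where y: "y \<in> KC (Suc (Suc i))" "z = dd (Suc i) y" by blast
  have "z = PT z" using assms(1) by (simp add: KE_def)
  also have "\<dots> = dd (Suc i) (PT y)" by (simp add: y(2) PT_dd)
  finally show ?thesis using PT_KE[OF y(1)] by blast
qed

text \<open>Modulo boundaries only the last remainder of division by the three variables survives, a
  constant; the idempotent moves it to the fixed vectors.\<close>

lemma KE_0_decompose:
  assumes "z \<in> KE 0"
  shows "\<exists>y \<in> KE 1. \<exists>w. pr w = w \<and> z = dd 0 y + (single 0 w, 0, 0)"
proof -
  obtain f where z: "z = (f, 0, 0)" "PR f = f" using assms by (auto simp: KE_def KC_def PT_def)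
  obtain a b d r where r: "keys r \<subseteq> levels_1" "f = k1 a + k2 b + k3 d + r" using kc.exact_0 by blast
  have r0: "r = single 0 (lookup r 0)"
    using r(1) unfolding levels_1
    by (intro poly_mapping_eqI) (auto simp: lookup_single when_def in_keys_iff)
  define y where "y = (a, b, d)"
  have "z = dd 0 y + (single 0 (lookup r 0), 0, 0)"
    using r(2) r0 by (simp add: z y_def dd_def)
  then have "PT z = PT (dd 0 y) + PT (single 0 (lookup r 0), 0, 0)"
    by (simp only: additive.add[OF additive_PT])
  then have "z = dd 0 (PT y) + (single 0 (pr (lookup r 0)), 0, 0)"
    using assms by (simp add: KE_def PT_dd) (simp add: PT_def PR_single additive.zero[OF additive_PR])
  moreover have "PT y \<in> KE 1" by (rule PT_KE) (simp add: KC_def y_def)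
  ultimately show ?thesis using pr_pr by blast
qed

end

section \<open>Left multiplication by the variables\<close>

context bichar
begin

definition lz :: "nat \<Rightarrow> 'k \<Rightarrow> (expo \<Rightarrow>\<^sub>0 'k) \<Rightarrow> (expo \<Rightarrow>\<^sub>0 'k)"
  where "lz i u = self.shift_op i (\<lambda>b. u * ch (unit_vec i) b) (\<lambda>_. 0)"

lemma additive_lz: "additive (lz i u)"
  unfolding lz_def by (rule self.additive_shift_op[OF additive_0])

lemma lz_tmul: "lz i u f = tmul (single (unit_vec i) u) f"
  by (rule additive_eqI[OF additive_lz self.additive_tact_right])
    (simp add: lz_def self.shift_op_single[OF additive_0] tmul_single add.commute)

lemma lz_square:
  assumes "u * u' * cc i j + s * s' * cc j i = 0"
  shows "lz i u (lz j u' f) + lz j s (lz i s' f) = 0"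
  unfolding lz_def
proof (rule self.shift_op_anticommute[OF additive_0 additive_0 additive_0 additive_0])
  fix b
  have "u * ch (unit_vec i) (b + unit_vec j) * (u' * ch (unit_vec j) b) +
      s * ch (unit_vec j) (b + unit_vec i) * (s' * ch (unit_vec i) b) =
    ch (unit_vec i) b * ch (unit_vec j) b * (u * u' * cc i j + s * s' * cc j i)"
    by (simp only: ch_add_right cc_def algebra_simps)
  then show "u * ch (unit_vec i) (b + unit_vec j) * (u' * ch (unit_vec j) b) +
      s * ch (unit_vec j) (b + unit_vec i) * (s' * ch (unit_vec i) b) = 0" by (simp add: assms)
qed simp_all

lemma split_op_lz:
  assumes "u \<noteq> 0" "\<And>b. b + unit_vec i \<in> S \<longleftrightarrow> b \<in> S"
  shows "split_op (\<lambda>f. keys f \<subseteq> S) (\<lambda>f. keys f \<subseteq> {b \<in> S. coord i b = 0}) (lz i u)"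
  unfolding lz_def using assms by (intro self.split_op_shift_op[OF additive_0]) auto

text \<open>The dual of the Koszul complex is again a cube, with every vertex replaced by its complement.\<close>

sublocale lc: cube "lz 1 1" "lz 2 1" "lz 3 1" "lz 1 (- cc 3 1)" "lz 2 (- cc 3 2)" "lz 1 (- cc 2 1)"
  "lz 3 (cc 2 3)" "lz 2 (cc 1 2)" "lz 3 (cc 1 3)"
  "lz 1 (cc 2 1 * cc 3 1)" "lz 2 (- (cc 1 2 * cc 3 2))" "lz 3 (cc 1 3 * cc 2 3)"
  "\<lambda>f. keys f \<subseteq> levels_1" "\<lambda>f. keys f \<subseteq> levels_2" "\<lambda>f. keys f \<subseteq> levels_3"
proof (unfold_locales, goal_cases)
  case (1 f g)
  then show ?case by (intro order_trans[OF keys_diff_subset]) auto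
next
  case (2 f g)
  then show ?case by (intro order_trans[OF keys_add]) auto
next
  case (7)
  then show ?case using split_op_lz[of 1 3 UNIV] by simp
next
  case (8)
  then show ?case using split_op_lz[of "cc 2 3" 3 UNIV] by simp
next
  case (9)
  then show ?case using split_op_lz[of "cc 1 3" 3 UNIV] by simp
next
  case (10)
  then show ?case using split_op_lz[of "cc 1 3 * cc 2 3" 3 UNIV] by simp
next
  case 11
  then show ?case by (rule split_op_lz) (simp, rule levels_closed)
next
  case 12
  then show ?case by (rule split_op_lz) (simp, rule levels_closed)
next
  case 13
  then show ?case by (rule split_op_lz) (simp, rule levels_closed)
next
  case (19 f)
  then show ?case unfolding lz_def
    by (rule self.keys_shift_op[OF additive_0]) (simp only: levels_closed)
next
  case 20 show ?case by (rule lz_square) simp_all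
next
  case 21 show ?case by (rule lz_square) simp_all
next
  case 22 show ?case by (rule lz_square) simp_all
next
  case 23 show ?case by (rule lz_square) simp_all
next
  case 24 show ?case by (rule lz_square) simp_all
next
  case 25 show ?case by (rule lz_square) simp_all
next
  case (6 f) then show ?case by (rule order_trans) blast
qed (simp, simp, simp, (rule additive.add[OF additive_lz])+)

end

section \<open>Modules over algebras of twisted polynomials and their Koszul resolutions\<close>

section \<open>Modules over algebras of twisted polynomials\<close>

text \<open>The algebra is given by coordinates \<open>rep\<close>, along which its ring and algebra
  laws are transported from the twisted product. The same \<open>rep\<close> serves the opposite
  algebra, with the bicharacter transposed.\<close>

locale qalg = bichar ch
  for ch :: "expo \<Rightarrow> expo \<Rightarrow> 'k::field" +
  fixes A :: "('k, 'a) module" and rep :: "(expo \<Rightarrow>\<^sub>0 'k) \<Rightarrow> 'a"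
  assumes rep_bij: "bij_betw rep UNIV (carrier A)"
    and rep_add: "rep (f + g) = rep f \<oplus>\<^bsub>A\<^esub> rep g"
    and rep_mult: "rep (tmul f g) = rep f \<otimes>\<^bsub>A\<^esub> rep g"
    and rep_zero: "rep 0 = \<zero>\<^bsub>A\<^esub>" and rep_one: "rep 1 = \<one>\<^bsub>A\<^esub>"
    and rep_smult: "rep (tmul (single 0 c) f) = c \<odot>\<^bsub>A\<^esub> rep f"

text \<open>The bridge between the two styles of modules: source a type-class group, target the
  carrier of a record.\<close>

definition madd :: "('m, 'e) ring_scheme \<Rightarrow> ('v::ab_group_add \<Rightarrow> 'm) \<Rightarrow> bool"
  where "madd M T \<longleftrightarrow> (\<forall>x. T x \<in> carrier M) \<and> (\<forall>x y. T (x + y) = T x \<oplus>\<^bsub>M\<^esub> T y)"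

lemma madd_closed: "madd M T \<Longrightarrow> T x \<in> carrier M"
  and madd_add: "madd M T \<Longrightarrow> T (x + y) = T x \<oplus>\<^bsub>M\<^esub> T y"
  by (simp_all add: madd_def)

lemma madd_comp: "madd M T \<Longrightarrow> additive f \<Longrightarrow> madd M (\<lambda>x. T (f x))"
  by (simp add: madd_def additive_def)

lemma madd_zero:
  fixes M :: "('m, 'e) ring_scheme" (structure)
  assumes "abelian_group M" "madd M T"
  shows "T 0 = \<zero>"
proof -
  interpret abelian_group M by fact
  have "T 0 \<oplus> T 0 = T 0" using madd_add[OF assms(2), of 0 0] by simp
  then show ?thesis using madd_closed[OF assms(2), of 0] by (metis add.r_cancel_one')
qed

lemma madd_diff_eq:
  fixes M :: "('m, 'e) ring_scheme" (structure)
  assumes "abelian_group M" "madd M T" "T x = T y"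
  shows "T (x - y) = \<zero>"
proof -
  interpret abelian_group M by fact
  have "T (x - y) \<oplus> T y = T y" using madd_add[OF assms(2), of "x - y" y] assms(3) by simp
  then show ?thesis using madd_closed[OF assms(2)] by (metis add.r_cancel_one)
qed

lemma madd_plus:
  fixes M :: "('m, 'e) ring_scheme" (structure)
  assumes "abelian_group M" "madd M S" "madd M T"
  shows "madd M (\<lambda>x. S x \<oplus> T x)"
proof -
  interpret abelian_group M by fact
  show ?thesis using assms(2,3) by (simp add: madd_def a_ac)
qed

lemma madd_eqI:
  fixes M :: "('m, 'e) ring_scheme" (structure)
  assumes "abelian_group M" "madd M S" "madd M T"
    and "\<And>b w. S (single b w) = T (single b w)"
  shows "S f = T f"
proof (induction f rule: single_add_induct)
  case zero
  show ?case using madd_zero[OF assms(1,2)] madd_zero[OF assms(1,3)] by simp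
next
  case (add b w f)
  then show ?case using assms by (simp add: madd_add)
qed

text \<open>The counterpart of \<open>lext\<close> for values in a record.\<close>

definition msum :: "('m, 'e) ring_scheme \<Rightarrow> ('b \<Rightarrow> 'w::zero \<Rightarrow> 'm) \<Rightarrow> ('b \<Rightarrow>\<^sub>0 'w) \<Rightarrow> 'm"
  where "msum M \<phi> f = finsum M (\<lambda>b. \<phi> b (lookup f b)) (keys f)"

context
  fixes M :: "('m, 'e) ring_scheme" (structure) and \<phi> :: "'b \<Rightarrow> 'w::ab_group_add \<Rightarrow> 'm"
  assumes M: "abelian_group M" and \<phi>: "\<And>b. madd M (\<phi> b)"
begin

interpretation abelian_group M by (rule M)

lemma msum_superset:
  assumes "finite S" "keys f \<subseteq> S"
  shows "msum M \<phi> f = finsum M (\<lambda>b. \<phi> b (lookup f b)) S"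
  unfolding msum_def
proof (rule add.finprod_mono_neutral_cong_left[OF assms])
  show "\<phi> i (lookup f i) = \<zero>" if "i \<in> S - keys f" for i
    using that madd_zero[OF M \<phi>] by (simp add: in_keys_iff)
qed (simp_all add: madd_closed[OF \<phi>])

lemma madd_msum: "madd M (msum M \<phi>)"
  unfolding madd_def
proof (intro conjI allI)
  show "msum M \<phi> f \<in> carrier M" for f
    unfolding msum_def using \<phi> by (intro finsum_closed) (auto simp: madd_def)
  fix f g :: "'b \<Rightarrow>\<^sub>0 'w"
  let ?S = "keys f \<union> keys g"
  have "msum M \<phi> (f + g) = finsum M (\<lambda>b. \<phi> b (lookup (f + g) b)) ?S"
    by (rule msum_superset) (simp_all add: keys_add)
  also have "\<dots> = finsum M (\<lambda>b. \<phi> b (lookup f b) \<oplus> \<phi> b (lookup g b)) ?S"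
    by (simp add: lookup_add madd_add[OF \<phi>])
  also have "\<dots> = finsum M (\<lambda>b. \<phi> b (lookup f b)) ?S \<oplus> finsum M (\<lambda>b. \<phi> b (lookup g b)) ?S"
    using \<phi> by (intro finsum_addf) (auto simp: madd_def)
  also have "\<dots> = msum M \<phi> f \<oplus> msum M \<phi> g"
    by (simp add: msum_superset[of ?S])
  finally show "msum M \<phi> (f + g) = msum M \<phi> f \<oplus> msum M \<phi> g" .
qed

lemma msum_single: "msum M \<phi> (single b w) = \<phi> b w"
proof (cases "w = 0")
  case True
  then show ?thesis using madd_zero[OF M \<phi>] by (simp add: msum_def)
next
  case False
  then show ?thesis using madd_closed[OF \<phi>] by (simp add: msum_def)
qed

end

lemma cring_base: "cring (base :: 'k::field ring)"
proof -
  have "abelian_group (base :: 'k ring)"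
    by (rule abelian_groupI) (auto simp: base_def intro: exI[of _ "- x" for x] left_minus)
  moreover have "Group.comm_monoid (base :: 'k ring)"
    by (rule comm_monoidI) (auto simp: base_def)
  ultimately show ?thesis
    by (rule cringI) (simp add: base_def distrib_right)
qed

definition scaleP :: "'k::field \<Rightarrow> ('u \<Rightarrow>\<^sub>0 'k) \<Rightarrow> ('u \<Rightarrow>\<^sub>0 'k)"
  where "scaleP c = lext (\<lambda>u x. single u (c * x))"

lemma additive_scaleP: "additive (scaleP c)"
  unfolding scaleP_def by (rule additive_lext) (simp add: additive_def distrib_left single_add)

lemma scaleP_single: "scaleP c (single u x) = single u (c * x)"
  by (simp add: scaleP_def)

lemma lookup_scaleP: "lookup (scaleP c f) u = c * lookup f u"
proof (rule additive_eqI[OF additive_comp[OF additive_lookup additive_scaleP]])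
  show "additive (\<lambda>f. c * lookup f u)" by (simp add: additive_def lookup_add distrib_left)
qed (simp add: scaleP_single lookup_single when_def)

lemma kspace_scaleP: "kspace scaleP"
  by unfold_locales (auto intro!: poly_mapping_eqI simp: lookup_scaleP lookup_add distrib_left distrib_right)

context qalg
begin

definition unrep :: "'a \<Rightarrow> (expo \<Rightarrow>\<^sub>0 'k)"
  where "unrep = the_inv_into UNIV rep"

lemma rep_carrier [simp]: "rep f \<in> carrier A"
  using rep_bij by (auto simp: bij_betw_def)

lemma rep_eq [simp]: "rep f = rep g \<longleftrightarrow> f = g"
  using rep_bij by (auto simp: bij_betw_def inj_on_def)

lemma unrep_rep [simp]: "unrep (rep f) = f"
  unfolding unrep_def using rep_bij by (intro the_inv_into_f_f) (auto simp: bij_betw_def)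

lemma rep_cases:
  assumes "a \<in> carrier A"
  obtains f where "a = rep f"
  using assms rep_bij by (auto simp: bij_betw_def)

lemma rep_unrep [simp]: "a \<in> carrier A \<Longrightarrow> rep (unrep a) = a"
  by (erule rep_cases) simp

lemma tmul_one_right: "tmul f 1 = f"
  unfolding single_one[symmetric]
  by (rule additive_eqI[OF self.additive_tact_left additive_id]) (simp add: tmul_single del: single_one)

lemma ring_A: "ring A"
proof (rule ringI)
  show "abelian_group A"
  proof (rule abelian_groupI)
    fix x assume "x \<in> carrier A"
    then obtain f where f: "x = rep f" by (rule rep_cases)
    show "\<exists>y\<in>carrier A. y \<oplus>\<^bsub>A\<^esub> x = \<zero>\<^bsub>A\<^esub>"
      by (rule bexI[of _ "rep (- f)"]) (simp_all add: f rep_add[symmetric] rep_zero[symmetric])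
  qed (auto elim!: rep_cases simp: rep_add[symmetric] rep_zero[symmetric] algebra_simps)
  show "monoid A"
    by (rule monoidI)
      (auto elim!: rep_cases simp: rep_mult[symmetric] rep_one[symmetric] self.tact_tmul self.tact_one tmul_one_right)
qed (auto elim!: rep_cases simp: rep_mult[symmetric] rep_add[symmetric] self.tact_add_left self.tact_add_right)

lemma tmul_single_0: "tmul (single 0 c) (single b w) = single b (c * w)"
  "tmul (single b w) (single 0 c) = single b (w * c)"
  by (simp_all add: tmul_single)

lemma tmul_single_0_commute: "tmul (single 0 c) f = tmul f (single 0 c)"
  by (rule additive_eqI[OF self.additive_tact_right self.additive_tact_left])
    (simp add: tmul_single_0 mult.commute)

lemma tmul_scale_right: "tmul f (tmul (single 0 c) g) = tmul (single 0 c) (tmul f g)"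
  by (metis self.tact_tmul tmul_single_0_commute)

lemma k_algebra_A: "k_algebra A"
proof -
  interpret ring A by (rule ring_A)
  have "module (base :: 'k ring) A"
  proof (rule moduleI[OF cring_base])
    show "abelian_group A" ..
    fix c d :: 'k and x assume x: "x \<in> carrier A"
    obtain f where f: "x = rep f" using x by (rule rep_cases)
    show "c \<odot>\<^bsub>A\<^esub> x \<in> carrier A" by (simp add: f rep_smult[symmetric])
    show "(c \<oplus>\<^bsub>base\<^esub> d) \<odot>\<^bsub>A\<^esub> x = c \<odot>\<^bsub>A\<^esub> x \<oplus>\<^bsub>A\<^esub> d \<odot>\<^bsub>A\<^esub> x"
      by (simp add: f rep_smult[symmetric] rep_add[symmetric] base_def single_add self.tact_add_left)
    have "tmul (single 0 (c * d)) f = tmul (single 0 c) (tmul (single 0 d) f)"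
      by (simp add: self.tact_tmul[symmetric] tmul_single_0)
    then show "(c \<otimes>\<^bsub>base\<^esub> d) \<odot>\<^bsub>A\<^esub> x = c \<odot>\<^bsub>A\<^esub> (d \<odot>\<^bsub>A\<^esub> x)"
      by (simp add: f rep_smult[symmetric] base_def)
    show "\<one>\<^bsub>base\<^esub> \<odot>\<^bsub>A\<^esub> x = x"
      by (simp add: f rep_smult[symmetric] base_def self.tact_one)
    fix y assume "y \<in> carrier A"
    then obtain g where g: "y = rep g" by (rule rep_cases)
    show "c \<odot>\<^bsub>A\<^esub> (x \<oplus>\<^bsub>A\<^esub> y) = c \<odot>\<^bsub>A\<^esub> x \<oplus>\<^bsub>A\<^esub> c \<odot>\<^bsub>A\<^esub> y"
      by (simp add: f g rep_smult[symmetric] rep_add[symmetric] self.tact_add_right)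
  qed
  moreover have "(c \<odot>\<^bsub>A\<^esub> x) \<otimes>\<^bsub>A\<^esub> y = c \<odot>\<^bsub>A\<^esub> (x \<otimes>\<^bsub>A\<^esub> y)"
    "x \<otimes>\<^bsub>A\<^esub> (c \<odot>\<^bsub>A\<^esub> y) = c \<odot>\<^bsub>A\<^esub> (x \<otimes>\<^bsub>A\<^esub> y)" if xy: "x \<in> carrier A" "y \<in> carrier A" for c x y
  proof -
    obtain f where f: "x = rep f" using xy(1) by (rule rep_cases)
    obtain g where g: "y = rep g" using xy(2) by (rule rep_cases)
    show "(c \<odot>\<^bsub>A\<^esub> x) \<otimes>\<^bsub>A\<^esub> y = c \<odot>\<^bsub>A\<^esub> (x \<otimes>\<^bsub>A\<^esub> y)"
      by (simp add: f g rep_smult[symmetric] rep_mult[symmetric] self.tact_tmul)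
    show "x \<otimes>\<^bsub>A\<^esub> (c \<odot>\<^bsub>A\<^esub> y) = c \<odot>\<^bsub>A\<^esub> (x \<otimes>\<^bsub>A\<^esub> y)"
      by (simp add: f g rep_smult[symmetric] rep_mult[symmetric] tmul_scale_right)
  qed
  ultimately show ?thesis
    by (intro k_algebra.intro k_algebra_axioms.intro ring_A)
qed

end

lemma (in qalg) qalg_op: "qalg (\<lambda>a b. ch b a) (op_algebra A) rep"
proof -
  interpret fl: bichar "\<lambda>a b. ch b a" by (rule bichar_flip[OF bichar_axioms])
  show ?thesis
    by unfold_locales
      (simp_all add: op_algebra_def rep_bij rep_add rep_zero rep_one tmul_flip rep_mult
        rep_smult[symmetric] tmul_single_0_commute[symmetric])
qed

locale qmap = qalg ch A rep + twist ch scale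
  for ch :: "expo \<Rightarrow> expo \<Rightarrow> 'k::field" and A :: "('k, 'a) module" and rep
    and scale :: "'k \<Rightarrow> 'w::ab_group_add \<Rightarrow> 'w" +
  fixes M :: "('a, 'm) module" and L :: "'w \<Rightarrow> 'm"
  assumes M: "left_module A M" and madd_L: "madd M L"
    and L_scale: "L (scale c w) = rep (single 0 c) \<odot>\<^bsub>M\<^esub> L w"
begin

lemma group_M: "abelian_group M"
  using M by (simp add: left_module_def)

text \<open>The \<open>A\<close>-linear extension of \<open>L\<close> to the free module
  \<open>A \<otimes> 'w\<close>; its uniqueness is \<open>hmap_eqI\<close>.\<close>

definition hmap :: "(expo \<Rightarrow>\<^sub>0 'w) \<Rightarrow> 'm"
  where "hmap = msum M (\<lambda>b w. rep (single b 1) \<odot>\<^bsub>M\<^esub> L w)"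

lemma act_assoc: "m \<in> carrier M \<Longrightarrow> rep f \<odot>\<^bsub>M\<^esub> (rep g \<odot>\<^bsub>M\<^esub> m) = rep (tmul f g) \<odot>\<^bsub>M\<^esub> m"
  by (simp add: rep_mult left_module.smult_assoc[OF M])

lemma madd_act_right: "madd M T \<Longrightarrow> madd M (\<lambda>x. rep f \<odot>\<^bsub>M\<^esub> T x)"
  by (simp add: madd_def left_module.smult_closed[OF M] left_module.smult_r_distr[OF M])

lemma madd_act_left: "m \<in> carrier M \<Longrightarrow> madd M (\<lambda>f. rep f \<odot>\<^bsub>M\<^esub> m)"
  by (simp add: madd_def left_module.smult_closed[OF M] left_module.smult_l_distr[OF M] rep_add)

lemma madd_hmap: "madd M hmap"
  unfolding hmap_def by (rule madd_msum[OF group_M madd_act_right[OF madd_L]])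

lemma hmap_single: "hmap (single b w) = rep (single b 1) \<odot>\<^bsub>M\<^esub> L w"
  unfolding hmap_def by (rule msum_single[OF group_M madd_act_right[OF madd_L]])

lemma hmap_tact: "hmap (tact a f) = rep a \<odot>\<^bsub>M\<^esub> hmap f"
proof -
  note Lc = madd_closed[OF madd_L]
  have "hmap (tact (single b c) f) = rep (single b c) \<odot>\<^bsub>M\<^esub> hmap f" for b c
  proof (rule madd_eqI[OF group_M madd_comp[OF madd_hmap additive_tact_right] madd_act_right[OF madd_hmap]])
    fix d w
    have "hmap (tact (single b c) (single d w)) = rep (single (b + d) 1) \<odot>\<^bsub>M\<^esub> (rep (single 0 (c * ch b d)) \<odot>\<^bsub>M\<^esub> L w)"
      by (simp only: tact_single hmap_single L_scale)
    also have "\<dots> = rep (single (b + d) (c * ch b d)) \<odot>\<^bsub>M\<^esub> L w"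
      by (simp add: act_assoc[OF Lc] tmul_single_0)
    also have "\<dots> = rep (tmul (single b c) (single d 1)) \<odot>\<^bsub>M\<^esub> L w"
      by (simp add: tmul_single)
    finally show "hmap (tact (single b c) (single d w)) = rep (single b c) \<odot>\<^bsub>M\<^esub> hmap (single d w)"
      by (simp add: act_assoc[OF Lc] hmap_single)
  qed
  then show ?thesis
    by (rule madd_eqI[OF group_M madd_comp[OF madd_hmap additive_tact_left]
          madd_act_left[OF madd_closed[OF madd_hmap]]])
qed

end

lemma module_hom_closed: "f \<in> module_hom R M N \<Longrightarrow> x \<in> carrier M \<Longrightarrow> f x \<in> carrier N"
  and module_hom_add: "f \<in> module_hom R M N \<Longrightarrow> x \<in> carrier M \<Longrightarrow> y \<in> carrier M \<Longrightarrow>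
    f (x \<oplus>\<^bsub>M\<^esub> y) = f x \<oplus>\<^bsub>N\<^esub> f y"
  and module_hom_smult: "f \<in> module_hom R M N \<Longrightarrow> a \<in> carrier R \<Longrightarrow> x \<in> carrier M \<Longrightarrow>
    f (a \<odot>\<^bsub>M\<^esub> x) = a \<odot>\<^bsub>N\<^esub> f x"
  by (auto simp: module_hom_def)

context qalg
begin

text \<open>Makes \<open>M\<close> a quotient of the type-class vector space of formal combinations
  of elements of \<open>'m\<close>. Basis elements outside the carrier go to zero, which keeps the
  map total.\<close>

definition piM :: "('a, 'm) module \<Rightarrow> ('m \<Rightarrow>\<^sub>0 'k) \<Rightarrow> 'm"
  where "piM M = msum M (\<lambda>m c. rep (single 0 c) \<odot>\<^bsub>M\<^esub> (if m \<in> carrier M then m else \<zero>\<^bsub>M\<^esub>))"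

context
  fixes M :: "('a, 'm) module"
  assumes lm: "left_module A M"
begin

lemma M_group: "abelian_group M"
  using lm by (simp add: left_module_def)

lemma M_closed: "(if m \<in> carrier M then m else \<zero>\<^bsub>M\<^esub>) \<in> carrier M"
  using abelian_group.axioms(1)[OF M_group] by (auto intro: abelian_monoid.zero_closed)

lemma madd_left: "m \<in> carrier M \<Longrightarrow> madd M (\<lambda>f. rep f \<odot>\<^bsub>M\<^esub> m)"
  by (simp add: madd_def left_module.smult_closed[OF lm] left_module.smult_l_distr[OF lm] rep_add)

lemma madd_right: "madd M T \<Longrightarrow> madd M (\<lambda>x. rep f \<odot>\<^bsub>M\<^esub> T x)"
  by (simp add: madd_def left_module.smult_closed[OF lm] left_module.smult_r_distr[OF lm])

lemma madd_pi_summand: "madd M (\<lambda>c. rep (single 0 c) \<odot>\<^bsub>M\<^esub> (if m \<in> carrier M then m else \<zero>\<^bsub>M\<^esub>))"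
  by (rule madd_comp[OF madd_left[OF M_closed] additive_single])

lemma madd_piM: "madd M (piM M)"
  unfolding piM_def by (rule madd_msum[OF M_group madd_pi_summand])

lemma piM_single: "m \<in> carrier M \<Longrightarrow> piM M (single m c) = rep (single 0 c) \<odot>\<^bsub>M\<^esub> m"
  unfolding piM_def by (subst msum_single[OF M_group madd_pi_summand]) simp

lemma piM_single_1: "m \<in> carrier M \<Longrightarrow> piM M (single m 1) = m"
  by (simp add: piM_single rep_one left_module.smult_one[OF lm])

lemma piM_scale: "piM M (scaleP c f) = rep (single 0 c) \<odot>\<^bsub>M\<^esub> piM M f"
proof (rule madd_eqI[OF M_group madd_comp[OF madd_piM additive_scaleP] madd_right[OF madd_piM]])
  fix m d
  have "rep (single 0 (c * d)) = rep (single 0 c) \<otimes>\<^bsub>A\<^esub> rep (single 0 d)"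
    by (simp add: rep_mult[symmetric] tmul_single_0)
  then show "piM M (scaleP c (single m d)) = rep (single 0 c) \<odot>\<^bsub>M\<^esub> piM M (single m d)"
    by (simp add: piM_def msum_single[OF M_group madd_pi_summand] scaleP_single M_closed
        left_module.smult_assoc[OF lm] del: if_image_distrib)
qed

end

end

section \<open>Lifting maps from free modules\<close>

context qmap
begin

lemma hmap_eqI:
  assumes "madd M S" "\<And>a f. S (tact a f) = rep a \<odot>\<^bsub>M\<^esub> S f" "\<And>w. S (single 0 w) = L w"
  shows "S f = hmap f"
proof (rule madd_eqI[OF group_M assms(1) madd_hmap])
  fix b w
  show "S (single b w) = hmap (single b w)"
    using assms(2)[of "single b 1" "single 0 w"] by (simp add: tact_single assms(3) hmap_single)
qed

end

text \<open>\<open>A \<otimes> 'w\<close> is free on any basis of the vector space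
  \<open>'w\<close>: choose preimages of the values on the basis and extend.\<close>

lemma free_lift:
  fixes ch :: "expo \<Rightarrow> expo \<Rightarrow> 'k::field" and A :: "('k, 'a) module"
    and scale :: "'k \<Rightarrow> 'w::ab_group_add \<Rightarrow> 'w" and M :: "('a, 'm) module" and N :: "('a, 'n) module"
  assumes A: "qalg ch A rep" and sc: "kspace scale"
    and M: "left_module A M" and N: "left_module A N"
    and g: "g \<in> module_hom A M N" "g ` carrier M = carrier N"
    and S: "madd N S" "\<And>a f. S (twist.tact ch scale a f) = rep a \<odot>\<^bsub>N\<^esub> S f"
  shows "\<exists>H. madd M H \<and> (\<forall>a f. H (twist.tact ch scale a f) = rep a \<odot>\<^bsub>M\<^esub> H f) \<and> (\<forall>f. g (H f) = S f)"
proof -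
  interpret qalg ch A rep by (rule A)
  interpret kspace scale by (rule sc)
  interpret twist ch scale ..
  interpret P: kspace "scaleP :: 'k \<Rightarrow> ('m \<Rightarrow>\<^sub>0 'k) \<Rightarrow> _" by (rule kspace_scaleP)
  interpret vp: vector_space_pair scale "scaleP :: 'k \<Rightarrow> ('m \<Rightarrow>\<^sub>0 'k) \<Rightarrow> _" ..
  obtain B where B: "independent B" "span B = UNIV"
    using maximal_independent_subset[of UNIV] by (metis top.extremum_uniqueI)
  define m where "m b = (SOME m. m \<in> carrier M \<and> g m = S (single 0 b))" for b
  have m: "m b \<in> carrier M" "g (m b) = S (single 0 b)" for b
  proof -
    have "\<exists>m. m \<in> carrier M \<and> g m = S (single 0 b)"
      using madd_closed[OF S(1), of "single 0 b"] g(2) by (metis imageE)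
    from someI_ex[OF this, folded m_def] show "m b \<in> carrier M" "g (m b) = S (single 0 b)" by simp_all
  qed
  \<comment> \<open>The record \<open>M\<close> is not a type-class vector space, so the linear
    extension takes values in formal combinations, which \<open>piM\<close> evaluates
    afterwards.\<close>
  define l where "l = vp.construct B (\<lambda>b. single (m b) 1)"
  have l: "Vector_Spaces.linear scale scaleP l" "\<And>b. b \<in> B \<Longrightarrow> l b = single (m b) 1"
    unfolding l_def using vp.linear_construct[OF B(1)] vp.construct_basis[OF B(1)] by auto
  have l_add: "additive l" using vp.linear_add[OF l(1)] by (simp add: additive_def)
  define L where "L w = piM M (l w)" for w
  interpret Lm: qmap ch A rep scale M L
  proof (intro qmap.intro qmap_axioms.intro)
    show "qalg ch A rep" "twist ch scale" "left_module A M" by (rule A, rule twist_axioms, rule M)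
    show "madd M L" unfolding L_def by (rule madd_comp[OF madd_piM[OF M] l_add])
    show "L (scale c w) = rep (single 0 c) \<odot>\<^bsub>M\<^esub> L w" for c w
      unfolding L_def using vp.linear_scale[OF l(1)] by (simp add: piM_scale[OF M])
  qed
  have gM: "madd N (\<lambda>x. g (T x))" if "madd M T" for T :: "'v::ab_group_add \<Rightarrow> 'm"
    using that module_hom_closed[OF g(1)] module_hom_add[OF g(1)] by (simp add: madd_def)
  have S0: "S (single 0 (scale c w)) = rep (single 0 c) \<odot>\<^bsub>N\<^esub> S (single 0 w)" for c w
    using S(2)[of "single 0 c" "single 0 w"] by (simp add: tact_single)
  have gL: "g (L w) = S (single 0 w)" for w
  proof -
    have "w \<in> span B" using B by simp
    then show ?thesis
    proof (induction w rule: span_induct_alt)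
      case base
      show ?case using madd_zero[OF M_group[OF N] gM[OF Lm.madd_L]] madd_zero[OF M_group[OF N] S(1)] by simp
    next
      case (step c x y)
      have x: "g (L x) = S (single 0 x)" using step(1) m by (simp add: L_def l(2) piM_single_1[OF M])
      show ?case
        using step(2) madd_closed[OF Lm.madd_L]
        by (simp add: madd_add[OF gM[OF Lm.madd_L]] single_add madd_add[OF S(1)] S0 Lm.L_scale
            module_hom_smult[OF g(1)] x)
    qed
  qed
  interpret Sm: qmap ch A rep scale N "\<lambda>w. S (single 0 w)"
    by (intro qmap.intro qmap_axioms.intro A twist_axioms N S0 madd_comp[OF S(1) additive_single])
  have "g (Lm.hmap f) = Sm.hmap f" for f
    by (rule Sm.hmap_eqI[OF gM[OF Lm.madd_hmap]])
      (auto simp: Lm.hmap_tact module_hom_smult[OF g(1)] madd_closed[OF Lm.madd_hmap] Lm.hmap_single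
        rep_one left_module.smult_one[OF M] madd_closed[OF Lm.madd_L] gL)
  moreover have "S f = Sm.hmap f" for f
    by (rule Sm.hmap_eqI[OF S(1)]) (simp_all add: S(2))
  ultimately show ?thesis using Lm.madd_hmap Lm.hmap_tact by metis
qed

section \<open>Projective resolutions\<close>

text \<open>The map \<open>aug\<close> identifies the vectors fixed by \<open>pr\<close> with the module \<open>M\<close>. The terms \<open>A \<otimes> \<Lambda>\<^sup>i \<otimes> M\<close> of the
  resolution are transported to \<open>'u\<close> along \<open>j\<close>.\<close>

locale kres = koszul ch scale xop pr + qmap ch A rep scale M aug
  for ch :: "expo \<Rightarrow> expo \<Rightarrow> 'k::field" and scale :: "'k \<Rightarrow> 'w::ab_group_add \<Rightarrow> 'w"
    and xop pr and A :: "('k, 'a) module" and rep and M :: "('a, 'm) module" and aug +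
  fixes j :: "'w poly3 \<Rightarrow> 'u"
  assumes inj_j: "inj j"
    and aug_xop: "aug (xop i w) = rep (single (unit_vec i) 1) \<odot>\<^bsub>M\<^esub> aug w"
    and aug_surj: "m \<in> carrier M \<Longrightarrow> \<exists>w. pr w = w \<and> aug w = m"
    and aug_inj: "pr w = w \<Longrightarrow> aug w = \<zero>\<^bsub>M\<^esub> \<Longrightarrow> w = 0"
begin

definition jinv :: "'u \<Rightarrow> 'w poly3"
  where "jinv = the_inv_into UNIV j"

lemma jinv_j [simp]: "jinv (j z) = z"
  unfolding jinv_def by (rule the_inv_into_f_f[OF inj_j]) simp

lemma j_eq [simp]: "j y = j z \<longleftrightarrow> y = z"
  by (rule inj_eq[OF inj_j])

definition PM :: "nat \<Rightarrow> ('a, 'u) module"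
  where "PM i = \<lparr>carrier = j ` KE i, monoid.mult = undefined, one = undefined, ring.zero = j 0,
    add = (\<lambda>x y. j (jinv x + jinv y)), module.smult = (\<lambda>a x. j (tactT (unrep a) (jinv x)))\<rparr>"

definition DM :: "nat \<Rightarrow> 'u \<Rightarrow> 'u"
  where "DM i = (\<lambda>x \<in> j ` KE (Suc i). j (dd i (jinv x)))"

definition EM :: "'u \<Rightarrow> 'm"
  where "EM = (\<lambda>x \<in> j ` KE 0. hmap (fst (jinv x)))"

lemma PM_simps [simp]:
  "carrier (PM i) = j ` KE i" "\<zero>\<^bsub>PM i\<^esub> = j 0" "j y \<oplus>\<^bsub>PM i\<^esub> j z = j (y + z)"
  "a \<odot>\<^bsub>PM i\<^esub> j z = j (tactT (unrep a) z)"
  by (simp_all add: PM_def)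

lemma DM_j [simp]: "z \<in> KE (Suc i) \<Longrightarrow> DM i (j z) = j (dd i z)"
  by (simp add: DM_def)

lemma EM_j [simp]: "z \<in> KE 0 \<Longrightarrow> EM (j z) = hmap (fst z)"
  by (simp add: EM_def)

lemma tactT_add_right: "tactT a (y + z) = tactT a y + tactT a z"
  by (cases y; cases z) (simp add: tactT_def tact_add_right)

lemma tactT_add_left: "tactT (a + b) z = tactT a z + tactT b z"
  by (cases z) (simp add: tactT_def tact_add_left)

lemma tactT_tmul: "tactT (tmul a b) z = tactT a (tactT b z)"
  by (cases z) (simp add: tactT_def tact_tmul)

lemma tactT_one: "tactT 1 z = z"
  by (cases z) (simp add: tactT_def tact_one)

lemma KE_add: "y \<in> KE i \<Longrightarrow> z \<in> KE i \<Longrightarrow> y + z \<in> KE i"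
  by (auto simp: KE_def KC_def additive.add[OF additive_PT])

lemma KE_minus: "y \<in> KE i \<Longrightarrow> - y \<in> KE i"
  by (auto simp: KE_def KC_def additive.minus[OF additive_PT])

lemma KE_tactT: "y \<in> KE i \<Longrightarrow> tactT a y \<in> KE i"
  by (simp add: KE_def PT_tactT) (auto simp: KC_def tactT_def)

lemma unrep_simps [simp]: "a \<in> carrier A \<Longrightarrow> b \<in> carrier A \<Longrightarrow> unrep (a \<oplus>\<^bsub>A\<^esub> b) = unrep a + unrep b"
  "a \<in> carrier A \<Longrightarrow> b \<in> carrier A \<Longrightarrow> unrep (a \<otimes>\<^bsub>A\<^esub> b) = tmul (unrep a) (unrep b)"
  "unrep \<one>\<^bsub>A\<^esub> = 1"
  by (auto elim!: rep_cases simp: rep_add[symmetric] rep_mult[symmetric] rep_one[symmetric])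

lemma PM_left_module: "left_module A (PM i)"
proof -
  have "abelian_group (PM i)"
  proof (rule abelian_groupI)
    show "\<exists>y\<in>carrier (PM i). y \<oplus>\<^bsub>PM i\<^esub> x = \<zero>\<^bsub>PM i\<^esub>" if x: "x \<in> carrier (PM i)" for x
    proof -
      obtain z where z: "x = j z" "z \<in> KE i" using x by auto
      show ?thesis by (rule bexI[of _ "j (- z)"]) (simp_all add: z KE_minus)
    qed
  qed ((unfold PM_simps(1))?, (elim imageE)?, simp add: KE_add zero_KE add.assoc add.commute)+
  then show ?thesis
    by (intro left_module.intro left_module_axioms.intro ring_A)
      ((unfold PM_simps(1))?, (elim imageE)?, (hypsubst)?,
        simp add: KE_tactT tactT_add_left tactT_add_right tactT_tmul tactT_one)+
qed

lemma module_homI_PM: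
  assumes "f \<in> extensional (j ` KE i)" "\<And>z. z \<in> KE i \<Longrightarrow> f (j z) \<in> carrier N"
    and "\<And>y z. y \<in> KE i \<Longrightarrow> z \<in> KE i \<Longrightarrow> f (j (y + z)) = f (j y) \<oplus>\<^bsub>N\<^esub> f (j z)"
    and "\<And>a z. z \<in> KE i \<Longrightarrow> f (j (tactT a z)) = rep a \<odot>\<^bsub>N\<^esub> f (j z)"
  shows "f \<in> module_hom A (PM i) N"
  unfolding module_hom_def PiE_def
proof (intro CollectI conjI IntI Pi_I ballI, unfold PM_simps(1))
  fix a x assume a: "a \<in> carrier A" and "x \<in> j ` KE i"
  then obtain z where "x = j z" "z \<in> KE i" by (elim imageE)
  then show "f (a \<odot>\<^bsub>PM i\<^esub> x) = a \<odot>\<^bsub>N\<^esub> f x" using a assms(4)[of z "unrep a"] by simp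
next
  fix x y assume "x \<in> j ` KE i" "y \<in> j ` KE i"
  then show "f (x \<oplus>\<^bsub>PM i\<^esub> y) = f x \<oplus>\<^bsub>N\<^esub> f y" by (elim imageE) (simp add: assms(3))
qed (use assms(1,2) in \<open>auto simp del: split_paired_all\<close>)

text \<open>A module map on \<open>PM i\<close> extends along this projection to the whole free module, which makes it total.\<close>

definition PK :: "nat \<Rightarrow> 'w poly3 \<Rightarrow> 'w poly3"
  where "PK i = (\<lambda>(f, g, h). PT (if i \<le> 3 then f else 0, if i = 1 \<or> i = 2 then g else 0,
    if i = 1 \<or> i = 2 then h else 0))"

lemma PK_KE: "PK i z \<in> KE i"
  by (cases z) (auto simp: PK_def KC_def intro!: PT_KE)

lemma PK_id: "z \<in> KE i \<Longrightarrow> PK i z = z"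
  by (cases z) (auto simp: KE_def KC_def PK_def)

lemma additive_PK: "additive (PK i)"
  unfolding additive_def
  by (auto simp: PK_def additive.add[OF additive_PT, symmetric])

lemma PK_tactT: "PK i (tactT a z) = tactT a (PK i z)"
  by (cases z) (auto simp: PK_def tactT_def PT_def PR_tact additive.zero[OF additive_PR])

text \<open>\<open>PM i\<close> is the image of the retraction \<open>PK i\<close> on three copies
  of the free module \<open>A \<otimes> 'w\<close>. The map \<open>f\<close> is composed with the
  retraction and lifted on each copy; the sum of the lifts is then restricted to
  \<open>KE i\<close>.\<close>

lemma PM_projective: "projective A (PM i :: ('a, 'u) module)"
  unfolding projective_def
proof (intro conjI allI impI PM_left_module, elim conjE)
  fix M N :: "('a, 'u) module" and g f
  assume M: "left_module A M" and N: "left_module A N" and g: "g \<in> module_hom A M N"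
    "g ` carrier M = carrier N" and f: "f \<in> module_hom A (PM i) N"
  note gM = M_group[OF M] and gN = M_group[OF N]
  have qA: "qalg ch A rep" and sc: "kspace scale" by unfold_locales
  have f_add: "f (j (PK i (y + z))) = f (j (PK i y)) \<oplus>\<^bsub>N\<^esub> f (j (PK i z))" for y z
    using module_hom_add[OF f, of "j (PK i y)" "j (PK i z)"]
    by (simp add: PK_KE additive.add[OF additive_PK])
  have f_act: "f (j (PK i (tactT a z))) = rep a \<odot>\<^bsub>N\<^esub> f (j (PK i z))" for a z
    using module_hom_smult[OF f, of "rep a" "j (PK i z)"] by (simp add: PK_KE PK_tactT)
  have f_closed: "f (j (PK i z)) \<in> carrier N" for z
    using module_hom_closed[OF f, of "j (PK i z)"] by (simp add: PK_KE)
  have "\<exists>H. madd M H \<and> (\<forall>a x. H (tact a x) = rep a \<odot>\<^bsub>M\<^esub> H x) \<and> (\<forall>x. g (H x) = f (j (PK i (c x))))"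
    if "additive c" "\<And>a x. c (tact a x) = tactT a (c x)" for c
    using that by (intro free_lift[OF qA sc M N g]) (simp_all add: madd_def f_closed f_add f_act additive.add)
  from this[of "\<lambda>x. (x, 0, 0)"] this[of "\<lambda>x. (0, x, 0)"] this[of "\<lambda>x. (0, 0, x)"]
  obtain H1 H2 H3 where H: "madd M H1" "madd M H2" "madd M H3"
    "\<And>a x. H1 (tact a x) = rep a \<odot>\<^bsub>M\<^esub> H1 x" "\<And>a x. H2 (tact a x) = rep a \<odot>\<^bsub>M\<^esub> H2 x"
    "\<And>a x. H3 (tact a x) = rep a \<odot>\<^bsub>M\<^esub> H3 x"
    "\<And>x. g (H1 x) = f (j (PK i (x, 0, 0)))" "\<And>x. g (H2 x) = f (j (PK i (0, x, 0)))"
    "\<And>x. g (H3 x) = f (j (PK i (0, 0, x)))"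
    by (auto simp: additive_def tactT_def)
  interpret Mg: abelian_group M by (rule gM)
  note Hc = H(1-3)[THEN madd_closed]
  define H where "H z = H1 (fst z) \<oplus>\<^bsub>M\<^esub> (H2 (fst (snd z)) \<oplus>\<^bsub>M\<^esub> H3 (snd (snd z)))" for z
  have addH: "madd M H" unfolding H_def
    by (intro madd_plus[OF gM] madd_comp[OF H(1)] madd_comp[OF H(2)] madd_comp[OF H(3)])
      (simp_all add: additive_def)
  have actH: "H (tactT a z) = rep a \<odot>\<^bsub>M\<^esub> H z" for a z
    by (cases z) (simp add: H_def tactT_def H(4-6) left_module.smult_r_distr[OF M] Hc)
  have gH: "g (H z) = f (j z)" if "z \<in> KE i" for z
  proof -
    obtain x y w where z: "z = (x, y, w)" by (cases z)
    have "g (H z) = f (j (PK i (x, 0, 0))) \<oplus>\<^bsub>N\<^esub> (f (j (PK i (0, y, 0))) \<oplus>\<^bsub>N\<^esub> f (j (PK i (0, 0, w))))"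
      by (simp add: H_def z module_hom_add[OF g(1)] Hc H(7-9))
    also have "\<dots> = f (j (PK i z))" by (simp add: f_add[symmetric] z)
    finally show ?thesis by (simp add: PK_id[OF that])
  qed
  show "\<exists>h\<in>module_hom A (PM i) M. \<forall>x\<in>carrier (PM i). g (h x) = f x"
  proof (rule bexI[of _ "\<lambda>x \<in> j ` KE i. H (jinv x)"])
    show "(\<lambda>x \<in> j ` KE i. H (jinv x)) \<in> module_hom A (PM i) M"
      by (intro module_homI_PM) (simp_all add: KE_add KE_tactT madd_add[OF addH] actH madd_closed[OF addH])
    show "\<forall>x\<in>carrier (PM i). g ((\<lambda>x \<in> j ` KE i. H (jinv x)) x) = f x"
      unfolding PM_simps(1) by (intro ballI, elim imageE) (simp add: gH)
  qed
qed

text \<open>The two terms \<open>a x_i \<otimes> w\<close> and \<open>a \<otimes> x_i w\<close> have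
  the same image \<open>a x_i w\<close> in \<open>M\<close>.\<close>

lemma hmap_kz: "hmap (kz i 1 1 f) = \<zero>\<^bsub>M\<^esub>"
proof (rule madd_eqI[OF group_M madd_comp[OF madd_hmap additive_kz]])
  interpret Mg: abelian_group M by (rule group_M)
  show "madd M (\<lambda>f. \<zero>\<^bsub>M\<^esub>)" by (simp add: madd_def)
  fix b w
  note ac = madd_closed[OF madd_L]
  have "hmap (single (b + unit_vec i) (scale (1 * ch b (unit_vec i)) w)) =
      rep (single (b + unit_vec i) (ch b (unit_vec i))) \<odot>\<^bsub>M\<^esub> aug w"
    by (simp add: hmap_single L_scale act_assoc[OF ac] tmul_single_0)
  also have "\<dots> = hmap (single b (scale 1 (xop i w)))"
    by (simp add: hmap_single aug_xop act_assoc[OF ac] tmul_single)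
  finally show "hmap (kz i 1 1 (single b w)) = \<zero>\<^bsub>M\<^esub>"
    unfolding kz_single by (rule madd_diff_eq[OF group_M madd_hmap])
qed

lemma hmap_dd: "hmap (fst (dd 0 z)) = \<zero>\<^bsub>M\<^esub>"
proof -
  interpret Mg: abelian_group M by (rule group_M)
  show ?thesis by (cases z) (simp add: dd_def madd_add[OF madd_hmap] hmap_kz)
qed

lemma hmap_single_0: "hmap (single 0 w) = aug w"
  by (simp add: hmap_single rep_one left_module.smult_one[OF M] madd_closed[OF madd_L])

theorem kres_resolution: "projective_resolution A PM DM EM M"
  unfolding projective_resolution_def a_kernel_def'
proof (intro conjI allI PM_projective)
  show "DM i \<in> module_hom A (PM (Suc i)) (PM i)" for i
    by (intro module_homI_PM) (simp_all add: DM_def dd_KE KE_add KE_tactT dd_tactT additive.add[OF additive_dd])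
  have "fst (y + z) = fst y + fst z" "fst (tactT a z) = tact a (fst z)" for a y and z :: "'w poly3"
    by (simp_all add: tactT_def split: prod.splits)
  then show "EM \<in> module_hom A (PM 0) M"
    by (intro module_homI_PM)
      (simp_all add: EM_def KE_add KE_tactT madd_closed[OF madd_hmap] madd_add[OF madd_hmap] hmap_tact)
  have s0: "(single 0 w, 0, 0) \<in> KE 0" if "pr w = w" for w
    using that by (simp add: KE_def KC_def PT_def PR_single additive.zero[OF additive_PR])
  show "EM ` carrier (PM 0) = carrier M"
  proof
    show "EM ` carrier (PM 0) \<subseteq> carrier M" by (auto simp: madd_closed[OF madd_hmap])
    show "carrier M \<subseteq> EM ` carrier (PM 0)"
    proof
      fix m assume "m \<in> carrier M"
      then obtain w where w: "pr w = w" "aug w = m" using aug_surj by blast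
      show "m \<in> EM ` carrier (PM 0)"
        by (rule image_eqI[of _ _ "j (single 0 w, 0, 0)"]) (simp_all add: s0 w hmap_single_0)
    qed
  qed
  show "{x \<in> carrier (PM 0). EM x = \<zero>\<^bsub>M\<^esub>} = DM 0 ` carrier (PM 1)"
  proof (intro equalityI subsetI)
    fix x assume x: "x \<in> {x \<in> carrier (PM 0). EM x = \<zero>\<^bsub>M\<^esub>}"
    then obtain z where z: "x = j z" "z \<in> KE 0" by auto
    obtain y w where y: "y \<in> KE 1" "pr w = w" "z = dd 0 y + (single 0 w, 0, 0)"
      using KE_0_decompose[OF z(2)] by blast
    interpret Mg: abelian_group M by (rule group_M)
    have "hmap (fst z) = hmap (fst (dd 0 y)) \<oplus>\<^bsub>M\<^esub> aug w"
      by (simp add: y(3) madd_add[OF madd_hmap] hmap_single_0)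
    then have "aug w = \<zero>\<^bsub>M\<^esub>" using x z by (simp add: hmap_dd madd_closed[OF madd_L])
    then have "w = 0" using aug_inj y(2) by blast
    then have "z = dd 0 y" using y(3) by (simp add: zero_prod_def[symmetric])
    then show "x \<in> DM 0 ` carrier (PM 1)" using y(1) z by (auto intro!: image_eqI[of _ _ "j y"])
  next
    fix x assume "x \<in> DM 0 ` carrier (PM 1)"
    then obtain y where "y \<in> KE (Suc 0)" "x = j (dd 0 y)" by auto
    then show "x \<in> {x \<in> carrier (PM 0). EM x = \<zero>\<^bsub>M\<^esub>}" by (simp add: dd_KE hmap_dd)
  qed
  show "{x \<in> carrier (PM (Suc i)). DM i x = \<zero>\<^bsub>PM i\<^esub>} = DM (Suc i) ` carrier (PM (Suc (Suc i)))" for i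
  proof (intro equalityI subsetI)
    fix x assume "x \<in> {x \<in> carrier (PM (Suc i)). DM i x = \<zero>\<^bsub>PM i\<^esub>}"
    then obtain z where z: "x = j z" "z \<in> KE (Suc i)" "dd i z = 0" by auto
    from dd_exact[OF z(2,3)] obtain y where "y \<in> KE (Suc (Suc i))" "z = dd (Suc i) y" by blast
    with z(1) show "x \<in> DM (Suc i) ` carrier (PM (Suc (Suc i)))"
      by (intro image_eqI[of _ _ "j y"]) simp_all
  next
    fix x assume "x \<in> DM (Suc i) ` carrier (PM (Suc (Suc i)))"
    then obtain y where "y \<in> KE (Suc (Suc i))" "x = DM (Suc i) (j y)"
      unfolding PM_simps(1) by (elim imageE) blast
    then show "x \<in> {x \<in> carrier (PM (Suc i)). DM i x = \<zero>\<^bsub>PM i\<^esub>}" by (simp add: dd_KE dd_dd)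
  qed
qed

lemma PM_trivial: "i > 3 \<Longrightarrow> carrier (PM i) = {\<zero>\<^bsub>PM i\<^esub>}"
proof -
  assume i: "i > 3"
  then have "z = 0" if "z \<in> KE i" for z using that by (auto simp: KE_def KC_def zero_prod_def)
  then show ?thesis using zero_KE[of i] by auto
qed

end

section \<open>The global dimension is at most three\<close>

text \<open>The module \<open>M\<close> is a quotient of the vector space with basis \<open>'m\<close>; a linear complement of the kernel,
  cut out by the idempotent \<open>e\<close>, is a copy of \<open>M\<close> inside a type-class vector space.\<close>

lemma (in qalg) resolution_exists:
  fixes M :: "('a, 'm) module"
    and j :: "('m \<Rightarrow>\<^sub>0 'k) poly3 \<Rightarrow> 'u"
  assumes lm: "left_module A M" and j: "inj j"
  shows "\<exists>(P :: nat \<Rightarrow> ('a, 'u) module) D \<epsilon>. projective_resolution A P D \<epsilon> M \<and>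
    (\<forall>i>3. carrier (P i) = {\<zero>\<^bsub>P i\<^esub>})"
proof -
  interpret kspace "scaleP :: 'k \<Rightarrow> ('m \<Rightarrow>\<^sub>0 'k) \<Rightarrow> _" by (rule kspace_scaleP)
  interpret vp: vector_space_pair "scaleP :: 'k \<Rightarrow> ('m \<Rightarrow>\<^sub>0 'k) \<Rightarrow> _" "scaleP :: 'k \<Rightarrow> ('m \<Rightarrow>\<^sub>0 'k) \<Rightarrow> _" ..
  interpret twist ch "scaleP :: 'k \<Rightarrow> ('m \<Rightarrow>\<^sub>0 'k) \<Rightarrow> _" ..
  note pm = madd_piM[OF lm] and gM = M_group[OF lm]
  note p_add = madd_add[OF pm] and p_closed = madd_closed[OF pm]
  define K where "K = {w. piM M w = \<zero>\<^bsub>M\<^esub>}"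
  obtain BK where BK: "BK \<subseteq> K" "independent BK" "K \<subseteq> span BK" using maximal_independent_subset by blast
  define B where "B = extend_basis BK"
  have B: "BK \<subseteq> B" "independent B" "span B = UNIV"
    using BK(2) by (simp_all add: B_def extend_basis_superset independent_extend_basis)
  \<comment> \<open>Killing a basis of the kernel and fixing the remaining vectors of an extended
    basis gives the projection onto a complement along the kernel.\<close>
  define e where "e = vp.construct B (\<lambda>b. if b \<in> BK then 0 else b)"
  have e: "Vector_Spaces.linear scaleP scaleP e" "\<And>b. b \<in> B \<Longrightarrow> e b = (if b \<in> BK then 0 else b)"
    unfolding e_def using vp.linear_construct[OF B(2)] vp.construct_basis[OF B(2)] by auto
  have e_add: "e (x + y) = e x + e y" and e_sc: "e (scaleP c x) = scaleP c (e x)" for c x y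
    using vp.linear_add[OF e(1)] vp.linear_scale[OF e(1)] by auto
  have e_additive: "additive e" by (simp add: additive_def e_add)
  have pe: "piM M (e w) = piM M w" for w
  proof -
    have "w \<in> span B" using B by simp
    then show ?thesis
    proof (induction w rule: span_induct_alt)
      case base
      show ?case using additive.zero[OF e_additive] by simp
    next
      case (step c x y)
      have "piM M (e x) = piM M x"
        using step(1) BK(1) e(2) madd_zero[OF gM pm] by (auto simp: K_def)
      then show ?case using step by (simp add: e_add e_sc p_add piM_scale[OF lm])
    qed
  qed
  have eK: "e w = 0" if "piM M w = \<zero>\<^bsub>M\<^esub>" for w
  proof -
    have "w \<in> span BK" using that BK(3) by (auto simp: K_def)
    then show ?thesis
    proof (induction w rule: span_induct_alt)
      case base
      show ?case by (rule additive.zero[OF e_additive])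
    next
      case (step c x y)
      have "e x = 0" using step(1) e(2) B(1) by auto
      then show ?case using step by (simp add: e_add e_sc)
    qed
  qed
  \<comment> \<open>Hence \<open>e w\<close> depends only on the image of \<open>w\<close> in
    \<open>M\<close>. Identities between vectors fixed by \<open>e\<close> can therefore be checked
    after applying \<open>piM M\<close>, which is how all laws for the operators \<open>x i\<close>
    are obtained.\<close>
  have key: "e w = e w'" if "piM M w = piM M w'" for w w'
    using eK[OF madd_diff_eq[OF gM pm that]] additive.diff[OF e_additive, of w w'] by simp
  have ee: "e (e w) = e w" for w by (rule key[OF pe])
  \<comment> \<open>The action of a variable, transported to the complement: evaluate in
    \<open>M\<close>, multiply there, regard the result as a basis vector and project.\<close>
  define x where "x i w = e (single (rep (single (unit_vec i) 1) \<odot>\<^bsub>M\<^esub> piM M w) 1)" for i w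
  have act: "rep f \<odot>\<^bsub>M\<^esub> m \<in> carrier M" if "m \<in> carrier M" for f m
    using that by (simp add: left_module.smult_closed[OF lm])
  have px: "piM M (x i w) = rep (single (unit_vec i) 1) \<odot>\<^bsub>M\<^esub> piM M w" for i w
    by (simp add: x_def pe piM_single_1[OF lm act[OF p_closed]])
  have ex: "e (x i w) = x i w" for i w by (simp add: x_def ee)
  have xI: "x i w = w'" if "e w' = w'" "rep (single (unit_vec i) 1) \<odot>\<^bsub>M\<^esub> piM M w = piM M w'" for i w w'
    using key[of "x i w" w'] that px ex by simp
  have act2: "rep f \<odot>\<^bsub>M\<^esub> (rep g \<odot>\<^bsub>M\<^esub> piM M w) = rep (tmul f g) \<odot>\<^bsub>M\<^esub> piM M w" for f g w
    using p_closed by (simp add: rep_mult left_module.smult_assoc[OF lm])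
  interpret kz: koszul ch "scaleP :: 'k \<Rightarrow> ('m \<Rightarrow>\<^sub>0 'k) \<Rightarrow> _" x e
  proof (intro koszul.intro koszul_axioms.intro twist_axioms e_additive e_sc ee)
    show "additive (x i)" for i
      unfolding additive_def
      by (intro allI xI) (simp_all add: e_add ex p_add px left_module.smult_r_distr[OF lm] p_closed)
    show "x i (scaleP c w) = scaleP c (x i w)" for i c w
      by (rule xI) (simp_all add: e_sc ex piM_scale[OF lm] px act2 tmul_single_0)
    show "e (x i w) = x i (e w)" for i w
      unfolding ex by (rule xI[symmetric]) (simp_all add: ex pe px)
    fix i k :: nat and w
    have "rep (tmul (single 0 (ch (unit_vec k) (unit_vec i))) (tmul (single (unit_vec i) 1) (single (unit_vec k) 1))) =
      rep (tmul (single 0 (ch (unit_vec i) (unit_vec k))) (tmul (single (unit_vec k) 1) (single (unit_vec i) 1)))"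
      by (simp add: tmul_single add.commute mult.commute)
    then have "piM M (scaleP (ch (unit_vec k) (unit_vec i)) (x i (x k w))) =
        piM M (scaleP (ch (unit_vec i) (unit_vec k)) (x k (x i w)))"
      by (simp add: piM_scale[OF lm] px act2)
    from key[OF this] show "scaleP (ch (unit_vec k) (unit_vec i)) (x i (x k w)) =
        scaleP (ch (unit_vec i) (unit_vec k)) (x k (x i w))"
      by (simp add: e_sc ex)
  qed
  interpret kr: kres ch "scaleP :: 'k \<Rightarrow> ('m \<Rightarrow>\<^sub>0 'k) \<Rightarrow> _" x e A rep M "piM M" j
  proof (intro kres.intro qmap.intro qmap_axioms.intro kres_axioms.intro twist_axioms lm pm j px)
    show "koszul ch scaleP x e" by unfold_locales
    show "qalg ch A rep" by unfold_locales
    show "piM M (scaleP c w) = rep (single 0 c) \<odot>\<^bsub>M\<^esub> piM M w" for c w by (rule piM_scale[OF lm])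
    show "\<exists>w. e w = w \<and> piM M w = m" if "m \<in> carrier M" for m
      using that by (intro exI[of _ "e (single m 1)"]) (simp add: ee pe piM_single_1[OF lm])
    show "w = 0" if "e w = w" "piM M w = \<zero>\<^bsub>M\<^esub>" for w
      using eK[OF that(2)] that(1) by simp
  qed
  show ?thesis using kr.kres_resolution kr.PM_trivial by blast
qed

lemma (in qalg) left_gldim_le:
  assumes "\<exists>j :: ('u \<Rightarrow>\<^sub>0 'k) poly3 \<Rightarrow> 'u. inj j"
  shows "left_gldim TYPE('u) A \<le> enat 3"
  unfolding left_gldim_def
proof (rule SUP_least)
  fix M :: "('a, 'u) module" assume "M \<in> {M. left_module A M}"
  then have lm: "left_module A M" by simp
  obtain j :: "('u \<Rightarrow>\<^sub>0 'k) poly3 \<Rightarrow> 'u" where "inj j"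
    using assms by blast
  from resolution_exists[OF lm this] show "proj_dim A M \<le> enat 3"
    unfolding proj_dim_def by (intro Inf_lower) blast
qed

section \<open>Cardinalities\<close>

lemma inj_pair_infinite:
  assumes "infinite (UNIV :: 'u set)"
  shows "\<exists>p :: 'u \<times> 'u \<Rightarrow> 'u. inj p"
proof -
  have "|UNIV \<times> UNIV :: ('u \<times> 'u) set| =o |UNIV :: 'u set|"
    using card_of_Times_same_infinite[OF assms] by simp
  then obtain f :: "'u \<times> 'u \<Rightarrow> 'u" where "bij_betw f (UNIV \<times> UNIV) UNIV"
    unfolding card_of_ordIso[symmetric] by blast
  then show ?thesis by (auto simp: bij_betw_def)
qed

text \<open>Iterated pairing is injective on lists of equal length, so the length is encoded along
  with it.\<close>

lemma inj_list_infinite: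
  assumes "infinite (UNIV :: 'u set)"
  shows "\<exists>p :: 'u list \<Rightarrow> 'u. inj p"
proof -
  obtain p :: "'u \<times> 'u \<Rightarrow> 'u" where p: "inj p" using inj_pair_infinite[OF assms] by blast
  obtain \<nu> :: "nat \<Rightarrow> 'u" where \<nu>: "inj \<nu>"
    using infinite_countable_subset[OF assms] by blast
  define q where "q xs = foldr (\<lambda>x a. p (x, a)) xs undefined" for xs
  have "xs = ys" if "length xs = length ys" "q xs = q ys" for xs ys
    using that
  proof (induction xs ys rule: list_induct2)
    case (Cons x xs y ys)
    then show ?case by (auto simp: q_def dest!: injD[OF p])
  qed simp
  then have "inj (\<lambda>xs. p (\<nu> (length xs), q xs))"
    by (intro injI) (auto dest!: injD[OF p] injD[OF \<nu>])
  then show ?thesis by blast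
qed

lemma inj_poly_mapping:
  fixes \<kappa> :: "'b \<Rightarrow> 'u" and \<nu> :: "'v::zero \<Rightarrow> 'u"
  assumes "infinite (UNIV :: 'u set)" "inj \<kappa>" "inj \<nu>"
  shows "\<exists>j :: ('b \<Rightarrow>\<^sub>0 'v) \<Rightarrow> 'u. inj j"
proof -
  obtain p :: "'u \<times> 'u \<Rightarrow> 'u" where p: "inj p" using inj_pair_infinite[OF assms(1)] by blast
  obtain l :: "'u list \<Rightarrow> 'u" where l: "inj l" using inj_list_infinite[OF assms(1)] by blast
  define ls where "ls f = (SOME xs. set xs = (\<lambda>b. (b, lookup f b)) ` keys f)" for f :: "'b \<Rightarrow>\<^sub>0 'v"
  have ls: "set (ls f) = (\<lambda>b. (b, lookup f b)) ` keys f" for f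
    unfolding ls_def by (rule someI_ex[OF finite_list]) simp
  have "inj (\<lambda>(b, v). p (\<kappa> b, \<nu> v))"
    by (rule injI) (auto dest!: injD[OF p] dest: injD[OF assms(2)] injD[OF assms(3)])
  then have m: "inj (map (\<lambda>(b, v). p (\<kappa> b, \<nu> v)))" by (rule inj_mapI)
  have i: "inj ls"
  proof (rule injI, rule poly_mapping_eqI)
    fix f g b assume "ls f = ls g"
    then have eq: "(\<lambda>b. (b, lookup f b)) ` keys f = (\<lambda>b. (b, lookup g b)) ` keys g"
      using ls[of f] ls[of g] by simp
    from arg_cong[OF this, of "image fst"] have k: "keys f = keys g" by (simp add: image_image)
    show "lookup f b = lookup g b"
    proof (cases "b \<in> keys f")
      case True
      then have "(b, lookup f b) \<in> (\<lambda>b. (b, lookup g b)) ` keys g" using eq by blast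
      then show ?thesis by auto
    next
      case False
      then show ?thesis using k by (metis in_keys_iff)
    qed
  qed
  have "inj (l \<circ> (map (\<lambda>(b, v). p (\<kappa> b, \<nu> v)) \<circ> ls))"
    by (intro inj_compose l m i)
  then show ?thesis by blast
qed

lemma inj_triple:
  fixes \<nu> :: "'v \<Rightarrow> 'u"
  assumes "infinite (UNIV :: 'u set)" "inj \<nu>"
  shows "\<exists>j :: 'v \<times> 'v \<times> 'v \<Rightarrow> 'u. inj j"
proof -
  obtain p :: "'u \<times> 'u \<Rightarrow> 'u" where p: "inj p" using inj_pair_infinite[OF assms(1)] by blast
  have "inj (\<lambda>(x, y, z). p (\<nu> x, p (\<nu> y, \<nu> z)))"
    by (rule injI) (auto dest!: injD[OF p] dest: injD[OF assms(2)])
  then show ?thesis by blast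
qed

text \<open>Characteristic zero makes the field, hence \<open>'u\<close>, infinite, and an infinite
  type absorbs pairs, lists and finitely supported functions. The first injection houses the
  resolutions of arbitrary modules in \<open>'u\<close>, the second that of the trivial
  module.\<close>

lemma inj_complexes:
  fixes \<iota> :: "'k::field_char_0 \<Rightarrow> 'u"
  assumes "inj \<iota>"
  shows "\<exists>j :: ('u \<Rightarrow>\<^sub>0 'k) poly3 \<Rightarrow> 'u. inj j"
    and "\<exists>j :: 'k poly3 \<Rightarrow> 'u. inj j"
proof -
  have "infinite (UNIV :: 'k set)"
    by (rule infinite_UNIV_char_0)
  then have inf: "infinite (UNIV :: 'u set)"
    using finite_imageD[OF finite_subset[OF subset_UNIV] assms] by blast
  obtain \<nu> :: "nat \<Rightarrow> 'u" where \<nu>: "inj \<nu>" using infinite_countable_subset[OF inf] by blast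
  obtain \<kappa> :: "expo \<Rightarrow> 'u" where \<kappa>: "inj \<kappa>" using inj_triple[OF inf \<nu>] by blast
  obtain j1 :: "('u \<Rightarrow>\<^sub>0 'k) \<Rightarrow> 'u" where "inj j1"
    using inj_poly_mapping[OF inf inj_on_id assms] by blast
  then obtain j2 :: "(expo \<Rightarrow>\<^sub>0 'u \<Rightarrow>\<^sub>0 'k) \<Rightarrow> 'u" where "inj j2"
    using inj_poly_mapping[OF inf \<kappa>] by blast
  then show "\<exists>j :: ('u \<Rightarrow>\<^sub>0 'k) poly3 \<Rightarrow> 'u. inj j"
    by (rule inj_triple[OF inf])
  obtain j3 :: "(expo \<Rightarrow>\<^sub>0 'k) \<Rightarrow> 'u" where "inj j3"
    using inj_poly_mapping[OF inf \<kappa> assms] by blast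
  then show "\<exists>j :: 'k poly3 \<Rightarrow> 'u. inj j"
    by (rule inj_triple[OF inf])
qed

section \<open>Gradings and growth\<close>

section \<open>Gradings\<close>

lemma single_eq_iff [simp]: "single k x = single k y \<longleftrightarrow> x = y"
  by (metis lookup_single_eq)

definition tdeg :: "expo \<Rightarrow> nat"
  where "tdeg b = fst b + fst (snd b) + snd (snd b)"

lemma tdeg_add: "tdeg (a + b) = tdeg a + tdeg b"
  by (simp add: tdeg_def)

lemma tdeg_eq_0: "tdeg b = 0 \<longleftrightarrow> b = 0"
  by (cases b) (auto simp: tdeg_def zero_prod_def)

lemma tdeg_unit_vec: "tdeg (unit_vec i) = 1"
  by (simp add: tdeg_def unit_vec_def)

lemma add_eq_0_expo: "a + b = 0 \<longleftrightarrow> a = 0 \<and> b = (0 :: expo)"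
  using tdeg_add[of a b] tdeg_eq_0 by (metis add_is_0 add_0)

text \<open>\<open>N\<close> is the degree of each variable. It is \<open>3 * n\<close> for the
  identity component, whose variables are \<open>u^n\<close>, \<open>v^n\<close>, \<open>w^n\<close>
  up to scalars, with the degrees inherited from \<open>x\<close>, \<open>y\<close>,
  \<open>z\<close>.\<close>

definition hom :: "nat \<Rightarrow> nat \<Rightarrow> (expo \<Rightarrow>\<^sub>0 'w::zero) set"
  where "hom N m = {f. \<forall>b\<in>keys f. N * tdeg b = m}"

definition hcomp :: "nat \<Rightarrow> nat \<Rightarrow> (expo \<Rightarrow>\<^sub>0 'w::ab_group_add) \<Rightarrow> (expo \<Rightarrow>\<^sub>0 'w)"
  where "hcomp N m = lext (\<lambda>b w. if N * tdeg b = m then single b w else 0)"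

lemma additive_hcomp: "additive (hcomp N m)"
  unfolding hcomp_def by (rule additive_lext) (simp add: additive_def single_add)

lemma hcomp_single: "hcomp N m (single b w) = (if N * tdeg b = m then single b w else 0)"
  unfolding hcomp_def by simp

lemma lookup_hcomp: "lookup (hcomp N m f) b = (if N * tdeg b = m then lookup f b else 0)"
proof (rule additive_eqI[OF additive_comp[OF additive_lookup additive_hcomp]])
  show "additive (\<lambda>f. if N * tdeg b = m then lookup f b else 0)"
    by (simp add: additive_def lookup_add)
qed (auto simp: hcomp_single lookup_single when_def)

lemma hom_zero [simp]: "0 \<in> hom N m"
  by (simp add: hom_def)

lemma hom_add: "f \<in> hom N m \<Longrightarrow> g \<in> hom N m \<Longrightarrow> f + g \<in> hom N m"
  using keys_add[of f g] by (auto simp: hom_def)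

lemma hom_minus: "f \<in> hom N m \<Longrightarrow> - f \<in> hom N m" for f :: "expo \<Rightarrow>\<^sub>0 'w::ab_group_add"
  by (auto simp: hom_def in_keys_iff)

lemma hcomp_hom: "hcomp N m f \<in> hom N m"
  by (auto simp: hom_def in_keys_iff lookup_hcomp split: if_splits)

lemma lookup_hom: "f \<in> hom N m \<Longrightarrow> N * tdeg b \<noteq> m \<Longrightarrow> lookup f b = 0"
  by (auto simp: hom_def in_keys_iff)

lemma hcomp_eq_0:
  assumes "m \<notin> (\<lambda>b. N * tdeg b) ` keys f"
  shows "hcomp N m f = 0"
  using assms by (intro poly_mapping_eqI) (auto simp: lookup_hcomp in_keys_iff)

lemma (in twist) tact_hom:
  assumes "a \<in> hom N i" "f \<in> hom N m"
  shows "tact a f \<in> hom N (i + m)"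
  using assms(1)
proof (induction a rule: single_add_induct)
  case zero
  show ?case by simp
next
  case (add b x a)
  have "tact (single b x) f \<in> hom N (i + m)"
    using assms(2)
  proof (induction f rule: single_add_induct)
    case zero
    show ?case by simp
  next
    case (add d w f)
    have "N * tdeg b = i" "N * tdeg d = m" "f \<in> hom N m"
      using \<open>single b x + a \<in> hom N i\<close> \<open>b \<notin> keys a\<close> \<open>x \<noteq> 0\<close> add
      by (auto simp: hom_def keys_single_add)
    then have "tact (single b x) (single d w) \<in> hom N (i + m)" "tact (single b x) f \<in> hom N (i + m)"
      using add.IH by (auto simp: tact_single hom_def tdeg_add distrib_left)
    then show ?case unfolding tact_add_right by (rule hom_add)
  qed
  moreover have "a \<in> hom N i" using add by (auto simp: hom_def keys_single_add)
  ultimately show ?case using add.IH by (simp add: tact_add_left hom_add)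
qed

locale gqalg = qalg ch A rep for ch :: "expo \<Rightarrow> expo \<Rightarrow> 'k::field" and A :: "('k, 'a) module" and rep +
  fixes N :: nat
  assumes N_pos: "N > 0"
begin

definition G :: "nat \<Rightarrow> 'a set" where "G m = rep ` hom N m"

interpretation rA: ring A by (rule ring_A)

lemma rep_sum: "finite I \<Longrightarrow> finsum A (\<lambda>i. rep (h i)) I = rep (\<Sum>i\<in>I. h i)"
  by (induction I rule: finite_induct) (auto simp: rep_zero rep_add)

text \<open>Uniqueness is read off coefficientwise: among homogeneous elements only the one of
  degree \<open>N * tdeg b\<close> can contain the exponent \<open>b\<close>.\<close>

lemma decomposes_iff: "decomposes A G (rep f) g \<longleftrightarrow> g = (\<lambda>i. rep (hcomp N i f))"
proof
  assume d: "decomposes A G (rep f) g"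
  then have "\<forall>i. \<exists>h. h \<in> hom N i \<and> g i = rep h" by (auto simp: decomposes_def G_def)
  then obtain h where h: "\<And>i. h i \<in> hom N i" "\<And>i. g i = rep (h i)" by metis
  have g: "g = (\<lambda>i. rep (h i))" by (simp add: fun_eq_iff h(2))
  define I where "I = {i. h i \<noteq> 0}"
  have I: "{i. g i \<noteq> \<zero>\<^bsub>A\<^esub>} = I" by (simp add: I_def h(2) rep_zero[symmetric])
  have "finite I" "rep f = finsum A (\<lambda>i. rep (h i)) I"
    using d unfolding decomposes_def I by (simp_all add: g)
  then have f: "f = (\<Sum>i\<in>I. h i)" by (simp add: rep_sum)
  have "h i = hcomp N i f" for i
  proof (rule poly_mapping_eqI)
    fix b
    have "lookup f b = (\<Sum>i\<in>I. if i = N * tdeg b then lookup (h i) b else 0)"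
      unfolding f lookup_sum by (intro sum.cong) (auto simp: lookup_hom[OF h(1)])
    also have "\<dots> = lookup (h (N * tdeg b)) b"
      using \<open>finite I\<close> by (auto simp: I_def)
    finally show "lookup (h i) b = lookup (hcomp N i f) b"
      using lookup_hom[OF h(1)[of i], of b] by (auto simp: lookup_hcomp)
  qed
  then show "g = (\<lambda>i. rep (hcomp N i f))" by (simp add: fun_eq_iff h(2))
next
  assume g: "g = (\<lambda>i. rep (hcomp N i f))"
  define I where "I = {i. hcomp N i f \<noteq> 0}"
  have I: "{i. g i \<noteq> \<zero>\<^bsub>A\<^esub>} = I" by (simp add: I_def g rep_zero[symmetric])
  have "I \<subseteq> (\<lambda>b. N * tdeg b) ` keys f" using hcomp_eq_0 unfolding I_def by blast
  then have fin: "finite I" by (rule finite_subset) simp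
  have "f = (\<Sum>i\<in>I. hcomp N i f)"
  proof (rule poly_mapping_eqI)
    fix b
    have "(\<Sum>i\<in>I. lookup (hcomp N i f) b) = (\<Sum>i\<in>I. if i = N * tdeg b then lookup f b else 0)"
      by (intro sum.cong) (auto simp: lookup_hcomp)
    also have "\<dots> = lookup f b"
    proof -
      have "lookup f b = 0" if "N * tdeg b \<notin> I"
      proof -
        have "lookup (hcomp N (N * tdeg b) f) b = 0" using that by (simp add: I_def)
        then show ?thesis by (simp add: lookup_hcomp)
      qed
      then show ?thesis using fin by auto
    qed
    finally show "lookup f b = lookup (\<Sum>i\<in>I. hcomp N i f) b" by (simp add: lookup_sum)
  qed
  then show "decomposes A G (rep f) g"
    unfolding decomposes_def I using fin by (auto simp: g G_def hcomp_hom rep_sum)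
qed

lemma tmul_single_0_scaleP: "tmul (single 0 c) f = scaleP c f"
  by (rule additive_eqI[OF self.additive_tact_right additive_scaleP])
    (simp add: tmul_single_0 scaleP_single)

lemma smult_rep: "c \<odot>\<^bsub>A\<^esub> rep f = rep (scaleP c f)"
  by (simp add: rep_smult[symmetric] tmul_single_0_scaleP)

lemma submodule_rep:
  assumes "0 \<in> U" "\<And>f g. f \<in> U \<Longrightarrow> g \<in> U \<Longrightarrow> f + g \<in> U" "\<And>c f. f \<in> U \<Longrightarrow> scaleP c f \<in> U"
  shows "submodule (rep ` U) base A"
proof -
  interpret k_algebra A by (rule k_algebra_A)
  show ?thesis
  proof (rule submoduleI)
    show "\<ominus>\<^bsub>A\<^esub> a \<in> rep ` U" if "a \<in> rep ` U" for a
    proof -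
      obtain f where f: "a = rep f" "f \<in> U" using \<open>a \<in> rep ` U\<close> by blast
      have "rep (scaleP (- 1) f) \<oplus>\<^bsub>A\<^esub> rep f = \<zero>\<^bsub>A\<^esub>"
        unfolding rep_add[symmetric] rep_zero[symmetric] rep_eq
        by (rule poly_mapping_eqI) (simp add: lookup_add lookup_scaleP)
      then have "\<ominus>\<^bsub>A\<^esub> a = rep (scaleP (- 1) f)" unfolding f(1) by (intro rA.minus_equality) simp_all
      then show ?thesis using f assms(3) by simp
    qed
    show "\<zero>\<^bsub>A\<^esub> \<in> rep ` U" using assms(1) rep_zero[symmetric] by blast
    show "a \<oplus>\<^bsub>A\<^esub> b \<in> rep ` U" if "a \<in> rep ` U" "b \<in> rep ` U" for a b
      using that assms(2) by (auto simp: rep_add[symmetric])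
    show "c \<odot>\<^bsub>A\<^esub> a \<in> rep ` U" if "c \<in> carrier base" "a \<in> rep ` U" for c a
      using that assms(3) by (auto simp: smult_rep)
  qed auto
qed

lemma hom_scaleP: "f \<in> hom N m \<Longrightarrow> scaleP c f \<in> hom N m"
  by (auto simp: hom_def in_keys_iff lookup_scaleP)

lemma G_submodule: "submodule (G m) base A"
  unfolding G_def by (intro submodule_rep hom_zero hom_add hom_scaleP)

lemma G_direct_sum: "internal_direct_sum A G"
  unfolding internal_direct_sum_def
proof (intro conjI allI ballI)
  show "additive_subgroup (G i) A" for i
    using G_submodule[of i] by (intro additive_subgroup.intro) (rule submodule.axioms)
  fix x assume "x \<in> carrier A"
  then obtain f where "x = rep f" by (rule rep_cases)
  then show "\<exists>!g. decomposes A G x g" by (simp add: decomposes_iff)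
qed

lemma G_mult: "x \<in> G i \<Longrightarrow> y \<in> G m \<Longrightarrow> x \<otimes>\<^bsub>A\<^esub> y \<in> G (i + m)"
  by (auto simp: G_def rep_mult[symmetric] self.tact_hom)

lemma one_smult: "c \<odot>\<^bsub>A\<^esub> \<one>\<^bsub>A\<^esub> = rep (single 0 c)"
  by (simp add: rep_one[symmetric] smult_rep) (simp add: single_one[symmetric] scaleP_single del: single_one)

lemma hom_0: "hom N 0 = range (single 0 :: 'k \<Rightarrow> expo \<Rightarrow>\<^sub>0 'k)"
proof -
  have "f = single 0 (lookup f 0)" if "f \<in> hom N 0" for f :: "expo \<Rightarrow>\<^sub>0 'k"
    using that N_pos by (intro poly_mapping_eqI) (auto simp: hom_def lookup_single when_def in_keys_iff tdeg_eq_0)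
  moreover have "single 0 c \<in> hom N 0" for c :: 'k by (auto simp: hom_def tdeg_def)
  ultimately show ?thesis by blast
qed

theorem A_connected_graded: "connected_graded A G"
  unfolding connected_graded_def
proof (intro conjI allI ballI k_algebra_A G_submodule G_direct_sum G_mult)
  show "bij_betw (\<lambda>c. c \<odot>\<^bsub>A\<^esub> \<one>\<^bsub>A\<^esub>) UNIV (G 0)"
    unfolding one_smult G_def hom_0 by (auto simp: bij_betw_def inj_def)
qed

lemma augmentation_rep: "augmentation A G (rep f) = lookup f 0"
proof -
  have "hcomp N 0 f = single 0 (lookup f 0)"
    using N_pos by (intro poly_mapping_eqI) (auto simp: lookup_hcomp lookup_single when_def tdeg_eq_0)
  then show ?thesis
    unfolding augmentation_def decomposes_iff one_smult by (intro the_equality) auto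
qed

text \<open>A sum of exponents is zero only if both summands are, and the bicharacter is 1 there.
  This makes the augmentation a ring homomorphism.\<close>

lemma lookup_tmul_0: "lookup (tmul f g) 0 = lookup f 0 * lookup g 0"
proof -
  have "lookup (tmul (single b c) g) 0 = lookup (single b c) 0 * lookup g 0" for b c
  proof (rule additive_eqI[OF additive_comp[OF additive_lookup self.additive_tact_right]])
    show "additive (\<lambda>g. lookup (single b c) 0 * lookup g 0)"
      by (simp add: additive_def lookup_add distrib_left)
  qed (auto simp: tmul_single lookup_single when_def add_eq_0_expo)
  then show ?thesis
  proof (rule additive_eqI[OF additive_comp[OF additive_lookup self.additive_tact_left], rotated])
    show "additive (\<lambda>f. lookup f 0 * lookup g 0)"
      by (simp add: additive_def lookup_add distrib_right)
  qed
qed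

definition TM :: "('a, 'k) module" where "TM = trivial_module A G"

lemma TM_simps [simp]: "carrier TM = UNIV" "\<zero>\<^bsub>TM\<^esub> = 0" "c \<oplus>\<^bsub>TM\<^esub> d = c + d"
  "rep f \<odot>\<^bsub>TM\<^esub> c = lookup f 0 * c"
  by (simp_all add: TM_def trivial_module_def base_def ring.defs module.defs augmentation_rep)

lemma TM_left_module: "left_module A TM"
proof -
  have "abelian_group TM"
  proof (rule abelian_groupI)
    show "\<exists>y\<in>carrier TM. y \<oplus>\<^bsub>TM\<^esub> x = \<zero>\<^bsub>TM\<^esub>" for x by (rule bexI[of _ "- x"]) simp_all
  qed (simp_all add: add.assoc add.commute)
  then show ?thesis
    by (intro left_module.intro left_module_axioms.intro ring_A)
      (auto elim!: rep_cases simp: rep_add[symmetric] rep_mult[symmetric] rep_one[symmetric]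
        lookup_tmul_0 lookup_add distrib_left distrib_right)
qed

text \<open>The variables act by zero and the field is its own coefficient space, so the operators
  are zero and the idempotent is the identity.\<close>

lemma TM_kres:
  assumes "inj j"
  shows "kres ch (*) (\<lambda>_ _. 0) (\<lambda>w. w) A rep TM (\<lambda>w. w) j"
proof (intro kres.intro koszul.intro koszul_axioms.intro qmap.intro qmap_axioms.intro kres_axioms.intro
    TM_left_module assms)
  show "qalg ch A rep" "twist ch (*)" "twist ch (*)"
    by (rule qalg_axioms, rule self.twist_axioms, rule self.twist_axioms)
  have "0 \<noteq> unit_vec i" for i by (simp add: unit_vec_def zero_prod_def)
  then have "lookup (single (unit_vec i) (1::'k)) 0 = 0" for i by (metis lookup_single_not_eq)
  then show "0 = rep (single (unit_vec i) 1) \<odot>\<^bsub>TM\<^esub> w" for i w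
    by (simp only: TM_simps mult_zero_left)
qed (simp_all add: additive_def madd_def)

end

section \<open>Gelfand-Kirillov dimension\<close>

definition box :: "nat \<Rightarrow> expo set"
  where "box D = {..D} \<times> {..D} \<times> {..D}"

lemma card_box: "card (box D) = (D + 1) ^ 3"
  by (simp add: box_def card_cartesian_product power3_eq_cube)

lemma finite_box: "finite (box D)"
  by (simp add: box_def)

lemma finite_subset_box: "finite E \<Longrightarrow> \<exists>D. E \<subseteq> box D"
proof (induction E rule: finite_induct)
  case (insert b E)
  then obtain D where "E \<subseteq> box D" by blast
  then have "insert b E \<subseteq> box (D + tdeg b)" by (cases b) (force simp: box_def tdeg_def)
  then show ?case by blast
qed simp

lemma (in bichar) keys_tmul_box:
  assumes "keys f \<subseteq> box D" "keys g \<subseteq> box E"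
  shows "keys (tmul f g) \<subseteq> box (D + E)"
  using assms(1)
proof (induction f rule: single_add_induct)
  case (add b x f)
  have "keys (tmul (single b x) g) \<subseteq> box (D + E)"
    using assms(2)
  proof (induction g rule: single_add_induct)
    case (add d y g)
    then have "keys (tmul (single b x) (single d y)) \<subseteq> box (D + E)"
      using \<open>keys (single b x + f) \<subseteq> box D\<close> \<open>b \<notin> keys f\<close> \<open>x \<noteq> 0\<close>
      by (cases b; cases d) (auto simp: tmul_single keys_single_add box_def split: if_splits)
    moreover have "keys (tmul (single b x) g) \<subseteq> box (D + E)" using add by (simp add: keys_single_add)
    ultimately show ?case unfolding self.tact_add_right by (intro order_trans[OF keys_add]) simp
  qed simp
  moreover have "keys (tmul f g) \<subseteq> box (D + E)" using add by (simp add: keys_single_add)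
  ultimately show ?case unfolding self.tact_add_left by (intro order_trans[OF keys_add]) simp
qed simp

context gqalg
begin

interpretation P: kspace "scaleP :: 'k \<Rightarrow> (expo \<Rightarrow>\<^sub>0 'k) \<Rightarrow> _" by (rule kspace_scaleP)

lemma k_span_subset:
  assumes "S \<subseteq> rep ` U" "0 \<in> U" "\<And>f g. f \<in> U \<Longrightarrow> g \<in> U \<Longrightarrow> f + g \<in> U" "\<And>c f. f \<in> U \<Longrightarrow> scaleP c f \<in> U"
  shows "k_span A S \<subseteq> rep ` U"
  unfolding k_span_def using submodule_rep[OF assms(2-4)] assms(1) by blast

lemma k_span_rep: "k_span A (rep ` S) = rep ` P.span S"
proof
  show "k_span A (rep ` S) \<subseteq> rep ` P.span S"
    by (intro k_span_subset image_mono P.span_superset P.span_zero P.span_add P.span_scale)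
  show "rep ` P.span S \<subseteq> k_span A (rep ` S)"
    unfolding k_span_def
  proof (intro Inter_greatest subsetI)
    fix W x assume W: "W \<in> {W. submodule W base A \<and> rep ` S \<subseteq> W}" and "x \<in> rep ` P.span S"
    then obtain f where f: "x = rep f" "f \<in> P.span S" by blast
    interpret W: submodule W base A using W by blast
    show "x \<in> W" unfolding f(1) using f(2)
    proof (induction f rule: P.span_induct_alt)
      case base
      show ?case using W.one_closed by (simp add: rep_zero)
    next
      case (step c f g)
      have "c \<odot>\<^bsub>A\<^esub> rep f \<in> W" using W step(1) by (intro W.smult_closed) (auto simp: base_def)
      then show ?case using step(2) W.m_closed[of "rep (scaleP c f)" "rep g"] by (simp add: rep_add smult_rep)
    qed
  qed
qed

lemma span_single: "f \<in> P.span ((\<lambda>b. single b 1) ` keys f)"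
proof -
  have "f \<in> P.span ((\<lambda>b. single b 1) ` E)" if "keys f \<subseteq> E" for E
    using that
  proof (induction f rule: single_add_induct)
    case zero
    show ?case by (rule P.span_zero)
  next
    case (add b c f)
    have "scaleP c (single b 1) \<in> P.span ((\<lambda>b. single b 1) ` E)"
      using add by (intro P.span_scale P.span_base) (auto simp: keys_single_add)
    then show ?case using add by (intro P.span_add) (auto simp: scaleP_single keys_single_add)
  qed
  then show ?thesis by blast
qed

text \<open>\<open>k_dim\<close> minimises over spanning sets, so the size of a basis of
  \<open>U\<close> bounds it; that basis is independent inside the span of the monomials from
  \<open>E\<close>.\<close>

lemma k_dim_le:
  assumes "W = rep ` U" "P.subspace U" "\<And>f. f \<in> U \<Longrightarrow> keys f \<subseteq> E" "finite E"
  shows "k_dim A W \<le> card E"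
proof -
  obtain B where B: "B \<subseteq> U" "P.independent B" "U \<subseteq> P.span B" using P.maximal_independent_subset by blast
  have "P.span B = U" using B assms(2) by (intro equalityI P.span_minimal)
  have "B \<subseteq> P.span ((\<lambda>b. single b 1) ` E)"
  proof
    fix f assume "f \<in> B"
    then have "keys f \<subseteq> E" using B assms(3) by blast
    then show "f \<in> P.span ((\<lambda>b. single b 1) ` E)"
      using span_single[of f] P.span_mono[OF image_mono] by blast
  qed
  then have fin: "finite B" "card B \<le> card ((\<lambda>b. single b (1 :: 'k)) ` E)"
    using P.independent_span_bound[OF finite_imageI[OF assms(4)] B(2)] by blast+
  have "k_dim A W \<le> card B"
    unfolding k_dim_def
  proof (rule Least_le, intro exI[of _ "rep ` B"] conjI)
    show "card (rep ` B) = card B" by (intro card_image) (auto simp: inj_on_def)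
  qed (use fin \<open>P.span B = U\<close> in \<open>auto simp: k_span_rep assms(1)\<close>)
  also have "\<dots> \<le> card E" using fin(2) card_image_le[OF assms(4)] by (rule order_trans)
  finally show ?thesis .
qed

text \<open>If the generators involve exponents up to \<open>D\<close>, products of at most
  \<open>n\<close> of them stay in \<open>box (n * D)\<close>, so the growth is at most cubic. The
  bound 6 is crude: it absorbs the constant \<open>D\<close> through
  \<open>(n * D + 1) ^ 3 \<le> n ^ 6\<close> for large \<open>n\<close>, and finiteness is all that
  is claimed.\<close>

theorem gk_dim_A: "gk_dim A < \<infinity>"
proof -
  have "gk_dim A \<le> ereal 6"
    unfolding gk_dim_def
  proof (rule SUP_least)
    fix V assume "V \<in> {k_span A S |S. S \<subseteq> carrier A \<and> finite S}"
    then obtain S where S: "V = k_span A S" "S \<subseteq> carrier A" "finite S" by blast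
    obtain D where D: "(\<Union>x\<in>S. keys (unrep x)) \<subseteq> box D"
      using finite_subset_box[of "\<Union>x\<in>S. keys (unrep x)"] S(3) by auto
    define U where "U E = {f :: expo \<Rightarrow>\<^sub>0 'k. keys f \<subseteq> box E}" for E
    have U: "0 \<in> U E" "\<And>f g. f \<in> U E \<Longrightarrow> g \<in> U E \<Longrightarrow> f + g \<in> U E"
      "\<And>c f. f \<in> U E \<Longrightarrow> scaleP c f \<in> U E" for E
    proof -
      show "f + g \<in> U E" if "f \<in> U E" "g \<in> U E" for f g
        using that keys_add[of f g] unfolding U_def by blast
      show "scaleP c f \<in> U E" if "f \<in> U E" for c f
        using that by (auto simp: U_def in_keys_iff lookup_scaleP)
    qed (simp add: U_def)
    have "S \<subseteq> rep ` U D"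
    proof
      fix x assume "x \<in> S"
      then show "x \<in> rep ` U D" using D S(2) by (intro image_eqI[of _ _ "unrep x"]) (auto simp: U_def)
    qed
    then have V: "V \<subseteq> rep ` U D" unfolding S(1) by (rule k_span_subset[OF _ U])
    have prod: "foldr (monoid.mult A) vs \<one>\<^bsub>A\<^esub> \<in> rep ` U (length vs * D)" if "set vs \<subseteq> V" for vs
      using that
    proof (induction vs)
      case Nil
      show ?case by (auto simp: U_def rep_one[symmetric] box_def zero_prod_def intro!: imageI)
    next
      case (Cons v vs)
      then obtain f g where "v = rep f" "f \<in> U D" "foldr (monoid.mult A) vs \<one>\<^bsub>A\<^esub> = rep g" "g \<in> U (length vs * D)"
        using V by auto
      then show ?case using keys_tmul_box by (auto simp: U_def rep_mult[symmetric] intro!: imageI)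
    qed
    have dim: "k_dim A (power_sum A V n) \<le> (n * D + 1) ^ 3" for n
    proof -
      let ?Q = "{foldr (monoid.mult A) vs \<one>\<^bsub>A\<^esub> |vs. set vs \<subseteq> V \<and> length vs \<le> n}"
      have mono: "U (m * D) \<subseteq> U (n * D)" if "m \<le> n" for m
      proof -
        have "m * D \<le> n * D" using that by (rule mult_le_mono1)
        then have "box (m * D) \<subseteq> box (n * D)" unfolding box_def by (intro Sigma_mono) auto
        then show ?thesis unfolding U_def by blast
      qed
      have Q: "?Q \<subseteq> rep ` U (n * D)"
        using prod mono by blast
      define S' where "S' = unrep ` ?Q"
      have S': "?Q = rep ` S'" "S' \<subseteq> U (n * D)" using Q unfolding S'_def by (force simp: image_image)+
      have "power_sum A V n = rep ` P.span S'" unfolding power_sum_def S'(1) by (rule k_span_rep)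
      moreover have "P.span S' \<subseteq> U (n * D)"
        by (rule P.span_minimal[OF S'(2)]) (auto simp: P.subspace_def U)
      ultimately have "k_dim A (power_sum A V n) \<le> card (box (n * D))"
        by (intro k_dim_le P.subspace_span finite_box) (auto simp: U_def)
      then show ?thesis by (simp add: card_box)
    qed
    have "eventually (\<lambda>n. ereal (log (real n) (real (k_dim A (power_sum A V n)))) \<le> ereal 6) sequentially"
      unfolding eventually_sequentially
    proof (intro exI allI impI)
      \<comment> \<open>From \<open>D + 1\<close> on one has \<open>n * D + 1 \<le> n ^ 2\<close>;
        the additional 1 ensures that the base of the logarithm exceeds 1 even for
        \<open>D = 0\<close>.\<close>
      fix n assume n: "D + 2 \<le> n"
      let ?d = "k_dim A (power_sum A V n)"
      have "n * D + 1 \<le> n * (D + 1)" using n by simp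
      also have "\<dots> \<le> n * n" using n by (intro mult_le_mono2) simp
      also have "n * n = n ^ 2" by (simp add: power2_eq_square)
      finally have "(n * D + 1) ^ 3 \<le> (n ^ 2) ^ 3" by (rule power_mono) simp
      then have "?d \<le> n ^ 6" using dim[of n] by (simp add: power_mult[symmetric])
      then have d: "real ?d \<le> real n ^ 6" by (metis of_nat_le_iff of_nat_power)
      have "log (real n) (real ?d) \<le> 6"
      proof (cases "?d = 0")
        \<comment> \<open>Here the logarithm is 0 by the convention \<open>ln 0 = 0\<close>.\<close>
        case True
        then show ?thesis by (simp add: log_def)
      next
        case False
        then have "log (real n) (real ?d) \<le> log (real n) (real n ^ 6)" using n d by (intro log_mono) auto
        also have "\<dots> = 6" using n by (simp add: log_nat_power)
        finally show ?thesis .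
      qed
      then show "ereal (log (real n) (real ?d)) \<le> ereal 6" by simp
    qed
    then show "limsup (\<lambda>n. ereal (log (real n) (real (k_dim A (power_sum A V n))))) \<le> ereal 6"
      by (rule Limsup_bounded)
  qed
  then show ?thesis by (rule order.strict_trans1) simp
qed

end

section \<open>The lower bound for the global dimension\<close>

section \<open>Comparison of projective resolutions\<close>

lemma module_homI:
  assumes "\<And>x. x \<in> carrier M \<Longrightarrow> f x \<in> carrier N"
    and "\<And>x y. x \<in> carrier M \<Longrightarrow> y \<in> carrier M \<Longrightarrow> f (x \<oplus>\<^bsub>M\<^esub> y) = f x \<oplus>\<^bsub>N\<^esub> f y"
    and "\<And>a x. a \<in> carrier R \<Longrightarrow> x \<in> carrier M \<Longrightarrow> f (a \<odot>\<^bsub>M\<^esub> x) = a \<odot>\<^bsub>N\<^esub> f x"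
    and "left_module R M"
  shows "(\<lambda>x \<in> carrier M. f x) \<in> module_hom R M N"
proof -
  interpret left_module R M by fact
  show ?thesis using assms(1-3) by (auto simp: module_hom_def smult_closed)
qed

context
  fixes R :: "('a, 'e) ring_scheme" and M :: "('a, 'm) module" and N :: "('a, 'n) module"
  assumes M: "left_module R M" and N: "left_module R N"
begin

interpretation M: left_module R M by (rule M)
interpretation N: left_module R N by (rule N)

lemma module_hom_zero:
  assumes f: "f \<in> module_hom R M N"
  shows "f \<zero>\<^bsub>M\<^esub> = \<zero>\<^bsub>N\<^esub>"
proof -
  have "f \<zero>\<^bsub>M\<^esub> \<oplus>\<^bsub>N\<^esub> f \<zero>\<^bsub>M\<^esub> = f \<zero>\<^bsub>M\<^esub>" using module_hom_add[OF f, of "\<zero>\<^bsub>M\<^esub>" "\<zero>\<^bsub>M\<^esub>"] by simp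
  then show ?thesis using module_hom_closed[OF f, of "\<zero>\<^bsub>M\<^esub>"] by (metis N.add.r_cancel_one' M.zero_closed)
qed

lemma module_hom_uminus:
  assumes f: "f \<in> module_hom R M N" and x: "x \<in> carrier M"
  shows "f (\<ominus>\<^bsub>M\<^esub> x) = \<ominus>\<^bsub>N\<^esub> f x"
proof -
  have "f (\<ominus>\<^bsub>M\<^esub> x) \<oplus>\<^bsub>N\<^esub> f x = \<zero>\<^bsub>N\<^esub>"
    using module_hom_add[OF f, of "\<ominus>\<^bsub>M\<^esub> x" x] x by (simp add: M.l_neg module_hom_zero[OF f])
  then show ?thesis using module_hom_closed[OF f] x by (metis N.minus_equality M.a_inv_closed)
qed

lemma module_hom_minus:
  assumes f: "f \<in> module_hom R M N" and x: "x \<in> carrier M" "y \<in> carrier M"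
  shows "f (x \<ominus>\<^bsub>M\<^esub> y) = f x \<ominus>\<^bsub>N\<^esub> f y"
  using x by (simp add: a_minus_def module_hom_add[OF f] module_hom_uminus[OF f])

lemma smult_uminus: "a \<in> carrier R \<Longrightarrow> x \<in> carrier N \<Longrightarrow> a \<odot>\<^bsub>N\<^esub> (\<ominus>\<^bsub>N\<^esub> x) = \<ominus>\<^bsub>N\<^esub> (a \<odot>\<^bsub>N\<^esub> x)"
proof -
  assume ax: "a \<in> carrier R" "x \<in> carrier N"
  have z: "a \<odot>\<^bsub>N\<^esub> \<zero>\<^bsub>N\<^esub> = \<zero>\<^bsub>N\<^esub>"
    using ax N.smult_r_distr[of a "\<zero>\<^bsub>N\<^esub>" "\<zero>\<^bsub>N\<^esub>"] N.smult_closed[of a "\<zero>\<^bsub>N\<^esub>"]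
    by (metis N.add.r_cancel_one' N.r_zero N.zero_closed)
  have "a \<odot>\<^bsub>N\<^esub> (\<ominus>\<^bsub>N\<^esub> x) \<oplus>\<^bsub>N\<^esub> a \<odot>\<^bsub>N\<^esub> x = \<zero>\<^bsub>N\<^esub>"
    using ax by (simp add: N.smult_r_distr[symmetric] N.l_neg z)
  then show ?thesis using ax by (metis N.minus_equality N.a_inv_closed N.smult_closed)
qed

lemma module_hom_diff:
  assumes f: "f \<in> module_hom R M N" and g: "g \<in> module_hom R M N"
  shows "(\<lambda>x \<in> carrier M. f x \<ominus>\<^bsub>N\<^esub> g x) \<in> module_hom R M N"
proof (rule module_homI[OF _ _ _ M])
  note c = module_hom_closed[OF f] module_hom_closed[OF g]
  show "f x \<ominus>\<^bsub>N\<^esub> g x \<in> carrier N" if "x \<in> carrier M" for x using that c by simp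
  show "f (x \<oplus>\<^bsub>M\<^esub> y) \<ominus>\<^bsub>N\<^esub> g (x \<oplus>\<^bsub>M\<^esub> y) = f x \<ominus>\<^bsub>N\<^esub> g x \<oplus>\<^bsub>N\<^esub> (f y \<ominus>\<^bsub>N\<^esub> g y)"
    if "x \<in> carrier M" "y \<in> carrier M" for x y
    using that c by (simp add: module_hom_add[OF f] module_hom_add[OF g] a_minus_def N.minus_add N.a_ac)
  show "f (a \<odot>\<^bsub>M\<^esub> x) \<ominus>\<^bsub>N\<^esub> g (a \<odot>\<^bsub>M\<^esub> x) = a \<odot>\<^bsub>N\<^esub> (f x \<ominus>\<^bsub>N\<^esub> g x)"
    if "a \<in> carrier R" "x \<in> carrier M" for a x
    using that c by (simp add: module_hom_smult[OF f] module_hom_smult[OF g] a_minus_def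
        N.smult_r_distr smult_uminus)
qed

end

lemma module_hom_comp:
  assumes M: "left_module R M" and f: "f \<in> module_hom R M N" and g: "g \<in> module_hom R N L"
  shows "(\<lambda>x \<in> carrier M. g (f x)) \<in> module_hom R M L"
  by (rule module_homI[OF _ _ _ M])
    (simp_all add: module_hom_closed[OF f] module_hom_closed[OF g] module_hom_add[OF f] module_hom_add[OF g]
      module_hom_smult[OF f] module_hom_smult[OF g])

lemma module_hom_id:
  assumes M: "left_module R M"
  shows "(\<lambda>x \<in> carrier M. x) \<in> module_hom R M M"
  by (rule module_homI[OF _ _ _ M]) simp_all

lemma left_module_image:
  assumes L: "left_module R L" and N: "left_module R N" and d: "d \<in> module_hom R L N"
  shows "left_module R (N\<lparr>carrier := d ` carrier L\<rparr>)"
proof -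
  interpret L: left_module R L by (rule L)
  interpret N: left_module R N by (rule N)
  let ?I = "N\<lparr>carrier := d ` carrier L\<rparr>"
  note c = module_hom_closed[OF d]
  have "abelian_group ?I"
  proof (rule abelian_groupI)
    show "\<zero>\<^bsub>?I\<^esub> \<in> carrier ?I" using module_hom_zero[OF L N d] by (auto intro!: image_eqI[of _ _ "\<zero>\<^bsub>L\<^esub>"])
    show "x \<oplus>\<^bsub>?I\<^esub> y \<in> carrier ?I" if "x \<in> carrier ?I" "y \<in> carrier ?I" for x y
      using that by (auto simp: module_hom_add[OF d, symmetric])
    show "\<exists>y\<in>carrier ?I. y \<oplus>\<^bsub>?I\<^esub> x = \<zero>\<^bsub>?I\<^esub>" if x: "x \<in> carrier ?I" for x
    proof -
      obtain z where z: "x = d z" "z \<in> carrier L" using x by auto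
      show ?thesis
      proof (rule bexI[of _ "d (\<ominus>\<^bsub>L\<^esub> z)"])
        show "d (\<ominus>\<^bsub>L\<^esub> z) \<oplus>\<^bsub>?I\<^esub> x = \<zero>\<^bsub>?I\<^esub>"
          using z c by (simp add: module_hom_uminus[OF L N d] N.l_neg)
      qed (use z in simp)
    qed
  qed (auto simp: c N.a_ac)
  moreover have "a \<odot>\<^bsub>N\<^esub> x \<in> d ` carrier L" if "a \<in> carrier R" "x \<in> d ` carrier L" for a x
    using that L.smult_closed by (auto simp: module_hom_smult[OF d, symmetric])
  ultimately show ?thesis
    by (intro left_module.intro left_module_axioms.intro L.ring_axioms)
      (auto simp: c N.smult_l_distr N.smult_r_distr N.smult_assoc N.smult_one)
qed

text \<open>Projectivity lifts through surjections, so the target is first cut down to the image of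
  \<open>d\<close>; by exactness this is the kernel in which \<open>h\<close> takes its
  values.\<close>

lemma projective_lift:
  fixes Q L L' :: "('a, 'u) module" and L'' :: "('a, 'm) module"
  assumes Q: "projective R Q" and L: "left_module R L" and L': "left_module R L'"
    and d: "d \<in> module_hom R L L'" and ker: "a_kernel L' L'' d' = d ` carrier L"
    and h: "h \<in> module_hom R Q L'" and zero: "\<And>x. x \<in> carrier Q \<Longrightarrow> d' (h x) = \<zero>\<^bsub>L''\<^esub>"
  obtains k where "k \<in> module_hom R Q L" "\<And>x. x \<in> carrier Q \<Longrightarrow> d (k x) = h x"
proof -
  let ?N = "L'\<lparr>carrier := d ` carrier L\<rparr>"
  have N: "left_module R ?N" by (rule left_module_image[OF L L' d])
  have lift: "\<exists>k \<in> module_hom R Q M. \<forall>x \<in> carrier Q. g (k x) = f x"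
    if "left_module R M" "left_module R N" "g \<in> module_hom R M N" "g ` carrier M = carrier N"
      "f \<in> module_hom R Q N" for M N :: "('a, 'u) module" and g f
    using that Q unfolding projective_def by blast
  have d': "d \<in> module_hom R L ?N" using d by (auto simp: module_hom_def)
  have h': "h \<in> module_hom R Q ?N"
    using h zero by (auto simp: module_hom_def ker[symmetric] a_kernel_def')
  obtain k where "k \<in> module_hom R Q L" "\<forall>x \<in> carrier Q. d (k x) = h x"
    using lift[OF L N d' _ h'] by auto
  then show ?thesis using that by blast
qed

text \<open>The composite of comparison maps \<open>Q \<rightarrow> P \<rightarrow> Q\<close> is homotopic to the identity and vanishes in degree 3, so
  the homotopy splits the last differential of \<open>Q\<close>.\<close>

theorem comparison_splits:
  fixes P Q :: "nat \<Rightarrow> ('a, 'u) module" and M :: "('a, 'u) module"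
  assumes M: "left_module R M" and P: "projective_resolution R P D \<epsilon> M"
    and Q: "projective_resolution R Q E \<eta> M"
    and P3: "carrier (P 3) = {\<zero>\<^bsub>P 3\<^esub>}" and inj: "inj_on (E 2) (carrier (Q 3))"
  obtains s where "s \<in> module_hom R (Q 2) (Q 3)" "\<And>x. x \<in> carrier (Q 3) \<Longrightarrow> s (E 2 x) = x"
proof -
  have Pp: "projective R (P i)" and Qp: "projective R (Q i)" for i
    using P Q by (auto simp: projective_resolution_def)
  then have Pm: "left_module R (P i)" and Qm: "left_module R (Q i)" for i
    by (auto simp: projective_def)
  have D: "D 0 \<in> module_hom R (P 1) (P 0)" "D 1 \<in> module_hom R (P 2) (P 1)" "D 2 \<in> module_hom R (P 3) (P 2)"
    and E: "E 0 \<in> module_hom R (Q 1) (Q 0)" "E 1 \<in> module_hom R (Q 2) (Q 1)" "E 2 \<in> module_hom R (Q 3) (Q 2)"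
    and ep: "\<epsilon> \<in> module_hom R (P 0) M" "\<epsilon> ` carrier (P 0) = carrier M"
    and et: "\<eta> \<in> module_hom R (Q 0) M" "\<eta> ` carrier (Q 0) = carrier M"
    and kP: "a_kernel (P 0) M \<epsilon> = D 0 ` carrier (P 1)" "a_kernel (P 1) (P 0) (D 0) = D 1 ` carrier (P 2)"
      "a_kernel (P 2) (P 1) (D 1) = D 2 ` carrier (P 3)"
    and kQ: "a_kernel (Q 0) M \<eta> = E 0 ` carrier (Q 1)" "a_kernel (Q 1) (Q 0) (E 0) = E 1 ` carrier (Q 2)"
      "a_kernel (Q 2) (Q 1) (E 1) = E 2 ` carrier (Q 3)"
    using P Q unfolding projective_resolution_def by (metis One_nat_def Suc_1 numeral_3_eq_3)+
  have DD: "\<And>x. x \<in> carrier (P 1) \<Longrightarrow> \<epsilon> (D 0 x) = \<zero>\<^bsub>M\<^esub>" "\<And>x. x \<in> carrier (P 2) \<Longrightarrow> D 0 (D 1 x) = \<zero>\<^bsub>P 0\<^esub>"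
    and EE: "\<And>x. x \<in> carrier (Q 1) \<Longrightarrow> \<eta> (E 0 x) = \<zero>\<^bsub>M\<^esub>" "\<And>x. x \<in> carrier (Q 2) \<Longrightarrow> E 0 (E 1 x) = \<zero>\<^bsub>Q 0\<^esub>"
      "\<And>x. x \<in> carrier (Q 3) \<Longrightarrow> E 1 (E 2 x) = \<zero>\<^bsub>Q 1\<^esub>"
    using kP kQ by (auto simp: a_kernel_def')
  interpret M: left_module R M by (rule M)
  interpret P0: left_module R "P 0" by (rule Pm)
  interpret P1: left_module R "P 1" by (rule Pm)
  interpret P2: left_module R "P 2" by (rule Pm)
  interpret Q0: left_module R "Q 0" by (rule Qm)
  interpret Q1: left_module R "Q 1" by (rule Qm)
  interpret Q2: left_module R "Q 2" by (rule Qm)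
  interpret Q3: left_module R "Q 3" by (rule Qm)
  have rr: "x \<ominus>\<^bsub>L\<^esub> x = \<zero>\<^bsub>L\<^esub>" if "left_module R L" "x \<in> carrier L" for L :: "('a, 'u) module" and x
  proof -
    interpret L: left_module R L by (rule that)
    show ?thesis using that(2) by (simp add: a_minus_def L.r_neg)
  qed
  note rr = rr[OF M] rr[OF Qm]
  have mz: "x \<ominus>\<^bsub>Q i\<^esub> \<zero>\<^bsub>Q i\<^esub> = x" if "x \<in> carrier (Q i)" for x i
  proof -
    interpret L: left_module R "Q i" by (rule Qm)
    have "\<ominus>\<^bsub>Q i\<^esub> \<zero>\<^bsub>Q i\<^esub> = \<zero>\<^bsub>Q i\<^esub>" by (rule L.M.minus_equality) simp_all
    then show ?thesis using that by (simp add: a_minus_def)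
  qed
  note cl = D[THEN module_hom_closed] E[THEN module_hom_closed] ep(1)[THEN module_hom_closed]
    et(1)[THEN module_hom_closed]
  have proj: "\<exists>k \<in> module_hom R Z L. \<forall>x \<in> carrier Z. d (k x) = h x"
    if "projective R Z" "left_module R L" "d \<in> module_hom R L M" "d ` carrier L = carrier M" "h \<in> module_hom R Z M"
    for Z L :: "('a, 'u) module" and d h
    using that M unfolding projective_def by blast
  \<comment> \<open>The comparison maps \<open>f_i\<close> from \<open>Q\<close> to \<open>P\<close>
    and \<open>g_i\<close> back are built up to degree 2, where they end because \<open>P 3\<close>
    is zero.\<close>
  obtain f0 where f0: "f0 \<in> module_hom R (Q 0) (P 0)" "\<And>x. x \<in> carrier (Q 0) \<Longrightarrow> \<epsilon> (f0 x) = \<eta> x"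
    using proj[OF Qp Pm ep et(1)] by blast
  obtain g0 where g0: "g0 \<in> module_hom R (P 0) (Q 0)" "\<And>x. x \<in> carrier (P 0) \<Longrightarrow> \<eta> (g0 x) = \<epsilon> x"
    using proj[OF Pp Qm et ep(1)] by blast
  note cl = cl f0(1)[THEN module_hom_closed] g0(1)[THEN module_hom_closed]
  obtain f1 where f1: "f1 \<in> module_hom R (Q 1) (P 1)" "\<And>x. x \<in> carrier (Q 1) \<Longrightarrow> D 0 (f1 x) = f0 (E 0 x)"
    using projective_lift[OF Qp Pm Pm D(1) kP(1) module_hom_comp[OF Qm E(1) f0(1)]]
    by (auto simp del: One_nat_def simp add: cl f0(2) EE)
  note cl = cl f1(1)[THEN module_hom_closed]
  obtain g1 where g1: "g1 \<in> module_hom R (P 1) (Q 1)" "\<And>x. x \<in> carrier (P 1) \<Longrightarrow> E 0 (g1 x) = g0 (D 0 x)"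
    using projective_lift[OF Pp Qm Qm E(1) kQ(1) module_hom_comp[OF Pm D(1) g0(1)]]
    by (auto simp del: One_nat_def simp add: cl g0(2) DD)
  note cl = cl g1(1)[THEN module_hom_closed]
  obtain f2 where f2: "f2 \<in> module_hom R (Q 2) (P 2)" "\<And>x. x \<in> carrier (Q 2) \<Longrightarrow> D 1 (f2 x) = f1 (E 1 x)"
    using projective_lift[OF Qp Pm Pm D(2) kP(2) module_hom_comp[OF Qm E(2) f1(1)]]
    by (auto simp del: One_nat_def simp add: cl f1(2) EE module_hom_zero[OF Qm Pm f0(1)])
  note cl = cl f2(1)[THEN module_hom_closed]
  obtain g2 where g2: "g2 \<in> module_hom R (P 2) (Q 2)" "\<And>x. x \<in> carrier (P 2) \<Longrightarrow> E 1 (g2 x) = g1 (D 1 x)"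
    using projective_lift[OF Pp Qm Qm E(2) kQ(2) module_hom_comp[OF Pm D(2) g1(1)]]
    by (auto simp del: One_nat_def simp add: cl g1(2) DD module_hom_zero[OF Pm Qm g0(1)])
  note cl = cl g2(1)[THEN module_hom_closed]
  \<comment> \<open>Here the homotopy starts: \<open>E s + s E = 1 - g f\<close> in each degree,
    without the term \<open>s E\<close> in degree 0. Each \<open>s_i\<close> lifts the difference
    that remains, which is a cycle by the identity one degree below.\<close>
  have h0: "(\<lambda>x \<in> carrier (Q 0). (\<lambda>x \<in> carrier (Q 0). x) x \<ominus>\<^bsub>Q 0\<^esub> (\<lambda>x \<in> carrier (Q 0). g0 (f0 x)) x) \<in> module_hom R (Q 0) (Q 0)"
    by (rule module_hom_diff[OF Qm Qm module_hom_id[OF Qm] module_hom_comp[OF Qm f0(1) g0(1)]])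
  obtain s0 where s0: "s0 \<in> module_hom R (Q 0) (Q 1)" "\<And>x. x \<in> carrier (Q 0) \<Longrightarrow> E 0 (s0 x) = x \<ominus>\<^bsub>Q 0\<^esub> g0 (f0 x)"
    using projective_lift[OF Qp Qm Qm E(1) kQ(1) h0]
    by (auto simp del: One_nat_def simp add: cl module_hom_minus[OF Qm M et(1)] f0(2) g0(2) rr)
  note cl = cl s0(1)[THEN module_hom_closed]
  have h1: "(\<lambda>x \<in> carrier (Q 1). (\<lambda>x \<in> carrier (Q 1). (\<lambda>x \<in> carrier (Q 1). x) x \<ominus>\<^bsub>Q 1\<^esub> (\<lambda>x \<in> carrier (Q 1). g1 (f1 x)) x) x
      \<ominus>\<^bsub>Q 1\<^esub> (\<lambda>x \<in> carrier (Q 1). s0 (E 0 x)) x) \<in> module_hom R (Q 1) (Q 1)"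
    by (intro module_hom_diff[OF Qm Qm] module_hom_id[OF Qm] module_hom_comp[OF Qm f1(1) g1(1)]
        module_hom_comp[OF Qm E(1) s0(1)])
  obtain s1 where s1: "s1 \<in> module_hom R (Q 1) (Q 2)"
    "\<And>x. x \<in> carrier (Q 1) \<Longrightarrow> E 1 (s1 x) = x \<ominus>\<^bsub>Q 1\<^esub> g1 (f1 x) \<ominus>\<^bsub>Q 1\<^esub> s0 (E 0 x)"
    using projective_lift[OF Qp Qm Qm E(2) kQ(2) h1]
    by (auto simp del: One_nat_def simp add: cl module_hom_minus[OF Qm Qm E(1)] f1(2) g1(2) s0(2) rr)
  note cl = cl s1(1)[THEN module_hom_closed]
  have h2: "(\<lambda>x \<in> carrier (Q 2). (\<lambda>x \<in> carrier (Q 2). (\<lambda>x \<in> carrier (Q 2). x) x \<ominus>\<^bsub>Q 2\<^esub> (\<lambda>x \<in> carrier (Q 2). g2 (f2 x)) x) x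
      \<ominus>\<^bsub>Q 2\<^esub> (\<lambda>x \<in> carrier (Q 2). s1 (E 1 x)) x) \<in> module_hom R (Q 2) (Q 2)"
    by (intro module_hom_diff[OF Qm Qm] module_hom_id[OF Qm] module_hom_comp[OF Qm f2(1) g2(1)]
        module_hom_comp[OF Qm E(2) s1(1)])
  obtain s2 where s2: "s2 \<in> module_hom R (Q 2) (Q 3)"
    "\<And>x. x \<in> carrier (Q 2) \<Longrightarrow> E 2 (s2 x) = x \<ominus>\<^bsub>Q 2\<^esub> g2 (f2 x) \<ominus>\<^bsub>Q 2\<^esub> s1 (E 1 x)"
    using projective_lift[OF Qp Qm Qm E(3) kQ(3) h2]
    by (auto simp del: One_nat_def simp add: cl module_hom_minus[OF Qm Qm E(2)] f2(2) g2(2) s1(2) EE module_hom_zero[OF Qm Qm s0(1)]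
        mz[of _ 1] rr)
  have "s2 (E 2 x) = x" if x: "x \<in> carrier (Q 3)" for x
  proof -
    \<comment> \<open>On the image of \<open>E 2\<close> the map \<open>f2\<close> takes values in
      the cycles of \<open>P 2\<close>, that is, in the image of \<open>P 3\<close>, so the
      comparison maps contribute nothing. The term with \<open>s1\<close> vanishes because
      \<open>E 1\<close> kills that image.\<close>
    have "D 1 (f2 (E 2 x)) = \<zero>\<^bsub>P 1\<^esub>"
      using x by (simp del: One_nat_def add: cl f2(2) EE module_hom_zero[OF Qm Pm f1(1)])
    then have "f2 (E 2 x) \<in> D 2 ` carrier (P 3)"
      unfolding kP(3)[symmetric] a_kernel_def' using x by (simp del: One_nat_def add: cl)
    then have "f2 (E 2 x) = \<zero>\<^bsub>P 2\<^esub>" using P3 module_hom_zero[OF Pm Pm D(3)] by simp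
    then have "E 2 (s2 (E 2 x)) = E 2 x \<ominus>\<^bsub>Q 2\<^esub> \<zero>\<^bsub>Q 2\<^esub> \<ominus>\<^bsub>Q 2\<^esub> \<zero>\<^bsub>Q 2\<^esub>"
      using x by (simp del: One_nat_def add: s2(2) cl EE module_hom_zero[OF Pm Qm g2(1)] module_hom_zero[OF Qm Qm s1(1)])
    also have "\<dots> = E 2 x"
      using mz[of "E 2 x" 2] module_hom_closed[OF E(3) x] by simp
    finally show ?thesis
      using x by - (rule inj_onD[OF inj], simp_all del: One_nat_def add: cl module_hom_closed[OF s2(1)])
  qed
  then show ?thesis using s2(1) that by blast
qed


section \<open>The global dimension is three\<close>

context gqalg
begin

text \<open>The trivial module, copied into \<open>'u\<close>.\<close>

definition TMu :: "('k \<Rightarrow> 'u) \<Rightarrow> ('a, 'u) module"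
  where "TMu \<iota> = \<lparr>carrier = range \<iota>, monoid.mult = undefined, one = undefined, ring.zero = \<iota> 0,
    add = (\<lambda>x y. \<iota> (the_inv_into UNIV \<iota> x + the_inv_into UNIV \<iota> y)),
    module.smult = (\<lambda>a x. \<iota> (augmentation A G a * the_inv_into UNIV \<iota> x))\<rparr>"

context
  fixes \<iota> :: "'k \<Rightarrow> 'u" and j :: "'k poly3 \<Rightarrow> 'u"
  assumes \<iota>: "inj \<iota>" and j: "inj j"
begin

lemma TMu_simps [simp]: "carrier (TMu \<iota>) = range \<iota>" "\<zero>\<^bsub>TMu \<iota>\<^esub> = \<iota> 0" "\<iota> c \<oplus>\<^bsub>TMu \<iota>\<^esub> \<iota> d = \<iota> (c + d)"
  "rep f \<odot>\<^bsub>TMu \<iota>\<^esub> \<iota> c = \<iota> (lookup f 0 * c)"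
  by (simp_all add: TMu_def augmentation_rep the_inv_into_f_f[OF \<iota>])

lemma TMu_left_module: "left_module A (TMu \<iota>)"
proof -
  have "abelian_group (TMu \<iota>)"
  proof (rule abelian_groupI)
    show "\<exists>y\<in>carrier (TMu \<iota>). y \<oplus>\<^bsub>TMu \<iota>\<^esub> x = \<zero>\<^bsub>TMu \<iota>\<^esub>" if x: "x \<in> carrier (TMu \<iota>)" for x
    proof -
      obtain c where "x = \<iota> c" using x by auto
      then show ?thesis by (intro bexI[of _ "\<iota> (- c)"]) simp_all
    qed
  qed (auto simp: add.assoc add.commute add.left_commute)
  then show ?thesis
    by (intro left_module.intro left_module_axioms.intro ring_A)
      (auto elim!: rep_cases simp: rep_add[symmetric] rep_mult[symmetric] rep_one[symmetric]
        lookup_tmul_0 lookup_add distrib_left distrib_right)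
qed

lemma TMu_kres: "kres ch (*) (\<lambda>_ _. 0) (\<lambda>w. w) A rep (TMu \<iota>) \<iota> j"
proof (intro kres.intro koszul.intro koszul_axioms.intro qmap.intro qmap_axioms.intro kres_axioms.intro
    TMu_left_module j)
  show "qalg ch A rep" "twist ch (*)" "twist ch (*)"
    by (rule qalg_axioms, rule self.twist_axioms, rule self.twist_axioms)
  have "0 \<noteq> unit_vec i" for i by (simp add: unit_vec_def zero_prod_def)
  then have "lookup (single (unit_vec i) (1::'k)) 0 = 0" for i by (metis lookup_single_not_eq)
  then show "\<iota> 0 = rep (single (unit_vec i) 1) \<odot>\<^bsub>TMu \<iota>\<^esub> \<iota> w" for i w
    by (simp only: TMu_simps mult_zero_left)
  show "w = 0" if "\<iota> w = \<zero>\<^bsub>TMu \<iota>\<^esub>" for w using that injD[OF \<iota>] by simp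
  show "\<exists>w. w = w \<and> \<iota> w = m" if "m \<in> carrier (TMu \<iota>)" for m using that by auto
qed (simp_all add: additive_def madd_def)

interpretation kr: kres ch "(*)" "\<lambda>_ _. 0" "\<lambda>w. w" A rep "TMu \<iota>" \<iota> j
  by (rule TMu_kres)

text \<open>On the unit, right and left multiplication by a variable agree, so the differential of
  the top generator is a combination of generators with coefficients acting from the left.\<close>

lemma kz_eq_lz: "kr.kz i u v (single 0 1) = tmul (single (unit_vec i) u) (single 0 1)"
  by (simp add: kr.kz_single tmul_single del: single_one)

text \<open>The last Koszul differential does not split, since its entries have no constant term.\<close>

lemma TMu_proj_dim: "proj_dim A (TMu \<iota>) \<ge> enat 3"
  unfolding proj_dim_def
proof (rule Inf_greatest)
  fix m assume "m \<in> {enat n |n. \<exists>(P :: nat \<Rightarrow> ('a, 'u) module) D \<epsilon>. projective_resolution A P D \<epsilon> (TMu \<iota>) \<and>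
    (\<forall>i>n. carrier (P i) = {\<zero>\<^bsub>P i\<^esub>})}"
  then obtain n and P :: "nat \<Rightarrow> ('a, 'u) module" and D \<epsilon> where m: "m = enat n"
    and P: "projective_resolution A P D \<epsilon> (TMu \<iota>)" "\<forall>i>n. carrier (P i) = {\<zero>\<^bsub>P i\<^esub>}" by blast
  have "\<not> n < 3"
  proof
    assume "n < 3"
    then have P3: "carrier (P 3) = {\<zero>\<^bsub>P 3\<^esub>}" using P(2) by simp
    have PRid: "kr.PR f = f" for f by (rule poly_mapping_eqI) (simp add: kr.lookup_PR)
    have KE: "kr.KE i = kr.KC i" for i
      unfolding kr.KE_def kr.PT_def by (auto simp: PRid)
    have KE2: "z \<in> kr.KE 2" for z by (cases z) (simp add: KE kr.KC_def)
    have KE3: "z \<in> kr.KE 3 \<longleftrightarrow> snd z = 0" for z by (cases z) (simp add: KE kr.KC_def zero_prod_def)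
    have eq3: "(3::nat) = Suc 2" "(2::nat) = Suc 1" by simp_all
    have inj: "inj_on (kr.DM 2) (carrier (kr.PM 3))"
    proof (rule inj_onI)
      fix x y assume "x \<in> carrier (kr.PM 3)" "y \<in> carrier (kr.PM 3)" and eq: "kr.DM 2 x = kr.DM 2 y"
      then obtain a b where ab: "x = j a" "a \<in> kr.KE 3" "y = j b" "b \<in> kr.KE 3"
        unfolding kr.PM_simps(1) by (elim imageE)
      then have "kr.dd 2 a = kr.dd 2 b" using eq unfolding eq3(1) by simp
      then have "kr.k123_3 (fst a - fst b) = 0"
        by (cases a; cases b) (simp add: kr.dd_def additive.diff[OF kr.additive_kz])
      from kr.kc.exact_3[OF this] have "fst a = fst b" by simp
      then show "x = y" using ab by (simp add: KE3 prod_eq_iff)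
    qed
    obtain s where s: "s \<in> module_hom A (kr.PM 2) (kr.PM 3)"
      "\<And>x. x \<in> carrier (kr.PM 3) \<Longrightarrow> s (kr.DM 2 x) = x"
      using comparison_splits[OF TMu_left_module P(1) kr.kres_resolution P3 inj] by blast
    \<comment> \<open>The retraction in coordinates: from the free module of rank 3 to the one of
      rank 1.\<close>
    define t where "t z = fst (kr.jinv (s (j z)))" for z
    have jt: "s (j z) \<in> j ` kr.KE 3" for z
      using module_hom_closed[OF s(1), of "j z"] KE2 by (simp add: imageI)
    have t_add: "t (y + z) = t y + t z" for y z
    proof -
      obtain a where "s (j y) = j a" using jt[of y] by (elim imageE)
      moreover obtain b where "s (j z) = j b" using jt[of z] by (elim imageE)
      ultimately show ?thesis
        using module_hom_add[OF s(1), of "j y" "j z"] KE2 by (simp add: t_def imageI)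
    qed
    \<comment> \<open>By linearity a left multiple of a variable goes to a left multiple of it by
      the variable, which has no constant term.\<close>
    have t_act: "lookup (t (kr.tactT (single (unit_vec i) u) z)) 0 = 0" for i u z
    proof -
      obtain a where "s (j z) = j a" using jt[of z] by (elim imageE)
      then have "t (kr.tactT (single (unit_vec i) u) z) = tmul (single (unit_vec i) u) (fst a)"
        using module_hom_smult[OF s(1), of "rep (single (unit_vec i) u)" "j z"] KE2
        by (cases a) (simp add: t_def imageI kr.tactT_def)
      moreover have "unit_vec i \<noteq> 0" by (simp add: unit_vec_def zero_prod_def)
      ultimately show ?thesis by (simp add: lookup_tmul_0 lookup_single)
    qed
    \<comment> \<open>The generator of the top term. Its differential consists of multiples of
      variables, so the retraction would have to return the unit as an element without constant
      term.\<close>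
    define x :: "'k poly3" where "x = (single 0 1, 0, 0)"
    have x: "x \<in> kr.KE 3" by (simp add: KE3 x_def zero_prod_def)
    have "kr.dd 2 x = kr.tactT (single (unit_vec 3) (cc 1 3 * cc 2 3)) (single 0 1, 0, 0)
      + kr.tactT (single (unit_vec 2) (- (cc 1 2 * cc 3 2))) (0, single 0 1, 0)
      + kr.tactT (single (unit_vec 1) (cc 2 1 * cc 3 1)) (0, 0, single 0 1)"
      by (simp add: x_def kr.dd_def kz_eq_lz kr.tactT_def del: single_one One_nat_def)
    then have "lookup (t (kr.dd 2 x)) 0 = 0" by (simp only: t_add lookup_add t_act) simp
    moreover have "t (kr.dd 2 x) = single 0 1"
      using s(2)[of "j x"] x unfolding t_def eq3(1) by (simp add: imageI x_def)
    ultimately show False by simp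
  qed
  then show "enat 3 \<le> m" by (simp add: m)
qed

theorem left_gldim_A:
  assumes "\<exists>j :: ('u \<Rightarrow>\<^sub>0 'k) poly3 \<Rightarrow> 'u. inj j"
  shows "left_gldim TYPE('u) A = enat 3"
proof (rule antisym[OF left_gldim_le[OF assms]])
  have "enat 3 \<le> proj_dim A (TMu \<iota>)" by (rule TMu_proj_dim)
  also have "\<dots> \<le> left_gldim TYPE('u) A"
    unfolding left_gldim_def using TMu_left_module by (intro SUP_upper) simp
  finally show "enat 3 \<le> left_gldim TYPE('u) A" .
qed

end

end

section \<open>The graded Koszul resolution, its dual, and Ext\<close>

section \<open>The graded Koszul resolution of the trivial module\<close>

text \<open>The projections \<open>p i\<close> certify the decomposition: applying
  \<open>p k\<close> to any homogeneous decomposition isolates its k-th part, which gives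
  uniqueness.\<close>

lemma internal_direct_sumI:
  fixes M :: "('b, 'e) ring_scheme" and \<kappa> :: "'v::ab_group_add \<Rightarrow> 'b"
  assumes M: "abelian_group M" and carrier: "carrier M = \<kappa> ` C" and inj: "inj \<kappa>"
    and add: "\<And>x y. x \<in> C \<Longrightarrow> y \<in> C \<Longrightarrow> \<kappa> (x + y) = \<kappa> x \<oplus>\<^bsub>M\<^esub> \<kappa> y" and zero: "\<kappa> 0 = \<zero>\<^bsub>M\<^esub>"
    and C: "\<And>x y. x \<in> C \<Longrightarrow> y \<in> C \<Longrightarrow> x + y \<in> C"
    and S: "\<And>i. S i \<subseteq> C" "\<And>i. 0 \<in> S i" "\<And>i x y. x \<in> S i \<Longrightarrow> y \<in> S i \<Longrightarrow> x + y \<in> S i"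
      "\<And>i x. x \<in> S i \<Longrightarrow> - x \<in> S i"
    and p: "\<And>i. additive (p i)" "\<And>i x. x \<in> C \<Longrightarrow> p i x \<in> S i" "\<And>i x. x \<in> S i \<Longrightarrow> p i x = x"
      "\<And>i k x. x \<in> S i \<Longrightarrow> k \<noteq> i \<Longrightarrow> p k x = 0"
    and fin: "\<And>x. x \<in> C \<Longrightarrow> finite {i. p i x \<noteq> 0}"
    and sum: "\<And>x. x \<in> C \<Longrightarrow> (\<Sum>i | p i x \<noteq> 0. p i x) = x"
  shows "internal_direct_sum M (\<lambda>i. \<kappa> ` S i)"
  unfolding internal_direct_sum_def
proof (intro conjI allI ballI)
  interpret M: abelian_group M by (rule M)
  have C0: "0 \<in> C" using S by blast
  have k0: "\<kappa> x = \<zero>\<^bsub>M\<^esub> \<longleftrightarrow> x = 0" for x using inj_eq[OF inj, of x 0] zero by simp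
  have ksum: "finsum M (\<lambda>i. \<kappa> (h i)) I = \<kappa> (\<Sum>i\<in>I. h i) \<and> (\<Sum>i\<in>I. h i) \<in> C"
    if "finite I" "\<And>i. h i \<in> S i" for I and h
    using that(1)
  proof (induction I rule: finite_induct)
    case empty
    show ?case by (simp add: zero C0)
  next
    case (insert i I)
    have hC: "h i \<in> C" for i using that(2) S(1) by blast
    have "finsum M (\<lambda>i. \<kappa> (h i)) (insert i I) = \<kappa> (h i) \<oplus>\<^bsub>M\<^esub> finsum M (\<lambda>i. \<kappa> (h i)) I"
      using insert hC by (intro M.finsum_insert) (auto simp: carrier)
    then show ?case using insert hC by (simp add: add C)
  qed
  show "additive_subgroup (\<kappa> ` S i) M" for i
  proof (intro additive_subgroup.intro subgroup.intro)
    show "\<kappa> ` S i \<subseteq> carrier (add_monoid M)" using S(1) by (auto simp: carrier)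
    show "x \<otimes>\<^bsub>add_monoid M\<^esub> y \<in> \<kappa> ` S i" if "x \<in> \<kappa> ` S i" "y \<in> \<kappa> ` S i" for x y
    proof -
      obtain a b where ab: "x = \<kappa> a" "y = \<kappa> b" "a \<in> S i" "b \<in> S i" using \<open>x \<in> _\<close> \<open>y \<in> _\<close> by blast
      then have "x \<otimes>\<^bsub>add_monoid M\<^esub> y = \<kappa> (a + b)" using add S(1) by (simp add: subset_eq)
      then show ?thesis using ab S(3) by blast
    qed
    show "\<one>\<^bsub>add_monoid M\<^esub> \<in> \<kappa> ` S i" using S(2)[of i] zero by (auto intro!: image_eqI[of _ _ 0])
    show "inv\<^bsub>add_monoid M\<^esub> x \<in> \<kappa> ` S i" if x: "x \<in> \<kappa> ` S i" for x
    proof -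
      obtain a where a: "x = \<kappa> a" "a \<in> S i" using x by blast
      then have aC: "a \<in> C" "- a \<in> C" using S(1,4) by blast+
      then have "\<kappa> (- a) \<oplus>\<^bsub>M\<^esub> x = \<zero>\<^bsub>M\<^esub>" using add[of "- a" a] zero by (simp add: a(1))
      moreover have "x \<in> carrier M" "\<kappa> (- a) \<in> carrier M" using a(1) aC by (simp_all add: carrier imageI)
      ultimately have "\<ominus>\<^bsub>M\<^esub> x = \<kappa> (- a)" by (intro M.minus_equality)
      then show ?thesis using a S(4) by (simp add: a_inv_def)
    qed
  qed
  fix x assume "x \<in> carrier M"
  then obtain v where v: "x = \<kappa> v" "v \<in> C" using carrier by blast
  show "\<exists>!f. decomposes M (\<lambda>i. \<kappa> ` S i) x f"
  proof (rule ex1I[of _ "\<lambda>i. \<kappa> (p i v)"])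
    have "finsum M (\<lambda>i. \<kappa> (p i v)) {i. p i v \<noteq> 0} = \<kappa> v"
      using ksum[OF fin[OF v(2)], of "\<lambda>i. p i v"] p(2)[OF v(2)] sum[OF v(2)] by simp
    then show "decomposes M (\<lambda>i. \<kappa> ` S i) x (\<lambda>i. \<kappa> (p i v))"
      using v p(2) fin by (simp add: decomposes_def k0)
  next
    fix g assume d: "decomposes M (\<lambda>i. \<kappa> ` S i) x g"
    then have "\<forall>i. \<exists>h. h \<in> S i \<and> g i = \<kappa> h" by (auto simp: decomposes_def)
    then obtain h where h: "\<And>i. h i \<in> S i" "\<And>i. g i = \<kappa> (h i)" by metis
    have g: "g = (\<lambda>i. \<kappa> (h i))" by (simp add: fun_eq_iff h(2))
    have f: "finite {i. h i \<noteq> 0}" "x = finsum M (\<lambda>i. \<kappa> (h i)) {i. h i \<noteq> 0}"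
      using d by (simp_all add: decomposes_def g k0)
    then have veq: "v = (\<Sum>i | h i \<noteq> 0. h i)"
      using ksum[of "{i. h i \<noteq> 0}" h, OF f(1) h(1)] v(1) injD[OF inj] by simp
    have "p k v = h k" for k
    proof -
      have "p k v = (\<Sum>i | h i \<noteq> 0. p k (h i))" unfolding veq by (rule additive.sum[OF p(1)])
      also have "\<dots> = (\<Sum>i | h i \<noteq> 0. if i = k then h k else 0)"
      proof (rule sum.cong)
        show "p k (h i) = (if i = k then h k else 0)" for i
          using p(3)[OF h(1)[of k]] p(4)[OF h(1)[of i], of k] by (cases "i = k") simp_all
      qed simp
      also have "\<dots> = h k" using f(1) by simp
      finally show ?thesis .
    qed
    then show "g = (\<lambda>i. \<kappa> (p i v))" by (simp add: g)
  qed
qed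

text \<open>Modules are graded by the integers, and the shifts of the resolution lead to negative
  degrees, where the component is zero.\<close>

definition homI :: "nat \<Rightarrow> int \<Rightarrow> (expo \<Rightarrow>\<^sub>0 'w::zero) set"
  where "homI N k = {f. \<forall>b\<in>keys f. int (N * tdeg b) = k}"

lemma homI_eq: "(homI N k :: (expo \<Rightarrow>\<^sub>0 'w::zero) set) = (if k \<ge> 0 then hom N (nat k) else {0})"
proof (cases "k \<ge> 0")
  case True
  then have "int (N * tdeg b) = k \<longleftrightarrow> N * tdeg b = nat k" for b by linarith
  with True show ?thesis unfolding homI_def hom_def by (simp only: if_True)
next
  case False
  have "f = 0" if "f \<in> homI N k" for f :: "expo \<Rightarrow>\<^sub>0 'w"
  proof -
    have "keys f = {}"
    proof (rule equals0I)
      fix b assume "b \<in> keys f"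
      then have "int (N * tdeg b) = k" using that unfolding homI_def by blast
      with False show False by linarith
    qed
    then show ?thesis by (auto intro!: poly_mapping_eqI simp: in_keys_iff)
  qed
  then show ?thesis using False by (auto simp: homI_def)
qed

definition hcompI :: "nat \<Rightarrow> int \<Rightarrow> (expo \<Rightarrow>\<^sub>0 'w::ab_group_add) \<Rightarrow> (expo \<Rightarrow>\<^sub>0 'w)"
  where "hcompI N k f = (if k \<ge> 0 then hcomp N (nat k) f else 0)"

lemma lookup_hcompI: "lookup (hcompI N k f) b = (if int (N * tdeg b) = k then lookup f b else 0)"
proof -
  have "int (N * tdeg b) = k \<longleftrightarrow> k \<ge> 0 \<and> N * tdeg b = nat k" by linarith
  then show ?thesis by (simp only: hcompI_def lookup_hcomp lookup_zero split: if_split) simp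
qed

lemma additive_hcompI: "additive (hcompI N k)"
  unfolding additive_def
  by (intro allI poly_mapping_eqI) (simp only: lookup_hcompI lookup_add add_0_left split: if_split, simp)

lemma homI_zero [simp]: "0 \<in> homI N k" by (simp add: homI_def)

lemma homI_add: "f \<in> homI N k \<Longrightarrow> g \<in> homI N k \<Longrightarrow> f + g \<in> homI N k"
  by (simp add: homI_eq hom_add split: if_splits)

lemma homI_minus: "f \<in> homI N k \<Longrightarrow> - f \<in> homI N k" for f :: "expo \<Rightarrow>\<^sub>0 'w::ab_group_add"
  by (simp add: homI_eq hom_minus split: if_splits)

lemma hcompI_homI: "hcompI N k f \<in> homI N k"
  by (simp add: homI_eq hcompI_def hcomp_hom)

lemma lookup_homI: "f \<in> homI N k \<Longrightarrow> int (N * tdeg b) \<noteq> k \<Longrightarrow> lookup f b = 0"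
  by (auto simp: homI_def in_keys_iff)

lemma hcompI_id: "f \<in> homI N k \<Longrightarrow> hcompI N k f = f"
  by (rule poly_mapping_eqI) (metis lookup_hcompI lookup_homI)

lemma hcompI_other: "f \<in> homI N k \<Longrightarrow> l \<noteq> k \<Longrightarrow> hcompI N l f = 0"
  by (rule poly_mapping_eqI) (metis lookup_hcompI lookup_homI lookup_zero)

lemma (in bichar) tmul_homI: "f \<in> homI N k \<Longrightarrow> g \<in> homI N l \<Longrightarrow> tmul f g \<in> homI N (k + l)"
  using self.tact_hom[of f N "nat k" g "nat l"]
  by (auto simp: homI_eq nat_add_distrib split: if_splits)

lemma hcompI_sum:
  assumes "finite J" "(\<lambda>b. int (N * tdeg b)) ` keys f \<subseteq> J"
  shows "(\<Sum>k\<in>J. hcompI N k f) = f"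
proof (rule poly_mapping_eqI)
  fix b
  have "(\<Sum>k\<in>J. lookup (hcompI N k f) b) = (\<Sum>k\<in>J. if k = int (N * tdeg b) then lookup f b else 0)"
    by (intro sum.cong) (auto simp: lookup_hcompI)
  also have "\<dots> = lookup f b"
  proof -
    have "lookup f b = 0" if "int (N * tdeg b) \<notin> J"
      using that assms(2) by (metis (mono_tags, lifting) image_eqI in_keys_iff subsetD)
    then show ?thesis using assms(1) by (simp del: of_nat_mult)
  qed
  finally show "lookup (\<Sum>k\<in>J. hcompI N k f) b = lookup f b" by (simp add: lookup_sum)
qed

lemma hcompI_nonzero: "hcompI N k f \<noteq> 0 \<Longrightarrow> k \<in> (\<lambda>b. int (N * tdeg b)) ` keys f"
proof -
  assume "hcompI N k f \<noteq> 0"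
  then obtain b where "lookup (hcompI N k f) b \<noteq> 0" by (metis poly_mapping_eqI lookup_zero)
  then show ?thesis by (auto simp: lookup_hcompI in_keys_iff split: if_splits)
qed

locale tres = gqalg ch A rep N
  for ch :: "expo \<Rightarrow> expo \<Rightarrow> 'k::field" and A :: "('k, 'a) module" and rep N +
  fixes j :: "'k poly3 \<Rightarrow> 'u"
  assumes inj_j: "inj j"
begin

sublocale kr: kres ch "(*)" "\<lambda>_ _. 0" "\<lambda>w. w" A rep TM "\<lambda>w. w" j
  by (rule TM_kres[OF inj_j])

lemma KE_KC: "kr.KE i = kr.KC i"
proof -
  have "kr.PR f = f" for f by (rule poly_mapping_eqI) (simp add: kr.lookup_PR)
  then show ?thesis unfolding kr.KE_def kr.PT_def by auto
qed

text \<open>The variables act by zero on the trivial module, which leaves the part acting on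
  \<open>A\<close>.\<close>

lemma kz_rmul: "kr.kz i u v f = tmul f (single (unit_vec i) u)"
  by (rule additive_eqI[OF kr.additive_kz self.additive_tact_left])
    (simp add: kr.kz_single tmul_single mult.commute)

definition homT :: "int \<Rightarrow> 'k poly3 set"
  where "homT k = homI N k \<times> homI N k \<times> homI N k"

definition hT :: "int \<Rightarrow> 'k poly3 \<Rightarrow> 'k poly3"
  where "hT k = map_prod (hcompI N k) (map_prod (hcompI N k) (hcompI N k))"

definition degsT :: "'k poly3 \<Rightarrow> int set"
  where "degsT = (\<lambda>(u, v, w). (\<lambda>b. int (N * tdeg b)) ` (keys u \<union> keys v \<union> keys w))"

lemma additive_hT: "additive (hT k)"
  by (auto simp: additive_def hT_def additive.add[OF additive_hcompI])

lemma finite_degsT: "finite (degsT t)"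
  by (cases t) (simp add: degsT_def)

lemma sum_triple: "(\<Sum>i\<in>I. (f i, g i, h i)) = (\<Sum>i\<in>I. f i, \<Sum>i\<in>I. g i, \<Sum>i\<in>I. h i)"
  by (induction I rule: infinite_finite_induct) (simp_all add: zero_prod_def)

lemma hT_sum: "finite J \<Longrightarrow> degsT t \<subseteq> J \<Longrightarrow> (\<Sum>k\<in>J. hT k t) = t"
proof (cases t)
  case (fields u v w)
  assume "finite J" "degsT t \<subseteq> J"
  then show ?thesis by (simp add: fields hT_def degsT_def sum_triple image_Un hcompI_sum)
qed

lemma hT_nonzero: "hT k t \<noteq> 0 \<Longrightarrow> k \<in> degsT t"
  using hcompI_nonzero by (cases t) (fastforce simp: hT_def degsT_def zero_prod_def)

lemma hT_homT: "hT k t \<in> homT k"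
  by (cases t) (simp add: hT_def homT_def hcompI_homI)

lemma hT_KC: "t \<in> kr.KC i \<Longrightarrow> hT k t \<in> kr.KC i"
  by (cases t) (auto simp: kr.KC_def hT_def additive.zero[OF additive_hcompI])

lemma KC_add: "s \<in> kr.KC i \<Longrightarrow> t \<in> kr.KC i \<Longrightarrow> s + t \<in> kr.KC i"
  and KC_minus: "s \<in> kr.KC i \<Longrightarrow> - s \<in> kr.KC i" and KC_zero: "0 \<in> kr.KC i"
  using kr.KE_add kr.KE_minus kr.zero_KE unfolding KE_KC by auto

text \<open>A product of \<open>i\<close> generators of the exterior algebra has degree
  \<open>N * i\<close>; this shift makes all differentials homogeneous of degree 0.\<close>

definition HH :: "nat \<Rightarrow> int \<Rightarrow> 'u set"
  where "HH i k = j ` (kr.KC i \<inter> homT (k - int (N * i)))"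

lemma PM_direct_sum: "internal_direct_sum (kr.PM i) (HH i)"
  unfolding HH_def
proof (rule internal_direct_sumI[where p = "\<lambda>k. hT (k - int (N * i))"])
  show "abelian_group (kr.PM i)" using kr.PM_left_module by (simp add: left_module_def)
  show "inj j" by (rule inj_j)
  show "carrier (kr.PM i) = j ` kr.KC i" by (simp add: KE_KC)
  show "additive (hT (k - int (N * i)))" for k by (rule additive_hT)
  show "0 \<in> kr.KC i \<inter> homT (k - int (N * i))" for k using KC_zero by (auto simp: homT_def zero_prod_def)
  show "x + y \<in> kr.KC i \<inter> homT (k - int (N * i))" if "x \<in> kr.KC i \<inter> homT (k - int (N * i))"
    "y \<in> kr.KC i \<inter> homT (k - int (N * i))" for k x y
    using that KC_add by (cases x; cases y) (auto simp: homT_def homI_add)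
  show "- x \<in> kr.KC i \<inter> homT (k - int (N * i))" if "x \<in> kr.KC i \<inter> homT (k - int (N * i))" for k x
    using that KC_minus[of x] by (cases x) (auto simp: homT_def homI_minus)
  show "hT (k - int (N * i)) x \<in> kr.KC i \<inter> homT (k - int (N * i))" if "x \<in> kr.KC i" for k x
    using that hT_KC hT_homT by blast
  show "hT (k - int (N * i)) x = x" if "x \<in> kr.KC i \<inter> homT (k - int (N * i))" for k x
    using that by (cases x) (auto simp: homT_def hT_def hcompI_id)
  show "hT (l - int (N * i)) x = 0" if "x \<in> kr.KC i \<inter> homT (k - int (N * i))" "l \<noteq> k" for k l x
    using that by (cases x) (auto simp: homT_def hT_def zero_prod_def intro!: hcompI_other)
  fix x assume "x \<in> kr.KC i"
  let ?I = "{k. hT (k - int (N * i)) x \<noteq> 0}"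
  have sub: "(\<lambda>k. k - int (N * i)) ` ?I \<subseteq> degsT x" using hT_nonzero by blast
  have inj: "inj_on (\<lambda>k. k - int (N * i)) ?I" by (simp add: inj_on_def)
  show fin: "finite ?I"
    using finite_subset[OF sub finite_degsT] inj by (rule finite_imageD)
  have "(\<Sum>k\<in>?I. hT (k - int (N * i)) x) = (\<Sum>k\<in>(\<lambda>k. k - int (N * i)) ` ?I. hT k x)"
    by (subst sum.reindex[OF inj]) (simp only: o_def)
  also have "\<dots> = (\<Sum>k\<in>degsT x. hT k x)"
  proof (rule sum.mono_neutral_left[OF finite_degsT sub], rule ballI)
    fix k assume k: "k \<in> degsT x - (\<lambda>k. k - int (N * i)) ` ?I"
    show "hT k x = 0"
    proof (rule ccontr)
      assume "hT k x \<noteq> 0"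
      then have "k + int (N * i) \<in> ?I" by simp
      then have "k + int (N * i) - int (N * i) \<in> (\<lambda>k. k - int (N * i)) ` ?I" by (rule imageI)
      with k show False by simp
    qed
  qed
  also have "\<dots> = x" by (simp add: hT_sum finite_degsT)
  finally show "(\<Sum>k\<in>?I. hT (k - int (N * i)) x) = x" .
qed (use kr.KE_add in \<open>auto simp: KE_KC KC_add\<close>)

lemma int_grading_G: "int_grading A G k = rep ` homI N k"
  by (simp add: int_grading_def homI_eq G_def rep_zero)

lemma tactT_homT: "a \<in> homI N k \<Longrightarrow> z \<in> homT l \<Longrightarrow> kr.tactT a z \<in> homT (k + l)"
  by (cases z) (simp add: kr.tactT_def homT_def tmul_homI)

lemma PM_graded: "graded_module A G (kr.PM i) (HH i)"
  unfolding graded_module_def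
proof (intro conjI kr.PM_left_module PM_direct_sum allI ballI)
  fix d k a x assume a: "a \<in> G d" and x: "x \<in> HH i k"
  obtain f where f: "a = rep f" "f \<in> hom N d" using a by (auto simp: G_def)
  obtain z where z: "x = j z" "z \<in> kr.KC i" "z \<in> homT (k - int (N * i))"
    using x unfolding HH_def by (elim imageE IntE)
  have "kr.tactT f z \<in> homT (int d + (k - int (N * i)))"
    using f z by (intro tactT_homT) (simp_all add: homI_eq)
  moreover have "kr.tactT f z \<in> kr.KC i" using kr.KE_tactT[of z i f] z by (simp add: KE_KC)
  ultimately show "a \<odot>\<^bsub>kr.PM i\<^esub> x \<in> HH i (int d + k)"
    by (simp add: HH_def f z(1) imageI algebra_simps)
qed

lemma unit_vec_homI: "single (unit_vec i) u \<in> homI N (int N)"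
  by (simp add: homI_def tdeg_unit_vec)

lemma kz_homI: "f \<in> homI N k \<Longrightarrow> kr.kz i u v f \<in> homI N (k + int N)"
  unfolding kz_rmul by (rule tmul_homI[OF _ unit_vec_homI])

lemma dd_homT: "z \<in> homT k \<Longrightarrow> kr.dd i z \<in> homT (k + int N)"
  by (cases z) (auto simp: kr.dd_def homT_def kz_homI homI_add zero_prod_def)

lemma hmap_TM: "kr.hmap f = lookup f 0"
proof (rule madd_eqI[OF kr.group_M kr.madd_hmap])
  show "madd TM (\<lambda>f. lookup f 0)" by (simp add: madd_def lookup_add)
qed (simp add: kr.hmap_single lookup_single when_def)

theorem TM_graded_resolution: "graded_resolution A G kr.PM HH kr.DM kr.EM"
  unfolding graded_resolution_def
proof (intro conjI allI PM_graded)
  show "projective_resolution A kr.PM kr.DM kr.EM (trivial_module A G)"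
    using kr.kres_resolution by (simp add: TM_def)
  show "kr.DM i ` HH (Suc i) k \<subseteq> HH i k" for i k
  proof
    fix x assume "x \<in> kr.DM i ` HH (Suc i) k"
    then obtain z where z: "x = kr.DM i (j z)" "z \<in> kr.KC (Suc i)" "z \<in> homT (k - int (N * Suc i))"
      unfolding HH_def by (elim imageE IntE) simp
    have "kr.dd i z \<in> homT (k - int (N * i))" using dd_homT[OF z(3), of i] by (simp add: algebra_simps)
    then show "x \<in> HH i k" using z kr.dd_KC by (simp add: HH_def KE_KC imageI)
  qed
  show "kr.EM ` HH 0 k \<subseteq> trivial_grading 0 k" for k
  proof
    fix x assume "x \<in> kr.EM ` HH 0 k"
    then obtain z where z: "x = kr.EM (j z)" "z \<in> kr.KC 0" "z \<in> homT k"
      unfolding HH_def by (elim imageE IntE) simp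
    then show "x \<in> trivial_grading 0 k"
      using lookup_homI[of "fst z" N k 0] by (auto simp: KE_KC hmap_TM trivial_grading_def homT_def tdeg_def)
  qed
qed

end

section \<open>Ext of the trivial module\<close>

context tres
begin

text \<open>Evaluation of a left-linear map: the first argument is the row of coefficients, the
  second lists the values on the generators. It turns the dual of a term of the resolution into
  triples, on which \<open>rT\<close> is the right action of \<open>A\<close>.\<close>

definition dot :: "'k poly3 \<Rightarrow> 'k poly3 \<Rightarrow> (expo \<Rightarrow>\<^sub>0 'k)"
  where "dot = (\<lambda>(a, b, c) (u, v, w). tmul a u + tmul b v + tmul c w)"

text \<open>\<open>Phi i t\<close> is the map on the free module \<open>PM i\<close> whose values on the generators are the entries of \<open>t\<close>.\<close>

definition Phi :: "nat \<Rightarrow> 'k poly3 \<Rightarrow> 'u \<Rightarrow> 'a"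
  where "Phi i t = (\<lambda>x \<in> j ` kr.KC i. rep (dot (kr.jinv x) t))"

lemma Phi_j: "z \<in> kr.KC i \<Longrightarrow> Phi i t (j z) = rep (dot z t)"
  by (simp add: Phi_def)

lemma dot_add_left: "dot (y + z) t = dot y t + dot z t"
  by (cases y; cases z; cases t) (simp add: dot_def self.tact_add_left)

lemma dot_add_right: "dot z (s + t) = dot z s + dot z t"
  by (cases s; cases z; cases t) (simp add: dot_def self.tact_add_right)

lemma dot_zero_right: "dot z 0 = 0"
  by (cases z) (simp add: dot_def zero_prod_def)

lemma dot_sum_right: "dot z (\<Sum>k\<in>J. F k) = (\<Sum>k\<in>J. dot z (F k))"
  by (rule additive.sum) (simp add: additive_def dot_add_right)

lemma dot_tactT: "dot (kr.tactT a z) t = tmul a (dot z t)"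
  by (cases z; cases t) (simp add: dot_def kr.tactT_def self.tact_tmul self.tact_add_right)

definition rT :: "(expo \<Rightarrow>\<^sub>0 'k) \<Rightarrow> 'k poly3 \<Rightarrow> 'k poly3"
  where "rT g = map_prod (\<lambda>u. tmul u g) (map_prod (\<lambda>u. tmul u g) (\<lambda>u. tmul u g))"

lemma dot_rT: "dot z (rT g t) = tmul (dot z t) g"
  by (cases z; cases t) (simp add: dot_def rT_def self.tact_tmul self.tact_add_left)

lemma regular_simps [simp]: "carrier (regular_module A) = carrier A" "x \<oplus>\<^bsub>regular_module A\<^esub> y = x \<oplus>\<^bsub>A\<^esub> y"
  "a \<odot>\<^bsub>regular_module A\<^esub> x = a \<otimes>\<^bsub>A\<^esub> x"
  by (simp_all add: regular_module_def ring.defs module.defs)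

lemma Phi_hom: "Phi i t \<in> module_hom A (kr.PM i) (regular_module A)"
proof (rule kr.module_homI_PM, unfold KE_KC)
  show "Phi i t (j (y + z)) = Phi i t (j y) \<oplus>\<^bsub>regular_module A\<^esub> Phi i t (j z)"
    if "y \<in> kr.KC i" "z \<in> kr.KC i" for y z
    using that KC_add by (simp add: Phi_j dot_add_left rep_add)
  show "Phi i t (j (kr.tactT a z)) = rep a \<odot>\<^bsub>regular_module A\<^esub> Phi i t (j z)" if "z \<in> kr.KC i" for a z
    using that kr.KE_tactT[of z i a] by (simp add: Phi_j KE_KC dot_tactT rep_mult)
qed (simp add: Phi_def, simp add: Phi_j)

lemma dot_unit: "t \<in> kr.KC i \<Longrightarrow> dot (kr.PK i (1, 0, 0)) t = fst t"
  "t \<in> kr.KC i \<Longrightarrow> dot (kr.PK i (0, 1, 0)) t = fst (snd t)"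
  "t \<in> kr.KC i \<Longrightarrow> dot (kr.PK i (0, 0, 1)) t = snd (snd t)"
proof -
  have id: "kr.PT z = z" for z
  proof -
    have "kr.PR f = f" for f by (rule poly_mapping_eqI) (simp add: kr.lookup_PR)
    then show ?thesis by (cases z) (simp add: kr.PT_def)
  qed
  assume "t \<in> kr.KC i"
  then show "dot (kr.PK i (1, 0, 0)) t = fst t" "dot (kr.PK i (0, 1, 0)) t = fst (snd t)"
    "dot (kr.PK i (0, 0, 1)) t = snd (snd t)"
    by (cases t; auto simp: kr.KC_def kr.PK_def id dot_def self.tact_one)+
qed

lemma PK_KC: "kr.PK i z \<in> kr.KC i"
  using kr.PK_KE[of i z] by (simp add: KE_KC)

lemma dot_zero_imp: "(\<And>z. z \<in> kr.KC i \<Longrightarrow> dot z t = 0) \<Longrightarrow> t \<in> kr.KC i \<Longrightarrow> t = 0"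
  using dot_unit[of t i] PK_KC by (simp add: prod_eq_iff)

lemma Phi_eq_iff:
  assumes "s \<in> kr.KC i" "t \<in> kr.KC i"
  shows "Phi i s = Phi i t \<longleftrightarrow> s = t"
proof
  assume eq: "Phi i s = Phi i t"
  have "dot z s = dot z t" if "z \<in> kr.KC i" for z
    using Phi_j[OF that, of s] Phi_j[OF that, of t] eq by simp
  then show "s = t" using dot_unit[OF assms(1)] dot_unit[OF assms(2)] PK_KC by (simp add: prod_eq_iff)
qed simp

text \<open>A map on a free module is determined by its values on the generators. Where the rank is
  below three, \<open>PK\<close> sends the surplus unit vectors to zero, so the triple of values
  lies in \<open>KC i\<close>.\<close>

lemma hom_eq_Phi:
  assumes f: "f \<in> module_hom A (kr.PM i) (regular_module A)"
  shows "\<exists>t \<in> kr.KC i. f = Phi i t"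
proof -
  interpret R: ring A by (rule ring_A)
  have fc: "f (j z) \<in> carrier A" if "z \<in> kr.KC i" for z
    using module_hom_closed[OF f, of "j z"] that by (simp add: KE_KC imageI)
  have fadd: "f (j (y + z)) = f (j y) \<oplus>\<^bsub>A\<^esub> f (j z)" if "y \<in> kr.KC i" "z \<in> kr.KC i" for y z
    using module_hom_add[OF f, of "j y" "j z"] that by (simp add: KE_KC imageI)
  have fact: "f (j (kr.tactT a z)) = rep a \<otimes>\<^bsub>A\<^esub> f (j z)" if "z \<in> kr.KC i" for a z
    using module_hom_smult[OF f, of "rep a" "j z"] that by (simp add: KE_KC imageI)
  have f0: "f (j 0) = \<zero>\<^bsub>A\<^esub>"
    using fadd[OF KC_zero KC_zero] fc[OF KC_zero] by (metis R.add.r_cancel_one' add_0)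
  define c where "c z = unrep (f (j (kr.PK i z)))" for z
  have c: "rep (c z) = f (j (kr.PK i z))" for z by (simp add: c_def fc PK_KC)
  define t where "t = (c (1, 0, 0), c (0, 1, 0), c (0, 0, 1))"
  have pk0: "kr.PK i 0 = 0" by (rule additive.zero[OF kr.additive_PK])
  have u0: "unrep (f (j 0)) = 0" by (simp add: f0 rep_zero[symmetric])
  have "i \<noteq> 1 \<Longrightarrow> i \<noteq> 2 \<Longrightarrow> kr.PK i (0, 1, 0) = 0 \<and> kr.PK i (0, 0, 1) = 0" "\<not> i \<le> 3 \<Longrightarrow> kr.PK i (1, 0, 0) = 0"
    using pk0 by (simp_all add: kr.PK_def zero_prod_def)
  then have "i \<noteq> 1 \<Longrightarrow> i \<noteq> 2 \<Longrightarrow> c (0, 1, 0) = 0 \<and> c (0, 0, 1) = 0" "\<not> i \<le> 3 \<Longrightarrow> c (1, 0, 0) = 0"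
    by (simp_all add: c_def u0)
  then have tK: "t \<in> kr.KC i" unfolding t_def kr.KC_def by blast
  have "f x = Phi i t x" for x
  proof (cases "x \<in> j ` kr.KC i")
    case True
    then obtain z where z: "x = j z" "z \<in> kr.KC i" by (elim imageE)
    obtain u v w where uvw: "z = (u, v, w)" by (cases z)
    have "z = kr.PK i (kr.tactT u (1, 0, 0) + (kr.tactT v (0, 1, 0) + kr.tactT w (0, 0, 1)))"
      using kr.PK_id[of z i] z(2) by (simp add: KE_KC uvw kr.tactT_def tmul_one_right)
    also have "\<dots> = kr.tactT u (kr.PK i (1, 0, 0)) + (kr.tactT v (kr.PK i (0, 1, 0)) + kr.tactT w (kr.PK i (0, 0, 1)))"
      by (simp only: additive.add[OF kr.additive_PK] kr.PK_tactT)
    finally have zz: "z = \<dots>" .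
    have K: "kr.tactT a (kr.PK i y) \<in> kr.KC i" for a y using kr.KE_tactT[of "kr.PK i y" i a] PK_KC by (simp add: KE_KC)
    have "f x = rep u \<otimes>\<^bsub>A\<^esub> f (j (kr.PK i (1, 0, 0))) \<oplus>\<^bsub>A\<^esub> (rep v \<otimes>\<^bsub>A\<^esub> f (j (kr.PK i (0, 1, 0)))
        \<oplus>\<^bsub>A\<^esub> rep w \<otimes>\<^bsub>A\<^esub> f (j (kr.PK i (0, 0, 1))))"
      unfolding z(1) by (subst zz) (simp only: fadd K KC_add fact PK_KC)
    also have "\<dots> = rep (dot z t)"
      unfolding c[symmetric] t_def by (simp add: uvw dot_def rep_mult rep_add R.add.m_assoc)
    finally show ?thesis by (simp add: z Phi_j)
  next
    case False
    have "f x = undefined" using f False unfolding module_hom_def kr.PM_simps(1) KE_KC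
      by (blast intro: PiE_arb)
    then show ?thesis using False by (simp add: Phi_def)
  qed
  then show ?thesis using tK by (intro bexI[of _ t]) auto
qed

abbreviation "DU i \<equiv> dual_module A G (kr.PM i) (HH i)"

lemma PK_unit_homT: "kr.PK i (1, 0, 0) \<in> homT 0" "kr.PK i (0, 1, 0) \<in> homT 0" "kr.PK i (0, 0, 1) \<in> homT 0"
proof -
  have id: "kr.PT z = z" for z
  proof -
    have "kr.PR f = f" for f by (rule poly_mapping_eqI) (simp add: kr.lookup_PR)
    then show ?thesis by (cases z) (simp add: kr.PT_def)
  qed
  have "1 \<in> homI N 0" by (simp add: homI_def tdeg_def zero_prod_def)
  then show "kr.PK i (1, 0, 0) \<in> homT 0" "kr.PK i (0, 1, 0) \<in> homT 0" "kr.PK i (0, 0, 1) \<in> homT 0"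
    by (auto simp: kr.PK_def id homT_def)
qed

text \<open>The generators of \<open>PM i\<close> have degree \<open>N * i\<close>, so the values of
  a map of degree \<open>m\<close> on them have degree \<open>N * i + m\<close>.\<close>

lemma Phi_dual_comp:
  assumes t: "t \<in> kr.KC i"
  shows "Phi i t \<in> dual_comp A G (kr.PM i) (HH i) m \<longleftrightarrow> t \<in> homT (int (N * i) + m)"
proof
  assume tm: "t \<in> homT (int (N * i) + m)"
  have "dot z t \<in> homI N (k + m)" if "z \<in> homT (k - int (N * i))" for z k
  proof -
    have e: "k - int (N * i) + (int (N * i) + m) = k + m" by simp
    show ?thesis
      using that tm tmul_homI[of _ N "k - int (N * i)" _ "int (N * i) + m"]
      by (cases z; cases t) (auto simp: homT_def dot_def e intro!: homI_add)
  qed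
  then show "Phi i t \<in> dual_comp A G (kr.PM i) (HH i) m"
    unfolding dual_comp_def graded_hom_def int_grading_G HH_def
    by (intro CollectI conjI Phi_hom allI subsetI) (elim imageE IntE, simp add: Phi_j)
next
  assume d: "Phi i t \<in> dual_comp A G (kr.PM i) (HH i) m"
  have "dot (kr.PK i z) t \<in> homI N (int (N * i) + m)" if "kr.PK i z \<in> homT 0" for z
  proof -
    have "j (kr.PK i z) \<in> HH i (int (N * i))" using that PK_KC by (simp add: HH_def imageI)
    then have "Phi i t (j (kr.PK i z)) \<in> int_grading A G (int (N * i) + m)"
      using d unfolding dual_comp_def graded_hom_def by blast
    then show ?thesis by (auto simp: Phi_j PK_KC int_grading_G)
  qed
  from this[OF PK_unit_homT(1)] this[OF PK_unit_homT(2)] this[OF PK_unit_homT(3)]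
  show "t \<in> homT (int (N * i) + m)" by (simp add: dot_unit[OF t] homT_def mem_Times_iff)
qed

lemma KC_sum: "(\<And>k. k \<in> J \<Longrightarrow> F k \<in> kr.KC i) \<Longrightarrow> (\<Sum>k\<in>J. F k) \<in> kr.KC i"
  by (induction J rule: infinite_finite_induct) (auto simp: KC_zero KC_add)

lemma Phi_sum:
  assumes "finite J"
  shows "(\<lambda>x \<in> carrier (kr.PM i). finsum A (\<lambda>k. Phi i (F k) x) J) = Phi i (\<Sum>k\<in>J. F k)"
proof
  fix x
  show "(\<lambda>x \<in> carrier (kr.PM i). finsum A (\<lambda>k. Phi i (F k) x) J) x = Phi i (\<Sum>k\<in>J. F k) x"
    using assms by (simp add: Phi_def KE_KC rep_sum dot_sum_right)
qed

text \<open>The terms have finite rank, so the homogeneous components of the finitely many values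
  write every map as a finite sum of homogeneous maps.\<close>

lemma DU_carrier: "carrier (DU i) = Phi i ` kr.KC i"
proof
  interpret R: ring A by (rule ring_A)
  show "carrier (DU i) \<subseteq> Phi i ` kr.KC i"
  proof
    fix f assume "f \<in> carrier (DU i)"
    then obtain J F where JF: "finite J" "\<And>k. k \<in> J \<Longrightarrow> F k \<in> dual_comp A G (kr.PM i) (HH i) k"
      and f: "f = (\<lambda>x \<in> carrier (kr.PM i). finsum A (\<lambda>k. F k x) J)"
      unfolding dual_module_def partial_object.simps by blast
    have "\<exists>t \<in> kr.KC i. F k = Phi i t" if "k \<in> J" for k
      using JF(2)[OF that] hom_eq_Phi unfolding dual_comp_def graded_hom_def by blast
    then obtain t where t: "\<And>k. k \<in> J \<Longrightarrow> t k \<in> kr.KC i" "\<And>k. k \<in> J \<Longrightarrow> F k = Phi i (t k)" by metis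
    have "f = (\<lambda>x \<in> carrier (kr.PM i). finsum A (\<lambda>k. Phi i (t k) x) J)"
      unfolding f
    proof (rule restrict_ext)
      fix x assume "x \<in> carrier (kr.PM i)"
      then have "Phi i s x \<in> carrier A" for s
        using module_hom_closed[OF Phi_hom, of x i s] by (simp only: regular_simps)
      then show "finsum A (\<lambda>k. F k x) J = finsum A (\<lambda>k. Phi i (t k) x) J"
        using t(2) by (intro R.finsum_cong') auto
    qed
    then have "f = Phi i (\<Sum>k\<in>J. t k)" by (simp add: Phi_sum[OF JF(1)] del: kr.PM_simps)
    moreover have "(\<Sum>k\<in>J. t k) \<in> kr.KC i" by (rule KC_sum) (rule t(1))
    ultimately show "f \<in> Phi i ` kr.KC i" by (rule image_eqI)
  qed
  show "Phi i ` kr.KC i \<subseteq> carrier (DU i)"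
  proof
    fix f assume "f \<in> Phi i ` kr.KC i"
    then obtain t where t: "f = Phi i t" "t \<in> kr.KC i" by (elim imageE)
    \<comment> \<open>The degree of a map is the degree of its values minus that of the
      generators.\<close>
    define J where "J = (\<lambda>k. k - int (N * i)) ` degsT t"
    have J: "finite J" unfolding J_def by (rule finite_imageI[OF finite_degsT])
    let ?F = "\<lambda>k. hT (int (N * i) + k) t"
    have "(\<Sum>k\<in>J. ?F k) = (\<Sum>k\<in>degsT t. hT k t)"
      unfolding J_def by (subst sum.reindex) (simp_all add: inj_on_def)
    then have "f = (\<lambda>x \<in> carrier (kr.PM i). finsum A (\<lambda>k. Phi i (?F k) x) J)"
      by (simp add: Phi_sum[OF J] t(1) hT_sum finite_degsT del: kr.PM_simps)
    moreover have "Phi i (?F k) \<in> dual_comp A G (kr.PM i) (HH i) k" for k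
      using Phi_dual_comp[OF hT_KC[OF t(2)]] hT_homT by blast
    ultimately show "f \<in> carrier (DU i)"
      using J unfolding dual_module_def partial_object.simps
      by (intro CollectI exI[of _ J] exI[of _ "\<lambda>k. Phi i (?F k)"]) blast
  qed
qed

lemma DU_zero: "\<zero>\<^bsub>DU i\<^esub> = Phi i 0"
  by (auto simp: dual_module_def Phi_def KE_KC dot_zero_right rep_zero)

lemma DU_add: "Phi i s \<oplus>\<^bsub>DU i\<^esub> Phi i t = Phi i (s + t)"
  by (auto simp: dual_module_def Phi_def KE_KC dot_add_right rep_add)

lemma DU_smult: "rep g \<odot>\<^bsub>DU i\<^esub> Phi i t = Phi i (rT g t)"
  by (auto simp: dual_module_def Phi_def KE_KC dot_rT rep_mult)

text \<open>The transpose of \<open>kr.dd i\<close>.\<close>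

definition del :: "nat \<Rightarrow> 'k poly3 \<Rightarrow> 'k poly3"
  where "del i = (\<lambda>(u, v, w).
    if i = 0 then (lz 1 1 u, lz 2 1 u, lz 3 1 u)
    else if i = 1 then (lz 2 (cc 1 2) u + lz 1 (- cc 2 1) v, lz 3 (cc 1 3) u + lz 1 (- cc 3 1) w,
      lz 3 (cc 2 3) v + lz 2 (- cc 3 2) w)
    else if i = 2 then (lz 3 (cc 1 3 * cc 2 3) u + lz 2 (- (cc 1 2 * cc 3 2)) v + lz 1 (cc 2 1 * cc 3 1) w, 0, 0)
    else 0)"

lemma additive_del: "additive (del i)"
  by (auto simp: additive_def del_def additive.add[OF additive_lz] zero_prod_def)

lemma del_KC: "t \<in> kr.KC i \<Longrightarrow> del i t \<in> kr.KC (Suc i)"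
  by (cases t) (auto simp: kr.KC_def del_def additive.zero[OF additive_lz] zero_prod_def split: if_splits)

text \<open>The differential multiplies the row on the right by variables; by associativity this
  becomes multiplication of the values on the left.\<close>

lemma dot_dd:
  assumes "z \<in> kr.KC (Suc i)" "t \<in> kr.KC i"
  shows "dot (kr.dd i z) t = dot z (del i t)"
proof -
  obtain a b c u v w where z: "z = (a, b, c)" and t: "t = (u, v, w)" by (cases z; cases t) auto
  consider "i = 0" | "i = 1" | "i = 2" | "i > 2" by linarith
  then show ?thesis
    by cases (use assms in \<open>auto simp: z t kr.dd_def del_def dot_def kr.KC_def zero_prod_def kz_rmul lz_tmul
      self.tact_tmul self.tact_add_left self.tact_add_right add_ac\<close>)
qed

lemma cocycles: "Ext_cocycles A G kr.PM HH kr.DM i = Phi i ` {t \<in> kr.KC i. del i t = 0}"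
proof -
  have "(\<forall>x \<in> carrier (kr.PM (Suc i)). Phi i t (kr.DM i x) = \<zero>\<^bsub>A\<^esub>) \<longleftrightarrow> del i t = 0"
    if t: "t \<in> kr.KC i" for t
  proof -
    have e: "Phi i t (kr.DM i (j z)) = rep (dot z (del i t))" if "z \<in> kr.KC (Suc i)" for z
      using that t kr.dd_KC[OF that] by (simp add: KE_KC Phi_j dot_dd)
    show ?thesis
    proof
      assume a: "\<forall>x \<in> carrier (kr.PM (Suc i)). Phi i t (kr.DM i x) = \<zero>\<^bsub>A\<^esub>"
      have "dot z (del i t) = 0" if "z \<in> kr.KC (Suc i)" for z
        using a e[OF that] that by (simp add: KE_KC rep_zero[symmetric])
      then show "del i t = 0" by (rule dot_zero_imp[OF _ del_KC[OF t]])
    next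
      assume d: "del i t = 0"
      show "\<forall>x \<in> carrier (kr.PM (Suc i)). Phi i t (kr.DM i x) = \<zero>\<^bsub>A\<^esub>"
        unfolding kr.PM_simps(1) KE_KC by (intro ballI, elim imageE) (simp add: e d dot_zero_right rep_zero)
    qed
  qed
  then show ?thesis unfolding Ext_cocycles_def DU_carrier by blast
qed

lemma coboundaries_0: "Ext_coboundaries A G kr.PM HH kr.DM 0 = Phi 0 ` {0}"
  by (simp add: Ext_coboundaries_def DU_zero)

lemma coboundaries_Suc: "Ext_coboundaries A G kr.PM HH kr.DM (Suc h) = Phi (Suc h) ` (del h ` kr.KC h)"
proof -
  have "(\<lambda>x \<in> carrier (kr.PM (Suc h)). Phi h t (kr.DM h x)) = Phi (Suc h) (del h t)" if t: "t \<in> kr.KC h" for t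
  proof
    fix x
    show "(\<lambda>x \<in> carrier (kr.PM (Suc h)). Phi h t (kr.DM h x)) x = Phi (Suc h) (del h t) x"
    proof (cases "x \<in> j ` kr.KC (Suc h)")
      case True
      then obtain z where z: "x = j z" "z \<in> kr.KC (Suc h)" by (elim imageE)
      then show ?thesis using kr.dd_KC[OF z(2)] t by (simp add: KE_KC Phi_j dot_dd)
    qed (simp add: KE_KC Phi_def)
  qed
  note eq = this
  have "{\<lambda>x \<in> carrier (kr.PM (Suc h)). g (kr.DM h x) |g. g \<in> Phi h ` kr.KC h} =
      (\<lambda>g. \<lambda>x \<in> carrier (kr.PM (Suc h)). g (kr.DM h x)) ` Phi h ` kr.KC h"
    by (rule Setcompr_eq_image)
  also have "\<dots> = (\<lambda>t. Phi (Suc h) (del h t)) ` kr.KC h"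
    unfolding image_image by (rule image_cong[OF HOL.refl eq])
  finally show ?thesis by (simp add: Ext_coboundaries_def DU_carrier image_image del: kr.PM_simps)
qed

lemma del_exact_0: "t \<in> kr.KC 0 \<Longrightarrow> del 0 t = 0 \<Longrightarrow> t = 0"
  using lc.exact_3 by (cases t) (auto simp: kr.KC_def del_def zero_prod_def)

text \<open>The dual cube labels each vertex by the complementary set of indices, so the entries of
  a triple enter it in reverse order. The same holds in \<open>del_exact_2\<close>.\<close>

lemma del_exact_1: "t \<in> kr.KC 1 \<Longrightarrow> del 1 t = 0 \<Longrightarrow> t \<in> del 0 ` kr.KC 0"
proof (cases t)
  case (fields u v w)
  assume "del 1 t = 0"
  then have "lz 2 (- cc 3 2) w + lz 3 (cc 2 3) v = 0" "lz 1 (- cc 3 1) w + lz 3 (cc 1 3) u = 0"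
    by (simp_all add: fields del_def zero_prod_def add.commute)
  from lc.exact_2[OF this] obtain g where "w = lz 3 1 g" "v = lz 2 1 g" "u = lz 1 1 g" by blast
  then show ?thesis by (intro image_eqI[of _ _ "(g, 0, 0)"]) (simp_all add: fields del_def kr.KC_def)
qed

lemma del_exact_2: "t \<in> kr.KC 2 \<Longrightarrow> del 2 t = 0 \<Longrightarrow> t \<in> del 1 ` kr.KC 1"
proof (cases t)
  case (fields u v w)
  assume "del 2 t = 0"
  then have "lz 1 (cc 2 1 * cc 3 1) w + lz 2 (- (cc 1 2 * cc 3 2)) v + lz 3 (cc 1 3 * cc 2 3) u = 0"
    by (simp add: fields del_def zero_prod_def add_ac)
  from lc.exact_1[OF this] obtain a3 a2 a1 where "w = lz 2 (- cc 3 2) a3 + lz 3 (cc 2 3) a2"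
    "v = lz 1 (- cc 3 1) a3 + lz 3 (cc 1 3) a1" "u = lz 1 (- cc 2 1) a2 + lz 2 (cc 1 2) a1" by blast
  then show ?thesis
    by (intro image_eqI[of _ _ "(a1, a2, a3)"]) (simp_all add: fields del_def kr.KC_def add.commute)
qed

text \<open>Dual to \<open>dd_dd\<close>, because the pairing \<open>dot\<close> detects
  zero.\<close>

lemma del_del: "del (Suc i) (del i t) = 0" if "t \<in> kr.KC i"
proof (rule dot_zero_imp[OF _ del_KC[OF del_KC[OF that]]])
  fix z assume z: "z \<in> kr.KC (Suc (Suc i))"
  have "dot z (del (Suc i) (del i t)) = dot (kr.dd i (kr.dd (Suc i) z)) t"
    by (simp only: dot_dd[OF z del_KC[OF that]] dot_dd[OF kr.dd_KC[OF z] that])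
  also have "\<dots> = 0" using dot_add_left[of 0 0 t] by (simp add: kr.dd_dd)
  finally show "dot z (del (Suc i) (del i t)) = 0" .
qed

lemma cocycles_eq_coboundaries:
  assumes "i \<noteq> 3"
  shows "\<exists>S. Ext_cocycles A G kr.PM HH kr.DM i = Phi i ` S \<and> Ext_coboundaries A G kr.PM HH kr.DM i = Phi i ` S \<and>
    0 \<in> S \<and> (\<forall>s \<in> S. \<forall>t \<in> S. s + t \<in> S) \<and> (\<forall>s \<in> S. - s \<in> S)"
proof (intro exI[of _ "{t \<in> kr.KC i. del i t = 0}"] conjI ballI)
  show "Ext_cocycles A G kr.PM HH kr.DM i = Phi i ` {t \<in> kr.KC i. del i t = 0}" by (rule cocycles)
  have "Ext_coboundaries A G kr.PM HH kr.DM i = Phi i ` {t \<in> kr.KC i. del i t = 0}"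
  proof (cases i)
    case 0
    have "{t \<in> kr.KC 0. del 0 t = 0} = {0}"
      using del_exact_0 KC_zero additive.zero[OF additive_del] by blast
    then show ?thesis by (simp only: 0 coboundaries_0)
  next
    case (Suc h)
    have "{t \<in> kr.KC (Suc h). del (Suc h) t = 0} = del h ` kr.KC h"
    proof (intro equalityI subsetI)
      fix t assume t: "t \<in> {t \<in> kr.KC (Suc h). del (Suc h) t = 0}"
      consider "h = 0" | "h = 1" | "h > 2" using assms Suc by linarith
      then show "t \<in> del h ` kr.KC h"
      proof cases
        case 1
        then show ?thesis using del_exact_1[of t] t by simp
      next
        case 2
        then show ?thesis using del_exact_2[of t] t by (simp add: numeral_2_eq_2)
      next
        case 3
        then have "t = 0" using t by (cases t) (auto simp: kr.KC_def zero_prod_def)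
        then show ?thesis using KC_zero additive.zero[OF additive_del] by (metis imageI)
      qed
    next
      fix t assume "t \<in> del h ` kr.KC h"
      then show "t \<in> {t \<in> kr.KC (Suc h). del (Suc h) t = 0}" using del_KC del_del by blast
    qed
    then show ?thesis by (simp only: Suc coboundaries_Suc)
  qed
  then show "Ext_coboundaries A G kr.PM HH kr.DM i = Phi i ` {t \<in> kr.KC i. del i t = 0}" .
qed (use KC_zero KC_add KC_minus additive.zero[OF additive_del] additive.add[OF additive_del]
    additive.minus[OF additive_del] in \<open>auto simp del: split_paired_all\<close>)

lemma coset_Phi:
  "Phi i ` S +>\<^bsub>DU i\<^esub> Phi i t = Phi i ` ((\<lambda>s. s + t) ` S)"
  "Phi i ` S +>\<^bsub>(DU i)\<lparr>carrier := Z\<rparr>\<^esub> Phi i t = Phi i ` ((\<lambda>s. s + t) ` S)"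
  by (auto simp: a_r_coset_def' DU_add image_image)

lemma Ext_carrier: "carrier (Ext_module A G kr.PM HH kr.DM i) =
    (\<lambda>f. Ext_coboundaries A G kr.PM HH kr.DM i +>\<^bsub>(DU i)\<lparr>carrier := Ext_cocycles A G kr.PM HH kr.DM i\<rparr>\<^esub> f) `
      Ext_cocycles A G kr.PM HH kr.DM i"
  by (auto simp: Ext_module_def quotient_by_def ring.defs module.defs FactRing_def A_RCOSETS_def')

lemma Ext_zero: "\<zero>\<^bsub>Ext_module A G kr.PM HH kr.DM i\<^esub> = Ext_coboundaries A G kr.PM HH kr.DM i"
  by (simp add: Ext_module_def quotient_by_def ring.defs module.defs FactRing_def)

lemma Ext_trivial:
  assumes "i \<noteq> 3"
  shows "carrier (Ext_module A G kr.PM HH kr.DM i) = {\<zero>\<^bsub>Ext_module A G kr.PM HH kr.DM i\<^esub>}"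
proof -
  obtain S where S: "Ext_cocycles A G kr.PM HH kr.DM i = Phi i ` S" "Ext_coboundaries A G kr.PM HH kr.DM i = Phi i ` S"
    "0 \<in> S" "\<And>s t. s \<in> S \<Longrightarrow> t \<in> S \<Longrightarrow> s + t \<in> S" "\<And>s. s \<in> S \<Longrightarrow> - s \<in> S"
    using cocycles_eq_coboundaries[OF assms] by blast
  have "(\<lambda>s. s + t) ` S = S" if t: "t \<in> S" for t
  proof (intro equalityI subsetI)
    fix s assume "s \<in> S"
    then show "s \<in> (\<lambda>s. s + t) ` S"
      using S(4)[OF _ S(5)[OF t], of s] by (intro image_eqI[of _ _ "s + - t"]) simp_all
  qed (use S(4) t in blast)
  then have "Phi i ` S +>\<^bsub>(DU i)\<lparr>carrier := Phi i ` S\<rparr>\<^esub> f = Phi i ` S" if "f \<in> Phi i ` S" for f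
    using that by (elim imageE) (simp add: coset_Phi)
  then show ?thesis unfolding Ext_carrier Ext_zero S(1,2) using S(3) by auto
qed

text \<open>These sets will be the cosets of the top coboundaries, so the constant term identifies
  the top Ext with the field.\<close>

definition L3 :: "'k \<Rightarrow> 'k poly3 set"
  where "L3 c = {t \<in> kr.KC 3. lookup (fst t) 0 = c}"

definition CL :: "'k \<Rightarrow> ('u \<Rightarrow> 'a) set"
  where "CL c = Phi 3 ` L3 c"

lemma L3_iff: "t \<in> L3 c \<longleftrightarrow> (\<exists>u. t = (u, 0, 0) \<and> lookup u 0 = c)"
  by (cases t) (auto simp: L3_def kr.KC_def)

lemma L3_single: "(single 0 c, 0, 0) \<in> L3 c"
  by (simp add: L3_iff)

lemma L3_add: "s \<in> L3 c \<Longrightarrow> t \<in> L3 d \<Longrightarrow> s + t \<in> L3 (c + d)"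
  by (auto simp: L3_iff lookup_add)

lemma L3_translate:
  assumes "t \<in> L3 c"
  shows "(\<lambda>s. s + t) ` L3 d = L3 (d + c)"
proof (intro equalityI subsetI)
  fix s assume "s \<in> L3 (d + c)"
  then have "s - t \<in> L3 d" using assms by (auto simp: L3_iff lookup_minus zero_prod_def)
  then show "s \<in> (\<lambda>s. s + t) ` L3 d" by (intro image_eqI[of _ _ "s - t"]) simp_all
qed (use assms L3_add in blast)

text \<open>The image is the right ideal generated by the variables. Division by all three leaves
  only a constant, so it contains everything without constant term.\<close>

lemma del_2_image: "del 2 ` kr.KC 2 = L3 0"
proof (intro equalityI subsetI)
  have nz: "unit_vec i \<noteq> 0" for i by (simp add: unit_vec_def zero_prod_def)
  have z: "lookup (lz i a u) 0 = 0" for i a u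
    unfolding lz_tmul lookup_tmul_0 using nz[of i] by (simp add: lookup_single)
  show "t \<in> L3 0" if t: "t \<in> del 2 ` kr.KC 2" for t
  proof -
    obtain s where "t = del 2 s" using t by (elim imageE)
    moreover obtain u v w where "s = (u, v, w)" by (cases s)
    ultimately have "t = del 2 (u, v, w)" by simp
    then show ?thesis by (simp add: L3_iff del_def lookup_add z)
  qed
  fix t assume "t \<in> L3 0"
  then obtain u where u: "t = (u, 0, 0)" "lookup u 0 = 0" by (auto simp: L3_iff)
  obtain f1 f2 f3 r where r: "keys r \<subseteq> levels_1"
    "u = lz 1 (cc 2 1 * cc 3 1) f1 + lz 2 (- (cc 1 2 * cc 3 2)) f2 + lz 3 (cc 1 3 * cc 2 3) f3 + r"
    using lc.exact_0 by blast
  have "lookup r 0 = 0" using u(2) unfolding r(2) by (simp add: lookup_add z)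
  then have "r = 0" using r(1) unfolding levels_1 by (intro poly_mapping_eqI) (auto simp: in_keys_iff)
  then have "t = del 2 (f3, f2, f1)" by (simp add: u(1) r(2) del_def add_ac)
  then show "t \<in> del 2 ` kr.KC 2" by (simp add: kr.KC_def image_iff) blast
qed

lemma cocycles_3: "Ext_cocycles A G kr.PM HH kr.DM 3 = Phi 3 ` kr.KC 3"
proof -
  have "del 3 t = 0" for t by (cases t) (simp add: del_def)
  then show ?thesis unfolding cocycles by simp
qed

lemma coboundaries_3: "Ext_coboundaries A G kr.PM HH kr.DM 3 = CL 0"
proof -
  have "(3::nat) = Suc 2" by simp
  then show ?thesis using coboundaries_Suc[of 2] del_2_image by (simp add: CL_def)
qed

lemma coset_3:
  assumes "t \<in> kr.KC 3"
  shows "CL 0 +>\<^bsub>DU 3\<^esub> Phi 3 t = CL (lookup (fst t) 0)"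
    "CL 0 +>\<^bsub>(DU 3)\<lparr>carrier := Z\<rparr>\<^esub> Phi 3 t = CL (lookup (fst t) 0)"
proof -
  have "t \<in> L3 (lookup (fst t) 0)" using assms(1) by (simp add: L3_def)
  from L3_translate[OF this, of 0]
  show "CL 0 +>\<^bsub>DU 3\<^esub> Phi 3 t = CL (lookup (fst t) 0)"
    "CL 0 +>\<^bsub>(DU 3)\<lparr>carrier := Z\<rparr>\<^esub> Phi 3 t = CL (lookup (fst t) 0)"
    unfolding CL_def coset_Phi by simp_all
qed

abbreviation "E3 \<equiv> Ext_module A G kr.PM HH kr.DM 3"

lemma E3_carrier: "carrier E3 = range CL"
proof -
  have "carrier E3 = (\<lambda>t. CL (lookup (fst t) 0)) ` kr.KC 3"
    unfolding Ext_carrier coboundaries_3 unfolding cocycles_3 image_image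
    by (intro image_cong HOL.refl coset_3(2))
  also have "\<dots> = range CL"
  proof (intro equalityI subsetI)
    fix C assume "C \<in> range CL"
    then obtain c where c: "C = CL c" by blast
    have "(single 0 c, 0, 0) \<in> kr.KC 3" using L3_single[of c] by (simp add: L3_def)
    then show "C \<in> (\<lambda>t. CL (lookup (fst t) 0)) ` kr.KC 3"
      by (rule image_eqI[rotated]) (simp add: c)
  qed blast
  finally show ?thesis .
qed

lemma CL_inj: "CL c = CL d \<longleftrightarrow> c = d"
proof
  assume "CL c = CL d"
  then have "Phi 3 (single 0 c, 0, 0) \<in> Phi 3 ` L3 d" using L3_single[of c] unfolding CL_def by blast
  then obtain t where t: "t \<in> L3 d" "Phi 3 (single 0 c, 0, 0) = Phi 3 t" by (elim imageE)
  then have "(single 0 c, 0, 0) = t"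
    using Phi_eq_iff[of "(single 0 c, 0, 0)" 3 t] L3_single[of c] by (simp add: L3_def)
  then show "c = d" using t(1) by (auto simp: L3_iff)
qed simp

lemma E3_add: "CL c \<oplus>\<^bsub>E3\<^esub> CL d = CL (c + d)"
proof -
  have "CL c \<oplus>\<^bsub>E3\<^esub> CL d = (\<Union>h\<in>CL c. \<Union>k\<in>CL d. {h \<oplus>\<^bsub>DU 3\<^esub> k})"
    by (simp add: Ext_module_def quotient_by_def ring.defs module.defs FactRing_def set_add_def')
  also have "\<dots> = CL (c + d)"
  proof (intro equalityI subsetI)
    fix f assume "f \<in> (\<Union>h\<in>CL c. \<Union>k\<in>CL d. {h \<oplus>\<^bsub>DU 3\<^esub> k})"
    then obtain s t where "s \<in> L3 c" "t \<in> L3 d" "f = Phi 3 (s + t)"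
      unfolding CL_def by (auto simp: DU_add simp del: split_paired_all)
    then show "f \<in> CL (c + d)" unfolding CL_def using L3_add by blast
  next
    fix f assume "f \<in> CL (c + d)"
    then obtain t where t: "t \<in> L3 (c + d)" "f = Phi 3 t" unfolding CL_def by (elim imageE)
    have "L3 (c + d) = (\<lambda>s. s + (single 0 d, 0, 0)) ` L3 c"
      by (rule L3_translate[OF L3_single, symmetric])
    then obtain s where s: "s \<in> L3 c" "t = s + (single 0 d, 0, 0)" using t(1) by blast
    have "f = Phi 3 s \<oplus>\<^bsub>DU 3\<^esub> Phi 3 (single 0 d, 0, 0)" by (simp only: DU_add t(2) s(2))
    then show "f \<in> (\<Union>h\<in>CL c. \<Union>k\<in>CL d. {h \<oplus>\<^bsub>DU 3\<^esub> k})"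
      unfolding CL_def using s(1) L3_single by blast
  qed
  finally show ?thesis .
qed

lemma E3_smult: "rep g \<odot>\<^bsub>E3\<^esub> CL c = CL (lookup g 0 * c)"
proof -
  have "rep g \<odot>\<^bsub>E3\<^esub> CL c = (\<Union>x\<in>CL c. CL 0 +>\<^bsub>(DU 3)\<lparr>carrier := Phi 3 ` kr.KC 3\<rparr>\<^esub> (rep g \<odot>\<^bsub>DU 3\<^esub> x))"
    by (simp add: Ext_module_def quotient_by_def ring.defs module.defs cocycles_3 coboundaries_3)
  also have "\<dots> = (\<Union>t\<in>L3 c. CL (lookup g 0 * c))"
    unfolding CL_def[of c] image_image
  proof (rule SUP_cong[OF HOL.refl])
    fix t assume t: "t \<in> L3 c"
    then have "rT g t \<in> kr.KC 3" "lookup (fst (rT g t)) 0 = lookup g 0 * c"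
      by (auto simp: L3_iff rT_def kr.KC_def lookup_tmul_0)
    then show "CL 0 +>\<^bsub>(DU 3)\<lparr>carrier := Phi 3 ` kr.KC 3\<rparr>\<^esub> (rep g \<odot>\<^bsub>DU 3\<^esub> Phi 3 t) = CL (lookup g 0 * c)"
      by (simp add: DU_smult coset_3)
  qed
  also have "\<dots> = CL (lookup g 0 * c)" using L3_single by blast
  finally show ?thesis .
qed

text \<open>The top generator has degree \<open>3 * N\<close>, so the map with value 1 on it has
  degree \<open>-3 * N\<close>. This is where the shift \<open>3 * N\<close> in the regularity
  condition comes from.\<close>

lemma E3_grading: "Ext_grading A G kr.PM HH kr.DM 3 m = (if m + int (3 * N) = 0 then range CL else {CL 0})"
proof -
  have "Ext_cocycles A G kr.PM HH kr.DM 3 \<inter> dual_comp A G (kr.PM 3) (HH 3) m =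
      Phi 3 ` {t \<in> kr.KC 3. t \<in> homT (int (N * 3) + m)}"
    unfolding cocycles_3 using Phi_dual_comp[of _ 3 m] by blast
  then have g: "Ext_grading A G kr.PM HH kr.DM 3 m =
      (\<lambda>t. CL (lookup (fst t) 0)) ` {t \<in> kr.KC 3. t \<in> homT (int (N * 3) + m)}"
    unfolding Ext_grading_def coboundaries_3
    by (simp only: image_image) (intro image_cong HOL.refl coset_3(1), auto)
  have *: "int (N * 3) + m = m + int (3 * N)" by simp
  show ?thesis
  proof (cases "m + int (3 * N) = 0")
    case True
    have "(single 0 c, 0, 0) \<in> {t \<in> kr.KC 3. t \<in> homT (int (N * 3) + m)}" for c
      unfolding * True using L3_single[of c] by (auto simp: L3_def homT_def homI_def tdeg_def)
    then have "CL c \<in> Ext_grading A G kr.PM HH kr.DM 3 m" for c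
      unfolding g by (intro image_eqI[of _ _ "(single 0 c, 0, 0)"]) simp_all
    then show ?thesis using True g by auto
  next
    case False
    have "lookup (fst t) 0 = 0" if "t \<in> homT (int (N * 3) + m)" for t
    proof (rule lookup_homI)
      show "fst t \<in> homI N (int (N * 3) + m)" using that by (auto simp: homT_def)
      show "int (N * tdeg 0) \<noteq> int (N * 3) + m" using False by (simp add: tdeg_def)
    qed
    then have "Ext_grading A G kr.PM HH kr.DM 3 m \<subseteq> {CL 0}" unfolding g by auto
    moreover have "0 \<in> {t \<in> kr.KC 3. t \<in> homT (int (N * 3) + m)}"
      using KC_zero by (simp add: homT_def zero_prod_def)
    then have "CL 0 \<in> Ext_grading A G kr.PM HH kr.DM 3 m"
      unfolding g by (intro image_eqI[of _ _ 0]) simp_all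
    ultimately show ?thesis using False by auto
  qed
qed

lemma op_gqalg: "gqalg (\<lambda>a b. ch b a) (op_algebra A) rep N"
  using qalg_op N_pos by (intro gqalg.intro gqalg_axioms.intro)

theorem Ext_condition_A: "Ext_condition TYPE('u) A G 3 (int (3 * N))"
proof -
  interpret op: gqalg "\<lambda>a b. ch b a" "op_algebra A" rep N by (rule op_gqalg)
  have opc: "carrier (op_algebra A) = carrier A" by (simp add: op_algebra_def)
  define f where "f = (\<lambda>C \<in> range CL. the_inv_into UNIV CL C)"
  have f: "f (CL c) = c" for c
    unfolding f_def using CL_inj by (simp add: the_inv_into_f_f inj_def)
  have T: "carrier (trivial_module (op_algebra A) G) = UNIV" "c \<oplus>\<^bsub>trivial_module (op_algebra A) G\<^esub> d = c + d"
    "rep g \<odot>\<^bsub>trivial_module (op_algebra A) G\<^esub> c = lookup g 0 * c" for c d :: 'k and g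
    using op.TM_simps unfolding op.TM_def by auto
  have "graded_isomorphic (op_algebra A) E3 (Ext_grading A G kr.PM HH kr.DM 3)
    (trivial_module (op_algebra A) G) (trivial_grading (int (3 * N)))"
    unfolding graded_isomorphic_def
  proof (intro bexI[of _ f] conjI allI)
    show "f \<in> module_hom (op_algebra A) E3 (trivial_module (op_algebra A) G)"
      unfolding module_hom_def E3_carrier T opc
      by (auto elim!: rep_cases simp: E3_add E3_smult f T PiE_def) (simp add: f_def)
    show "bij_betw f (carrier E3) (carrier (trivial_module (op_algebra A) G))"
      unfolding E3_carrier T by (auto simp: bij_betw_def inj_on_def f image_image)
    show "f ` Ext_grading A G kr.PM HH kr.DM 3 m = trivial_grading (int (3 * N)) m" for m
      unfolding E3_grading trivial_grading_def by (simp add: image_image f)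
  qed
  then show ?thesis
    unfolding Ext_condition_def using TM_graded_resolution Ext_trivial by blast
qed

end

theorem gqalg_AS_regular:
  fixes ch :: "expo \<Rightarrow> expo \<Rightarrow> 'k::field_char_0" and \<iota> :: "'k \<Rightarrow> 'u"
  assumes "gqalg ch A rep N" and \<iota>: "inj \<iota>"
  shows "AS_regular TYPE('u) A (gqalg.G rep N) 3"
proof -
  interpret gqalg ch A rep N by fact
  obtain j :: "'k poly3 \<Rightarrow> 'u" where j: "inj j"
    using inj_complexes(2)[OF \<iota>] by blast
  interpret t: tres ch A rep N j by unfold_locales (rule j)
  interpret o: tres "\<lambda>a b. ch b a" "op_algebra A" rep N j
    by (intro tres.intro tres_axioms.intro t.op_gqalg j)
  show ?thesis
    unfolding AS_regular_def
    using A_connected_graded left_gldim_A[OF \<iota> j inj_complexes(1)[OF \<iota>]]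
      o.left_gldim_A[OF \<iota> j inj_complexes(1)[OF \<iota>]] gk_dim_A t.Ext_condition_A o.Ext_condition_A by blast
qed

section \<open>Normal forms in algebras given by generators and relations\<close>

section \<open>Words and twisted monomials\<close>

fun ev :: "gen \<Rightarrow> expo" where
  "ev gx = (1, 0, 0)" | "ev gy = (0, 1, 0)" | "ev gz = (0, 0, 1)"

lemma tdeg_ev: "tdeg (ev g) = 1"
  by (cases g) (simp_all add: tdeg_def)

lemma tdeg_eq_1: "tdeg a = 1 \<Longrightarrow> \<exists>g. a = ev g"
proof -
  assume a: "tdeg a = 1"
  obtain x y z where xyz: "a = (x, y, z)" by (cases a)
  consider "a = ev gx" | "a = ev gy" | "a = ev gz" using a by (fastforce simp: xyz tdeg_def)
  then show ?thesis by cases blast+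
qed

lemma tdeg_pos: "tdeg a = Suc m \<Longrightarrow> \<exists>g b. a = ev g + b \<and> tdeg b = m"
proof -
  assume a: "tdeg a = Suc m"
  obtain x y z where xyz: "a = (x, y, z)" by (cases a)
  have "x > 0 \<or> y > 0 \<or> z > 0" using a by (cases x; cases y; cases z; simp add: xyz tdeg_def)
  then consider "x > 0" | "y > 0" | "z > 0" by blast
  then show ?thesis
  proof cases
    case 1
    then show ?thesis using a by (intro exI[of _ gx] exI[of _ "(x - 1, y, z)"]) (auto simp: xyz tdeg_def)
  next
    case 2
    then show ?thesis using a by (intro exI[of _ gy] exI[of _ "(x, y - 1, z)"]) (auto simp: xyz tdeg_def)
  next
    case 3
    then show ?thesis using a by (intro exI[of _ gz] exI[of _ "(x, y, z - 1)"]) (auto simp: xyz tdeg_def)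
  qed
qed

lemma ev_add_exchange:
  assumes "ev g + a = ev h + b" "g \<noteq> h"
  shows "\<exists>c. a = ev h + c \<and> b = ev g + c"
proof -
  obtain x y z where a: "a = (x, y, z)" by (cases a)
  obtain x' y' z' where b: "b = (x', y', z')" by (cases b)
  show ?thesis
    by (rule exI[of _ "(x - fst (ev h), y - fst (snd (ev h)), z - snd (snd (ev h)))"])
      (use assms in \<open>cases g; cases h; auto simp: a b\<close>)
qed

text \<open>The twist is kept abstract because two instances are needed: the rotation for
  \<open>S_alg\<close> and the identity for \<open>A_rst\<close>.\<close>

locale words =
  fixes sg :: "expo \<Rightarrow> expo"
  assumes sg_add: "sg (a + b) = sg a + sg b" and sg3: "sg (sg (sg a)) = a"
    and tdeg_sg: "tdeg (sg a) = tdeg a"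
begin

text \<open>The letter at position \<open>i\<close> of a word is transformed by the \<open>i\<close>-th power of the twist.\<close>

primrec al :: "gen list \<Rightarrow> expo" where
  "al [] = 0" | "al (g # w) = ev g + sg (al w)"

lemma sg_0: "sg 0 = 0"
  using tdeg_sg[of 0] tdeg_eq_0[of "sg 0"] tdeg_eq_0[of 0] by simp

lemma sg_inj: "sg a = sg b \<longleftrightarrow> a = b"
  by (metis sg3)

lemma funpow_sg_3: "(sg ^^ (3 * k)) a = a"
  by (induction k) (simp_all add: sg3 eval_nat_numeral)

lemma al_append: "al (u @ v) = al u + (sg ^^ length u) (al v)"
  by (induction u) (simp_all add: sg_add add.assoc)

lemma tdeg_al: "tdeg (al w) = length w"
  by (induction w) (simp_all add: tdeg_add tdeg_ev tdeg_sg tdeg_eq_0)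

lemma al_surj: "\<exists>w. al w = a"
proof (induction "tdeg a" arbitrary: a)
  case 0
  then show ?case by (intro exI[of _ "[]"]) (simp add: tdeg_eq_0)
next
  case (Suc m)
  then obtain g b where gb: "a = ev g + b" "tdeg b = m" using tdeg_pos[of a m] by auto
  then obtain w where "al w = sg (sg b)" using Suc(1)[of "sg (sg b)"] by (auto simp: tdeg_sg)
  then show ?case by (intro exI[of _ "g # w"]) (simp add: gb sg3)
qed

lemma ev_preimage: "\<exists>k. sg (ev k) = ev g"
  using tdeg_eq_1[of "sg (sg (ev g))"] by (metis tdeg_sg tdeg_ev sg3)

text \<open>Words with equal exponent vectors are linked by exchanges of two letters in front of a
  tail. If the first letters differ, the vector contains both readings, so each word can be moved to
  one that begins with both, in either order.\<close>

lemma al_eq_induct: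
  assumes refl: "\<And>w. E w w" and trans: "\<And>u v w. E u v \<Longrightarrow> E v w \<Longrightarrow> E u w"
    and cons: "\<And>g u v. E u v \<Longrightarrow> E (g # u) (g # v)"
    and swap: "\<And>u v w. length u = 2 \<Longrightarrow> length v = 2 \<Longrightarrow> al u = al v \<Longrightarrow> E (u @ w) (v @ w)"
  shows "al w = al w' \<Longrightarrow> E w w'"
proof (induction "length w" arbitrary: w w')
  case 0
  then have "length w' = 0" using tdeg_al[of w] tdeg_al[of w'] by simp
  then show ?case using 0 refl by simp
next
  case (Suc m)
  then obtain g w1 where w: "w = g # w1" by (cases w) auto
  have "length w' = Suc m" using Suc(2,3) tdeg_al by metis
  then obtain h w1' where w': "w' = h # w1'" by (cases w') auto
  have len: "length w1 = m" "length w1' = m" using \<open>length w' = Suc m\<close> Suc(2) by (simp_all add: w w')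
  have eq: "ev g + sg (al w1) = ev h + sg (al w1')" using Suc(3) by (simp add: w w')
  show ?case
  proof (cases "g = h")
    case True
    then have "al w1 = al w1'" using eq by (simp add: sg_inj)
    then have "E w1 w1'" using Suc(1)[of w1 w1'] len by blast
    then show ?thesis unfolding w w' True by (rule cons)
  next
    case False
    obtain c where c: "sg (al w1) = ev h + c" "sg (al w1') = ev g + c"
      using ev_add_exchange[OF eq False] by blast
    \<comment> \<open>At position 1 the letter \<open>k\<close> is read as \<open>h\<close> and
      \<open>k'\<close> as \<open>g\<close>.\<close>
    obtain k k' where k: "sg (ev k) = ev h" "sg (ev k') = ev g" using ev_preimage by metis
    \<comment> \<open>A tail that begins at position 2 is read through \<open>sg\<close> twice, and
      \<open>sg (sg (sg c)) = c\<close>, so this tail contributes exactly \<open>c\<close>.\<close>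
    obtain v where v: "al v = sg c" using al_surj by blast
    have a: "al w1 = al (k # v)" "al (k' # v) = al w1'"
      unfolding sg_inj[symmetric, of "al w1"] sg_inj[symmetric, of "al (k' # v)"]
      by (simp_all add: c k v sg_add sg3)
    have "length (k' # v) = m" using a(2) tdeg_al len(2) by metis
    then have e: "E w1 (k # v)" "E (k' # v) w1'"
      using Suc(1)[of w1 "k # v"] Suc(1)[of "k' # v" w1'] a len by simp_all
    have "E ([g, k] @ v) ([h, k'] @ v)" by (rule swap) (simp_all add: k add.commute sg_0)
    then show ?thesis unfolding w w' using trans[OF cons[OF e(1)] trans[OF _ cons[OF e(2)]]] by simp
  qed
qed

end

section \<open>Presented algebras with a basis of twisted monomials\<close>

lemma ring_free_algebra: "ring (free_algebra :: ('k::field, 'g list \<Rightarrow>\<^sub>0 'k) module)"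
proof (rule ringI)
  show "abelian_group (free_algebra :: ('k, 'g list \<Rightarrow>\<^sub>0 'k) module)"
    by (rule abelian_groupI) (auto simp: free_algebra_def add.assoc add.commute add.left_commute intro: exI[of _ "- x" for x])
  show "monoid (free_algebra :: ('k, 'g list \<Rightarrow>\<^sub>0 'k) module)"
    by (rule monoidI) (auto simp: free_algebra_def mult.assoc)
qed (auto simp: free_algebra_def distrib_left distrib_right)

lemma free_algebra_simps [simp]:
  "carrier free_algebra = UNIV" "\<zero>\<^bsub>free_algebra\<^esub> = 0" "\<one>\<^bsub>free_algebra\<^esub> = 1"
  "f \<oplus>\<^bsub>free_algebra\<^esub> g = f + g" "f \<otimes>\<^bsub>free_algebra\<^esub> g = f * g" "c \<odot>\<^bsub>free_algebra\<^esub> f = single [] c * f"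
  by (simp_all add: free_algebra_def)

lemma single_Nil_one: "single [] 1 = (1 :: 'g list \<Rightarrow>\<^sub>0 'k::field)"
  unfolding zero_list_def[symmetric] by (rule single_one)

lemma single_eq_0 [simp]: "single k x = 0 \<longleftrightarrow> x = 0"
  by (metis single_zero single_eq_iff)

lemma single_list_mult: "single u a * single v b = single (u @ v) (a * b)" for u v :: "'g list"
  by (simp add: mult_single plus_list_def)

text \<open>\<open>ka w\<close> is the scalar with which the word \<open>w\<close> reads as a
  monomial. The condition \<open>rels\<close> makes the reading compatible with the relations, which
  keeps the monomials independent; \<open>swap\<close> supplies enough relations for words with the
  same vector to be proportional.\<close>

locale pwords = words sg + bichar ch
  for sg :: "expo \<Rightarrow> expo" and ch :: "expo \<Rightarrow> expo \<Rightarrow> 'k::field" +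
  fixes R :: "(gen list \<Rightarrow>\<^sub>0 'k) set" and ka :: "gen list \<Rightarrow> 'k"
  assumes ch_sg: "ch (sg a) (sg b) = ch a b"
    and ka_Nil: "ka [] = 1" and ka_Cons: "ka (g # w) = ch (ev g) (sg (al w)) * ka w"
    and rels: "r \<in> R \<Longrightarrow> \<exists>u v c. length u = length v \<and> al u = al v \<and> ka u = c * ka v \<and> r = single u 1 - single v c"
    and swap: "length u = 2 \<Longrightarrow> length v = 2 \<Longrightarrow> al u = al v \<Longrightarrow> u \<noteq> v \<Longrightarrow>
      \<exists>c. c \<noteq> 0 \<and> (single u 1 - single v c \<in> R \<or> single v 1 - single u c \<in> R)"
begin

lemma ka_nz [simp]: "ka w \<noteq> 0"
  by (induction w) (simp_all add: ka_Nil ka_Cons)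

lemma ka_append: "ka (u @ v) = ka u * ka v * ch (al u) ((sg ^^ length u) (al v))"
proof (induction u)
  case (Cons g u)
  have "ka ((g # u) @ v) = ch (ev g) (sg (al (u @ v))) * ka (u @ v)" by (simp add: ka_Cons)
  also have "\<dots> = ch (ev g) (sg (al u)) * ch (ev g) (sg ((sg ^^ length u) (al v))) *
      (ka u * ka v * ch (sg (al u)) (sg ((sg ^^ length u) (al v))))"
    by (simp only: al_append sg_add ch_add_right Cons.IH ch_sg)
  also have "\<dots> = ka (g # u) * ka v * ch (al (g # u)) ((sg ^^ length (g # u)) (al v))"
    by (simp add: ka_Cons ch_add_left)
  finally show ?case .
qed (simp add: ka_Nil)

text \<open>The reading of words as scaled monomials. It is linear but in general not
  multiplicative: in a product the second word is read through the power of \<open>sg\<close> given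
  by the length of the first.\<close>

definition Phi :: "(gen list \<Rightarrow>\<^sub>0 'k) \<Rightarrow> (expo \<Rightarrow>\<^sub>0 'k)"
  where "Phi = lext (\<lambda>w c. single (al w) (c * ka w))"

lemma additive_Phi: "additive Phi"
  unfolding Phi_def by (rule additive_lext) (simp add: additive_def distrib_right single_add)

lemma Phi_single: "Phi (single w c) = single (al w) (c * ka w)"
  by (simp add: Phi_def)

lemmas Phi_add = additive.add[OF additive_Phi]
lemmas Phi_diff = additive.diff[OF additive_Phi]
lemmas Phi_zero [simp] = additive.zero[OF additive_Phi]

definition II :: "(gen list \<Rightarrow>\<^sub>0 'k) set" where "II = Idl\<^bsub>free_algebra\<^esub> R"

interpretation F: ring "free_algebra :: ('k, gen list \<Rightarrow>\<^sub>0 'k) module" by (rule ring_free_algebra)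

lemma ideal_II: "ideal II free_algebra"
  unfolding II_def by (rule F.genideal_ideal) simp

lemma II_zero: "0 \<in> II"
  using additive_subgroup.zero_closed[OF ideal.axioms(1)[OF ideal_II]] by simp

lemma II_add: "f \<in> II \<Longrightarrow> g \<in> II \<Longrightarrow> f + g \<in> II"
  using additive_subgroup.a_closed[OF ideal.axioms(1)[OF ideal_II], of f g] by simp

lemma II_left: "f \<in> II \<Longrightarrow> g * f \<in> II"
  using ideal.I_l_closed[OF ideal_II, of f g] by simp

lemma II_right: "f \<in> II \<Longrightarrow> f * g \<in> II"
  using ideal.I_r_closed[OF ideal_II, of f g] by simp

lemma R_II: "r \<in> R \<Longrightarrow> r \<in> II"
  using F.genideal_self[of R] by (auto simp: II_def)

definition sim :: "gen list \<Rightarrow> gen list \<Rightarrow> bool"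
  where "sim u v \<longleftrightarrow> (\<exists>c. c \<noteq> 0 \<and> single u 1 - single v c \<in> II)"

lemma sim_al: "al w = al w' \<Longrightarrow> sim w w'"
proof (rule al_eq_induct[of sim])
  show "sim w w" for w unfolding sim_def by (rule exI[of _ 1]) (simp add: II_zero)
  show "sim u w" if uv: "sim u v" and vw: "sim v w" for u v w
  proof -
    obtain c d where c: "c \<noteq> 0" "single u 1 - single v c \<in> II" and d: "d \<noteq> 0" "single v 1 - single w d \<in> II"
      using uv vw unfolding sim_def by blast
    have e: "single u 1 - single w (c * d) = (single u 1 - single v c) + single [] c * (single v 1 - single w d)"
      by (simp add: right_diff_distrib single_list_mult)
    have "single u 1 - single w (c * d) \<in> II" unfolding e by (rule II_add[OF c(2) II_left[OF d(2)]])
    then show ?thesis unfolding sim_def using c(1) d(1) by (intro exI[of _ "c * d"]) simp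
  qed
  show "sim (g # u) (g # v)" if uv: "sim u v" for g u v
  proof -
    obtain c where c: "c \<noteq> 0" "single u 1 - single v c \<in> II" using uv unfolding sim_def by blast
    have "single (g # u) 1 - single (g # v) c = single [g] 1 * (single u 1 - single v c)"
      by (simp add: right_diff_distrib single_list_mult)
    then show ?thesis unfolding sim_def using II_left[OF c(2)] c(1) by metis
  qed
  show "sim (u @ w) (v @ w)" if uv: "length u = 2" "length v = 2" "al u = al v" for u v w
  proof (cases "u = v")
    case True
    then show ?thesis unfolding sim_def by (intro exI[of _ 1]) (simp add: II_zero)
  next
    case False
    obtain c where c: "c \<noteq> 0" "single u 1 - single v c \<in> R \<or> single v 1 - single u c \<in> R"
      using swap[OF uv False] by blast
    have "\<exists>d. d \<noteq> 0 \<and> single u 1 - single v d \<in> II"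
      using c(2)
    proof
      assume "single u 1 - single v c \<in> R"
      then show ?thesis using c(1) R_II by blast
    next
      assume "single v 1 - single u c \<in> R"
      then have "single [] (- inverse c) * (single v 1 - single u c) \<in> II" by (intro II_left R_II)
      moreover have "single [] (- inverse c) * (single v 1 - single u c) = single u 1 - single v (inverse c)"
        using c(1) by (simp add: right_diff_distrib single_list_mult single_uminus)
      ultimately show ?thesis using c(1) by (intro exI[of _ "inverse c"]) simp
    qed
    then obtain d where d: "d \<noteq> 0" "single u 1 - single v d \<in> II" by blast
    have "single (u @ w) 1 - single (v @ w) d = (single u 1 - single v d) * single w 1"
      by (simp add: left_diff_distrib single_list_mult)
    then show ?thesis unfolding sim_def using II_right[OF d(2)] d(1) by metis
  qed
qed

lemma Phi_sandwich_rel: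
  assumes "r \<in> R"
  shows "Phi (single x 1 * r * single y 1) = 0"
proof -
  obtain u v c where r: "length u = length v" "al u = al v" "ka u = c * ka v" "r = single u 1 - single v c"
    using rels[OF assms] by blast
  have "al (x @ u @ y) = al (x @ v @ y)" "ka (x @ u @ y) = c * ka (x @ v @ y)"
    by (simp_all add: al_append ka_append r(1-3))
  then show ?thesis
    by (simp add: r(4) right_diff_distrib left_diff_distrib single_list_mult Phi_diff Phi_single)
qed

text \<open>Since \<open>Phi\<close> need not be multiplicative, its kernel is not visibly an ideal.
  The set \<open>K\<close> of elements killed in every context of words is one; it lies in the
  kernel and contains the relators by \<open>Phi_sandwich_rel\<close>.\<close>

lemma II_subset_kernel: "f \<in> II \<Longrightarrow> Phi f = 0"
proof -
  define K where "K = {f. \<forall>x y. Phi (single x 1 * f * single y 1) = 0}"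
  have K_add: "f + g \<in> K" if "f \<in> K" "g \<in> K" for f g
    using that by (simp add: K_def distrib_left distrib_right Phi_add)
  have scal: "Phi (single [] c * f) = 0" if "Phi f = 0" for c f
  proof -
    have "Phi (single [] c * f) = scaleP c (Phi f)"
    proof (rule additive_eqI[of "\<lambda>f. Phi (single [] c * f)" "\<lambda>f. scaleP c (Phi f)"])
      show "additive (\<lambda>f. Phi (single [] c * f))" by (simp add: additive_def distrib_left Phi_add)
      show "additive (\<lambda>f. scaleP c (Phi f))" by (rule additive_comp[OF additive_scaleP additive_Phi])
    qed (simp add: single_list_mult Phi_single scaleP_single)
    then show ?thesis using that additive.zero[OF additive_scaleP] by simp
  qed
  have K_single: "single w c * f \<in> K" "f * single w c \<in> K" if f: "f \<in> K" for w c f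
  proof -
    have "single x 1 * (single w c * f) * single y 1 = single [] c * (single (x @ w) 1 * f * single y 1)"
      "single x 1 * (f * single w c) * single y 1 = single [] c * (single x 1 * f * single (w @ y) 1)" for x y
    proof -
      have sp: "single (x @ w) 1 = single x 1 * (single w 1 :: _ \<Rightarrow>\<^sub>0 'k)" "single w c = single [] c * (single w 1 :: _ \<Rightarrow>\<^sub>0 'k)"
        "single (w @ y) 1 = single w 1 * (single y 1 :: _ \<Rightarrow>\<^sub>0 'k)"
        by (simp_all add: single_list_mult)
      have cc: "g * single [] c = single [] c * g" for g :: "gen list \<Rightarrow>\<^sub>0 'k"
        by (rule additive_eqI[of "\<lambda>g. g * single [] c" "\<lambda>g. single [] c * g"])
          (simp_all add: additive_def distrib_left distrib_right single_list_mult mult.commute)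
      have "single x 1 * (single [] c * single w 1 * f) * single y 1 = (single x 1 * single [] c) * (single w 1 * f * single y 1)"
        by (simp only: mult.assoc)
      also have "\<dots> = (single [] c * single x 1) * (single w 1 * f * single y 1)" by (simp only: cc)
      also have "\<dots> = single [] c * (single x 1 * single w 1 * f * single y 1)" by (simp only: mult.assoc)
      finally show "single x 1 * (single w c * f) * single y 1 = single [] c * (single (x @ w) 1 * f * single y 1)"
        unfolding sp .
      have "single x 1 * (f * (single [] c * single w 1)) * single y 1 = single x 1 * ((f * single [] c) * (single w 1 * single y 1))"
        by (simp only: mult.assoc)
      also have "\<dots> = single x 1 * ((single [] c * f) * (single w 1 * single y 1))" by (simp only: cc)
      also have "\<dots> = (single x 1 * single [] c) * (f * (single w 1 * single y 1))" by (simp only: mult.assoc)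
      also have "\<dots> = (single [] c * single x 1) * (f * (single w 1 * single y 1))" by (simp only: cc)
      also have "\<dots> = single [] c * (single x 1 * f * (single w 1 * single y 1))" by (simp only: mult.assoc)
      finally show "single x 1 * (f * single w c) * single y 1 = single [] c * (single x 1 * f * single (w @ y) 1)"
        unfolding sp .
    qed
    then show "single w c * f \<in> K" "f * single w c \<in> K" using f scal unfolding K_def by simp_all
  qed
  have K0: "0 \<in> K" by (simp add: K_def)
  have K_mult: "g * f \<in> K" "f * g \<in> K" if f: "f \<in> K" for f g
  proof (induction g rule: single_add_induct)
    case zero
    show "0 * f \<in> K" "f * 0 \<in> K" using K0 by simp_all
  next
    case (add b w g)
    then show "(single b w + g) * f \<in> K" "f * (single b w + g) \<in> K"
      using K_single[OF f] K_add by (simp_all add: distrib_left distrib_right)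
  qed
  have "ideal K free_algebra"
  proof (rule idealI[OF ring_free_algebra])
    show "subgroup K (add_monoid free_algebra)"
    proof (rule group.subgroupI)
      show "Group.group (add_monoid (free_algebra :: ('k, gen list \<Rightarrow>\<^sub>0 'k) module))" by (rule F.add.group_axioms)
      show "inv\<^bsub>add_monoid free_algebra\<^esub> a \<in> K" if "a \<in> K" for a
      proof -
        have "\<ominus>\<^bsub>free_algebra\<^esub> a = - a" by (rule F.minus_equality) simp_all
        then show ?thesis using K_mult(1)[OF that, of "- 1"] by (simp add: a_inv_def)
      qed
    qed (use K0 K_add in auto)
  qed (use K_mult in auto)
  moreover have "R \<subseteq> K" using Phi_sandwich_rel by (auto simp: K_def)
  ultimately have "II \<subseteq> K" unfolding II_def by (rule F.genideal_minimal)
  moreover assume "f \<in> II"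
  ultimately have "Phi (single [] 1 * f * single [] 1) = 0" unfolding K_def by blast
  then show "Phi f = 0" by (simp add: single_Nil_one)
qed

definition canon :: "expo \<Rightarrow> gen list" where "canon a = (SOME w. al w = a)"

lemma al_canon [simp]: "al (canon a) = a"
  unfolding canon_def by (rule someI_ex[OF al_surj])

definition Psi :: "(expo \<Rightarrow>\<^sub>0 'k) \<Rightarrow> (gen list \<Rightarrow>\<^sub>0 'k)"
  where "Psi = lext (\<lambda>a c. single (canon a) (c / ka (canon a)))"

lemma additive_Psi: "additive Psi"
  unfolding Psi_def by (rule additive_lext) (simp add: additive_def add_divide_distrib single_add)

lemma Psi_single: "Psi (single a c) = single (canon a) (c / ka (canon a))"
  by (simp add: Psi_def)

lemma Phi_Psi: "Phi (Psi b) = b"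
  by (rule additive_eqI[OF additive_comp[OF additive_Phi additive_Psi] additive_id])
    (simp add: Psi_single Phi_single)

text \<open>Modulo the ideal every word is proportional to the chosen word with the same exponent
  vector.\<close>

lemma Psi_Phi_II: "f - Psi (Phi f) \<in> II"
proof (induction f rule: single_add_induct)
  case zero
  show ?case by (simp add: additive.zero[OF additive_Psi] II_zero)
next
  case (add w c f)
  obtain d where d: "single w 1 - single (canon (al w)) d \<in> II" using sim_al[of w "canon (al w)"] by (auto simp: sim_def)
  \<comment> \<open>The factor of proportionality is identified by applying \<open>Phi\<close>,
    which vanishes on the ideal.\<close>
  have "ka w = d * ka (canon (al w))"
    using II_subset_kernel[OF d] by (simp add: Phi_diff Phi_single single_diff[symmetric])
  then have "single w c - Psi (Phi (single w c)) = single [] c * (single w 1 - single (canon (al w)) d)"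
    by (simp add: Phi_single Psi_single right_diff_distrib single_list_mult)
  then have "single w c - Psi (Phi (single w c)) \<in> II" using II_left[OF d] by simp
  from II_add[OF this add(3)] show ?case
    by (simp add: Phi_add additive.add[OF additive_Psi] algebra_simps)
qed

lemma II_eq: "II = {f. Phi f = 0}"
proof (intro equalityI subsetI)
  fix f assume "f \<in> {f. Phi f = 0}"
  then show "f \<in> II" using Psi_Phi_II[of f] additive.zero[OF additive_Psi] by simp
qed (simp add: II_subset_kernel)

text \<open>The ideal is the kernel of \<open>Phi\<close>, so these fibres are its cosets, that is,
  the elements of the quotient algebra.\<close>

definition cls :: "(expo \<Rightarrow>\<^sub>0 'k) \<Rightarrow> (gen list \<Rightarrow>\<^sub>0 'k) set" where "cls b = {f. Phi f = b}"

lemma coset_cls: "II +>\<^bsub>free_algebra\<^esub> f = cls (Phi f)"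
proof -
  have "g \<in> II +>\<^bsub>free_algebra\<^esub> f" if "Phi g = Phi f" for g
  proof -
    have "g - f \<in> II" using that by (simp add: II_eq Phi_diff)
    then show ?thesis unfolding a_r_coset_def' by (auto intro!: bexI[of _ "g - f"])
  qed
  then show ?thesis by (auto simp: a_r_coset_def' cls_def II_eq Phi_add)
qed

lemma Psi_cls: "Psi b \<in> cls b"
  by (simp add: cls_def Phi_Psi)

lemma cls_eq [simp]: "cls a = cls b \<longleftrightarrow> a = b"
proof
  assume "cls a = cls b"
  then have "Psi a \<in> cls b" using Psi_cls[of a] by simp
  then show "a = b" by (simp add: cls_def Phi_Psi)
qed simp

abbreviation "PA \<equiv> presented_algebra R"

lemma PA_carrier: "carrier PA = range cls"
proof -
  have "carrier PA = range (\<lambda>f. cls (Phi f))"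
    by (auto simp: presented_algebra_def quotient_by_def ring.defs module.defs FactRing_def A_RCOSETS_def'
        II_def[symmetric] coset_cls)
  also have "\<dots> = range cls"
  proof (intro equalityI subsetI)
    fix x assume "x \<in> range cls"
    then obtain b where "x = cls b" by blast
    then show "x \<in> range (\<lambda>f. cls (Phi f))" by (intro image_eqI[of _ _ "Psi b"]) (simp_all add: Phi_Psi)
  qed blast
  finally show ?thesis .
qed

lemma PA_zero: "\<zero>\<^bsub>PA\<^esub> = cls 0"
  by (simp add: presented_algebra_def quotient_by_def ring.defs module.defs FactRing_def II_def[symmetric] II_eq cls_def)

lemma PA_one: "\<one>\<^bsub>PA\<^esub> = cls 1"
proof -
  have "Phi 1 = 1" using Phi_single[of "[]" 1] by (simp add: ka_Nil single_Nil_one)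
  then show ?thesis
    by (simp add: presented_algebra_def quotient_by_def ring.defs module.defs FactRing_def II_def[symmetric] coset_cls)
qed

lemma PA_add: "cls a \<oplus>\<^bsub>PA\<^esub> cls b = cls (a + b)"
proof -
  have "cls a \<oplus>\<^bsub>PA\<^esub> cls b = (\<Union>h\<in>cls a. \<Union>k\<in>cls b. {h + k})"
    by (simp add: presented_algebra_def quotient_by_def ring.defs module.defs FactRing_def set_add_def')
  also have "\<dots> = cls (a + b)"
  proof (intro equalityI subsetI)
    fix f assume "f \<in> cls (a + b)"
    then have "f - Psi b \<in> cls a" "f = (f - Psi b) + Psi b" by (simp_all add: cls_def Phi_diff Phi_Psi)
    then show "f \<in> (\<Union>h\<in>cls a. \<Union>k\<in>cls b. {h + k})" using Psi_cls[of b] by blast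
  qed (auto simp: cls_def Phi_add)
  finally show ?thesis .
qed

lemma Phi_mult_cong: "Phi f = Phi f' \<Longrightarrow> Phi g = Phi g' \<Longrightarrow> Phi (f * g) = Phi (f' * g')"
proof -
  assume "Phi f = Phi f'" "Phi g = Phi g'"
  then have "f - f' \<in> II" "g - g' \<in> II" by (simp_all add: II_eq Phi_diff)
  then have "(f - f') * g + f' * (g - g') \<in> II" by (intro II_add II_left II_right)
  moreover have "(f - f') * g + f' * (g - g') = f * g - f' * g'" by (simp add: left_diff_distrib right_diff_distrib)
  ultimately show ?thesis by (simp add: II_eq Phi_diff)
qed

lemma PA_mult: "cls (Phi f) \<otimes>\<^bsub>PA\<^esub> cls (Phi g) = cls (Phi (f * g))"
proof -
  have "cls (Phi f) \<otimes>\<^bsub>PA\<^esub> cls (Phi g) = (\<Union>x\<in>cls (Phi f). \<Union>y\<in>cls (Phi g). cls (Phi (x * y)))"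
    by (simp add: presented_algebra_def quotient_by_def ring.defs module.defs FactRing_def rcoset_mult_def
        II_def[symmetric] coset_cls)
  also have "\<dots> = (\<Union>x\<in>cls (Phi f). \<Union>y\<in>cls (Phi g). cls (Phi (f * g)))"
    by (intro SUP_cong HOL.refl arg_cong[of _ _ cls] Phi_mult_cong) (simp_all add: cls_def)
  also have "\<dots> = cls (Phi (f * g))" by (auto simp: cls_def)
  finally show ?thesis .
qed

lemma PA_smult: "c \<odot>\<^bsub>PA\<^esub> cls b = cls (scaleP c b)"
proof -
  have e: "Phi (single [] c * f) = scaleP c (Phi f)" for f
  proof (rule additive_eqI[of "\<lambda>f. Phi (single [] c * f)" "\<lambda>f. scaleP c (Phi f)"])
    show "additive (\<lambda>f. Phi (single [] c * f))" by (simp add: additive_def distrib_left Phi_add)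
    show "additive (\<lambda>f. scaleP c (Phi f))" by (rule additive_comp[OF additive_scaleP additive_Phi])
  qed (simp add: single_list_mult Phi_single scaleP_single)
  have "c \<odot>\<^bsub>PA\<^esub> cls b = (\<Union>x\<in>cls b. cls (scaleP c (Phi x)))"
    by (simp add: presented_algebra_def quotient_by_def ring.defs module.defs II_def[symmetric] coset_cls e)
  also have "\<dots> = (\<Union>x\<in>cls b. cls (scaleP c b))"
    by (intro SUP_cong HOL.refl) (simp add: cls_def)
  also have "\<dots> = cls (scaleP c b)" using Psi_cls by blast
  finally show ?thesis .
qed

lemma word_class_cls: "word_class R w = cls (single (al w) (ka w))"
  by (simp add: word_class_def II_def[symmetric] coset_cls Phi_single)

lemma word_class_mult: "word_class R u \<otimes>\<^bsub>PA\<^esub> word_class R v = word_class R (u @ v)"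
  using PA_mult[of "single u 1" "single v 1"] by (simp add: word_class_cls Phi_single single_list_mult)

lemma word_class_pow: "word_class R w [^]\<^bsub>PA\<^esub> (k::nat) = word_class R (concat (replicate k w))"
proof (induction k)
  case 0
  show ?case by (simp add: PA_one word_class_cls ka_Nil)
next
  case (Suc k)
  have "concat (replicate k w) @ w = w @ concat (replicate k w)"
    by (induction k) simp_all
  then show ?case using Suc by (simp add: word_class_mult)
qed

lemma PA_abelian_group: "abelian_group PA"
proof (rule abelian_groupI)
  show "\<exists>y\<in>carrier PA. y \<oplus>\<^bsub>PA\<^esub> x = \<zero>\<^bsub>PA\<^esub>" if x: "x \<in> carrier PA" for x
  proof -
    obtain b where "x = cls b" using x by (auto simp: PA_carrier)
    then show ?thesis by (intro bexI[of _ "cls (- b)"]) (simp_all add: PA_add PA_zero PA_carrier)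
  qed
qed (auto simp: PA_carrier PA_add PA_zero add.assoc add.commute add.left_commute)

lemma k_span_words: "k_span PA {word_class R w |w. D w} = cls ` {f. keys f \<subseteq> {al w |w. D w}}"
proof
  interpret G: abelian_group PA by (rule PA_abelian_group)
  let ?U = "{f. keys f \<subseteq> {al w |w. D w}}"
  have "submodule (cls ` ?U) base PA"
  proof (intro submodule.intro submodule_axioms.intro)
    show "subgroup (cls ` ?U) (add_monoid PA)"
    proof (rule group.subgroupI[OF G.add.group_axioms])
      show "cls ` ?U \<noteq> {}" by (auto intro!: exI[of _ 0])
      show "inv\<^bsub>add_monoid PA\<^esub> a \<in> cls ` ?U" if a: "a \<in> cls ` ?U" for a
      proof -
        obtain f where f: "a = cls f" "f \<in> ?U" using a by blast
        have "\<ominus>\<^bsub>PA\<^esub> a = cls (- f)" unfolding f(1)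
          by (rule G.minus_equality) (simp_all add: PA_add PA_zero PA_carrier)
        moreover have "- f \<in> ?U" using f(2) by (simp add: keys_def)
        ultimately show ?thesis by (simp add: a_inv_def)
      qed
      show "a \<otimes>\<^bsub>add_monoid PA\<^esub> b \<in> cls ` ?U" if ab: "a \<in> cls ` ?U" "b \<in> cls ` ?U" for a b
      proof -
        obtain f g where fg: "a = cls f" "f \<in> ?U" "b = cls g" "g \<in> ?U" using ab by blast
        then have "f + g \<in> ?U" using keys_add[of f g] by blast
        then show ?thesis by (simp add: fg PA_add)
      qed
    qed (auto simp: PA_carrier)
    show "c \<odot>\<^bsub>PA\<^esub> x \<in> cls ` ?U" if x: "x \<in> cls ` ?U" for c x
    proof -
      obtain f where f: "x = cls f" "f \<in> ?U" using x by blast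
      then have "scaleP c f \<in> ?U" by (auto simp: in_keys_iff lookup_scaleP)
      then show ?thesis by (simp add: f PA_smult)
    qed
  qed
  moreover have "{word_class R w |w. D w} \<subseteq> cls ` ?U" by (auto simp: word_class_cls intro!: imageI)
  ultimately show "k_span PA {word_class R w |w. D w} \<subseteq> cls ` ?U" unfolding k_span_def by blast
  show "cls ` ?U \<subseteq> k_span PA {word_class R w |w. D w}"
    unfolding k_span_def
  proof (intro Inter_greatest subsetI)
    fix W x assume W: "W \<in> {W. submodule W base PA \<and> {word_class R w |w. D w} \<subseteq> W}" and "x \<in> cls ` ?U"
    then obtain f where f: "x = cls f" "keys f \<subseteq> {al w |w. D w}" by blast
    interpret W: submodule W base PA using W by blast
    show "x \<in> W" unfolding f(1) using f(2)
    proof (induction f rule: single_add_induct)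
      case zero
      show ?case using W.one_closed by (simp add: PA_zero)
    next
      case (add b c f)
      then obtain w where w: "b = al w" "D w" by (auto simp: keys_single_add)
      have "word_class R w \<in> W" using W w(2) by blast
      then have "(c / ka w) \<odot>\<^bsub>PA\<^esub> word_class R w \<in> W" by (intro W.smult_closed) (simp_all add: base_def)
      then have "cls (single b c) \<in> W" by (simp add: word_class_cls PA_smult scaleP_single w(1))
      moreover have "cls f \<in> W" using add by (simp add: keys_single_add)
      ultimately show ?case using W.m_closed by (fastforce simp: PA_add[symmetric])
    qed
  qed
qed

end

definition mulv :: "nat \<Rightarrow> expo \<Rightarrow> expo"
  where "mulv m = map_prod ((*) m) (map_prod ((*) m) ((*) m))"

lemma mulv_add: "mulv m (a + b) = mulv m a + mulv m b"
  by (cases a; cases b) (simp add: mulv_def distrib_left)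

lemma mulv_0 [simp]: "mulv m 0 = 0"
  by (simp add: mulv_def zero_prod_def)

lemma mulv_eq: "m > 0 \<Longrightarrow> mulv m a = mulv m b \<longleftrightarrow> a = b"
  by (cases a; cases b) (simp add: mulv_def)

lemma tdeg_mulv: "tdeg (mulv m a) = m * tdeg a"
  by (cases a) (simp add: mulv_def tdeg_def distrib_left)

definition emb :: "nat \<Rightarrow> (expo \<Rightarrow>\<^sub>0 'k::field) \<Rightarrow> (expo \<Rightarrow>\<^sub>0 'k)"
  where "emb m = lext (\<lambda>b c. single (mulv m b) c)"

lemma additive_emb: "additive (emb m)"
  unfolding emb_def by (rule additive_lext[OF additive_single])

lemma emb_single: "emb m (single b c) = single (mulv m b) c"
  by (simp add: emb_def)

lemma lookup_emb: "m > 0 \<Longrightarrow> lookup (emb m f) (mulv m b) = lookup f b"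
  by (rule additive_eqI[OF additive_comp[OF additive_lookup additive_emb] additive_lookup])
    (simp add: emb_single lookup_single mulv_eq when_def)

lemma keys_emb: "m > 0 \<Longrightarrow> keys (emb m f) = mulv m ` keys f"
proof (induction f rule: single_add_induct)
  case zero
  show ?case by (simp add: additive.zero[OF additive_emb])
next
  case (add b c f)
  then have "mulv m b \<notin> keys (emb m f)" by (auto simp: mulv_eq)
  then show ?case using add
    by (simp add: additive.add[OF additive_emb] emb_single keys_single_add)
qed

lemma emb_image: "m > 0 \<Longrightarrow> keys f \<subseteq> mulv m ` E \<Longrightarrow> \<exists>g. keys g \<subseteq> E \<and> f = emb m g"
proof (induction f rule: single_add_induct)
  case zero
  show ?case by (rule exI[of _ 0]) (simp add: additive.zero[OF additive_emb])
next
  case (add b c f)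
  then obtain g where g: "keys g \<subseteq> E" "f = emb m g" by (auto simp: keys_single_add)
  obtain a where a: "b = mulv m a" "a \<in> E" using add by (auto simp: keys_single_add)
  have "keys (single a c + g) \<subseteq> E" by (rule order_trans[OF keys_add]) (use g a in auto)
  then show ?case
    by (intro exI[of _ "single a c + g"]) (simp add: additive.add[OF additive_emb] emb_single a(1) g(2))
qed

context pwords
begin

text \<open>Monomials whose exponents are multiples of \<open>m\<close> multiply without twist when \<open>m\<close> is a multiple of the
  order of \<open>sg\<close>.\<close>

lemma qalg_sub:
  assumes m: "m > 0" and sgm: "\<And>k a. (sg ^^ (m * k)) a = a"
    and ch': "\<And>a b. ch' a b = ch (mulv m a) (mulv m b)"
  shows "qalg ch' (PA\<lparr>carrier := cls ` {f. keys f \<subseteq> range (mulv m)}\<rparr>) (\<lambda>f. cls (emb m f))"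
proof -
  interpret c: bichar ch' by unfold_locales (simp_all add: ch' mulv_add ch_add_left ch_add_right)
  have mult: "cls (emb m (c.tmul f g)) = cls (emb m f) \<otimes>\<^bsub>PA\<^esub> cls (emb m g)" for f g
  proof -
    have e: "emb m (c.tmul f g) = Phi (Psi (emb m f) * Psi (emb m g))"
    proof -
      have s: "emb m (c.tmul (single a x) (single b y)) = Phi (Psi (emb m (single a x)) * Psi (emb m (single b y)))"
        for a x b y
      proof -
        \<comment> \<open>The first word has length divisible by \<open>m\<close>, so the second one
          is read without a shift and the reading is multiplicative.\<close>
        have len: "length (canon (mulv m a)) = m * tdeg a"
          using tdeg_al[of "canon (mulv m a)"] by (simp add: tdeg_mulv)
        show ?thesis
          by (simp add: c.tmul_single emb_single Psi_single single_list_mult Phi_single al_append ka_append len sgm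
              mulv_add ch')
      qed
      have aPP: "additive (\<lambda>g. Phi (h * Psi (emb m g)))" "additive (\<lambda>g. Phi (Psi (emb m g) * h))" for h
        by (simp_all add: additive_def additive.add[OF additive_emb] additive.add[OF additive_Psi]
            distrib_left distrib_right Phi_add)
      have "emb m (c.tmul (single a x) g) = Phi (Psi (emb m (single a x)) * Psi (emb m g))" for a x
        by (rule additive_eqI[OF additive_comp[OF additive_emb c.self.additive_tact_right] aPP(1)]) (rule s)
      then show ?thesis
        by (rule additive_eqI[OF additive_comp[OF additive_emb c.self.additive_tact_left] aPP(2)])
    qed
    show ?thesis using PA_mult[of "Psi (emb m f)" "Psi (emb m g)"] by (simp add: Phi_Psi e)
  qed
  have scale: "emb m (c.tmul (single 0 x) f) = scaleP x (emb m f)" for x f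
    by (rule additive_eqI[OF additive_comp[OF additive_emb c.self.additive_tact_right]
          additive_comp[OF additive_scaleP additive_emb]])
      (simp add: c.tmul_single emb_single scaleP_single)
  show ?thesis
  proof (intro qalg.intro qalg_axioms.intro c.bichar_axioms)
    have "cls ` {f. keys f \<subseteq> range (mulv m)} = range (\<lambda>f. cls (emb m f))"
    proof (intro equalityI subsetI)
      fix x assume "x \<in> cls ` {f. keys f \<subseteq> range (mulv m)}"
      then obtain f where "x = cls f" "keys f \<subseteq> range (mulv m)" by blast
      then show "x \<in> range (\<lambda>f. cls (emb m f))" using emb_image[OF m] by blast
    next
      fix x assume "x \<in> range (\<lambda>f. cls (emb m f))"
      then show "x \<in> cls ` {f. keys f \<subseteq> range (mulv m)}" using keys_emb[OF m] by blast
    qed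
    moreover have "inj (\<lambda>f. cls (emb m f))"
    proof (rule injI, rule poly_mapping_eqI)
      fix f g b assume "cls (emb m f) = cls (emb m g)"
      then show "lookup f b = lookup g b" using lookup_emb[OF m, of f b] lookup_emb[OF m, of g b] by simp
    qed
    ultimately show "bij_betw (\<lambda>f. cls (emb m f)) UNIV (carrier (PA\<lparr>carrier := cls ` {f. keys f \<subseteq> range (mulv m)}\<rparr>))"
      by (simp add: bij_betw_def)
    have "emb m 1 = 1" using emb_single[of m 0 1] by simp
    then show "cls (emb m 1) = \<one>\<^bsub>PA\<lparr>carrier := cls ` {f. keys f \<subseteq> range (mulv m)}\<rparr>\<^esub>" by (simp add: PA_one)
  qed (simp_all add: PA_add PA_zero PA_smult scale mult[symmetric] additive.add[OF additive_emb] additive.zero[OF additive_emb])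
qed

end

lemma (in gqalg) generated_by_variables:
  assumes B: "subring B A" "submodule B base A"
    and gen: "\<And>g. rep (single (ev g) (k g)) \<in> B" "\<And>g. k g \<noteq> 0"
  shows "carrier A \<subseteq> B"
proof
  interpret rA: ring A by (rule ring_A)
  interpret M: submodule B base A by (rule B)
  note Bc = subringE[OF B(1)]
  have sc: "rep (scaleP c f) \<in> B" if "rep f \<in> B" for c f
    using M.smult_closed[of c "rep f"] that by (simp add: base_def smult_rep)
  have mono: "rep (single b 1) \<in> B" for b
  proof (induction "tdeg b" arbitrary: b)
    case 0
    then show ?case using Bc(3) by (simp add: tdeg_eq_0 rep_one)
  next
    case (Suc m)
    then obtain g c where gc: "b = ev g + c" "tdeg c = m" using tdeg_pos[of b m] by auto
    have "rep (single (ev g) (k g)) \<otimes>\<^bsub>A\<^esub> rep (single c 1) \<in> B"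
      using gen(1) Suc(1) gc(2) by (intro Bc(6)) auto
    moreover define d where "d = k g * ch (ev g) c"
    ultimately have "rep (single b d) \<in> B" by (simp add: rep_mult[symmetric] tmul_single gc(1))
    moreover have "d \<noteq> 0" using gen(2)[of g] by (simp add: d_def)
    ultimately show ?case using sc[of "single b d" "inverse d"] by (simp add: scaleP_single)
  qed
  fix x assume "x \<in> carrier A"
  then obtain f where x: "x = rep f" by (rule rep_cases)
  show "x \<in> B" unfolding x
  proof (induction f rule: single_add_induct)
    case zero
    show ?case using Bc(2) by (simp add: rep_zero)
  next
    case (add b c f)
    have "rep (single b c) \<in> B" using sc[OF mono, of c b] by (simp add: scaleP_single)
    then show ?case using add Bc(7) by (simp add: rep_add)
  qed
qed

lemma qalg_iso:
  fixes ch :: "expo \<Rightarrow> expo \<Rightarrow> 'k::field"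
  assumes "qalg ch A rep" "qalg ch B rep'"
  shows "\<exists>\<phi>. k_algebra_iso A B \<phi>"
proof -
  interpret A: qalg ch A rep by fact
  interpret B: qalg ch B rep' by fact
  have "bij_betw (\<lambda>x. rep' (A.unrep x)) (carrier A) (carrier B)"
    unfolding bij_betw_def
  proof
    show "inj_on (\<lambda>x. rep' (A.unrep x)) (carrier A)"
      by (rule inj_onI) (metis A.rep_unrep B.rep_eq)
    show "(\<lambda>x. rep' (A.unrep x)) ` carrier A = carrier B"
    proof (intro equalityI subsetI)
      fix y assume "y \<in> carrier B"
      then obtain f where "y = rep' f" by (rule B.rep_cases)
      then show "y \<in> (\<lambda>x. rep' (A.unrep x)) ` carrier A" by (intro image_eqI[of _ _ "rep f"]) simp_all
    qed auto
  qed
  then have "k_algebra_iso A B (\<lambda>x. rep' (A.unrep x))"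
    unfolding k_algebra_iso_def ring_iso_def ring_hom_def
    by (auto elim!: A.rep_cases simp: A.rep_mult[symmetric] A.rep_add[symmetric] A.rep_one[symmetric]
        B.rep_mult[symmetric] B.rep_add[symmetric] B.rep_one[symmetric] A.rep_smult[symmetric] B.rep_smult[symmetric])
  then show ?thesis by blast
qed

section \<open>The two presented algebras\<close>

text \<open>The bicharacter for which \<open>x\<^sub>1 x\<^sub>2 = Q x\<^sub>2 x\<^sub>1\<close>, \<open>x\<^sub>2 x\<^sub>3 = Q x\<^sub>3 x\<^sub>2\<close> and \<open>x\<^sub>3 x\<^sub>1 = Q x\<^sub>1 x\<^sub>3\<close>.\<close>

definition chq :: "'k::field \<Rightarrow> expo \<Rightarrow> expo \<Rightarrow> 'k"
  where "chq Q = (\<lambda>(a0, a1, a2) (b0, b1, b2). Q ^ (a0 * b1 + a1 * b2 + a2 * b0))"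

lemma bichar_chq: "Q \<noteq> 0 \<Longrightarrow> bichar (chq Q)"
  by unfold_locales (auto simp: chq_def power_add[symmetric] algebra_simps)

definition rot :: "expo \<Rightarrow> expo"
  where "rot = (\<lambda>(a, b, c). (c, a, b))"

lemma rot_simp [simp]: "rot (a, b, c) = (c, a, b)"
  by (simp add: rot_def)

lemma chq_rot: "chq Q (rot a) (rot b) = chq Q a b"
  by (cases a; cases b) (simp add: chq_def algebra_simps)

text \<open>The exponent of a bicharacter is quadratic in a common factor of its arguments; this is
  the origin of \<open>n^2\<close> in the theorem.\<close>

lemma chq_mulv: "chq Q (mulv m a) (mulv m b) = chq (Q ^ (m ^ 2)) a b"
  by (cases a; cases b) (simp add: chq_def mulv_def power_mult[symmetric] power2_eq_square algebra_simps)

fun kaw :: "'k::field \<Rightarrow> (expo \<Rightarrow> expo) \<Rightarrow> (gen list \<Rightarrow> expo) \<Rightarrow> gen list \<Rightarrow> 'k" where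
  "kaw Q sg al [] = 1"
| "kaw Q sg al (g # w) = chq Q (ev g) (sg (al w)) * kaw Q sg al w"

interpretation wr: words rot
  by unfold_locales (auto simp: tdeg_def)

interpretation wi: words "\<lambda>a. a"
  by unfold_locales simp_all

declare wr.sg_0 [simp]

lemma length_2: "length u = 2 \<longleftrightarrow> (\<exists>g h. u = [g, h])"
  by (auto simp: length_Suc_conv numeral_2_eq_2)

lemma chq_simp [simp]: "chq Q (a0, a1, a2) (b0, b1, b2) = Q ^ (a0 * b1 + a1 * b2 + a2 * b0)"
  by (simp add: chq_def)

lemma chq_0 [simp]: "chq Q a 0 = 1"
  by (cases a) (simp only: zero_prod_def chq_simp mult_0_right add_0_left power_0)

text \<open>Of the nine words of length 2, \<open>xz\<close>, \<open>yx\<close>, \<open>zy\<close>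
  read as squares of variables. The other six fall into the pairs \<open>xx, yz\<close>, then
  \<open>yy, zx\<close>, then \<open>zz, xy\<close> with equal readings, and these are exactly the
  pairs in the relations.\<close>

lemma pwords_skly:
  assumes "q \<noteq> 0"
  shows "pwords rot (chq (- q)) (skly_rels q) (kaw (- q) rot wr.al)"
proof (intro pwords.intro pwords_axioms.intro wr.words_axioms bichar_chq)
  define D where "D = {([gx, gx], [gy, gz]), ([gy, gy], [gz, gx]), ([gz, gz], [gx, gy])}"
  have R: "skly_rels q = (\<lambda>(u, v). single u 1 - single v (- q)) ` D"
    by (simp add: skly_rels_def D_def single_uminus)
  have D: "length u = length v" "wr.al u = wr.al v" "kaw (- q) rot wr.al u = - q * kaw (- q) rot wr.al v"
    if "(u, v) \<in> D" for u v
  proof -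
    have "u = [gx, gx] \<and> v = [gy, gz] \<or> u = [gy, gy] \<and> v = [gz, gx] \<or> u = [gz, gz] \<and> v = [gx, gy]"
      using that unfolding D_def by blast
    then show "length u = length v" "wr.al u = wr.al v" "kaw (- q) rot wr.al u = - q * kaw (- q) rot wr.al v"
      by (elim disjE conjE; simp)+
  qed
  show "- q \<noteq> 0" using assms by simp
  show "\<exists>u v c. length u = length v \<and> wr.al u = wr.al v \<and> kaw (- q) rot wr.al u = c * kaw (- q) rot wr.al v \<and>
      r = single u 1 - single v c" if r: "r \<in> skly_rels q" for r
  proof -
    obtain u v where uv: "(u, v) \<in> D" "r = single u 1 - single v (- q)" using r unfolding R by auto
    show ?thesis by (intro exI[of _ u] exI[of _ v] exI[of _ "- q"] conjI D[OF uv(1)] uv(2))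
  qed
  show "\<exists>c. c \<noteq> 0 \<and> (single u 1 - single v c \<in> skly_rels q \<or> single v 1 - single u c \<in> skly_rels q)"
    if l: "length u = 2" "length v = 2" "wr.al u = wr.al v" "u \<noteq> v" for u v
  proof -
    obtain g h g' h' where uv: "u = [g, h]" "v = [g', h']" using l(1,2) unfolding length_2 by blast
    have "(u, v) \<in> D \<or> (v, u) \<in> D"
      using l(3,4) unfolding uv D_def by (cases g; cases h; cases g'; cases h'; simp)
    then have "single u 1 - single v (- q) \<in> skly_rels q \<or> single v 1 - single u (- q) \<in> skly_rels q"
      unfolding R by (metis (mono_tags, lifting) case_prod_conv image_eqI)
    then show ?thesis using assms by (intro exI[of _ "- q"]) simp
  qed
  show "kaw (- q) rot wr.al (g # w) = chq (- q) (ev g) (rot (wr.al w)) * kaw (- q) rot wr.al w" for g w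
    by (rule kaw.simps)
qed (rule chq_rot kaw.simps)+

text \<open>The bicharacter is cyclic, whereas the relations order the variables linearly:
  \<open>x3 x1\<close> runs along the cycle and has parameter \<open>T\<close>, while
  \<open>x2 x1\<close> and \<open>x3 x2\<close> run against it and have the inverse.\<close>

lemma pwords_skew:
  assumes "T \<noteq> 0"
  shows "pwords (\<lambda>a. a) (chq T) (skew_poly_rels (inverse T) T (inverse T)) (kaw T (\<lambda>a. a) wi.al)"
proof (intro pwords.intro pwords_axioms.intro wi.words_axioms bichar_chq assms)
  let ?R = "skew_poly_rels (inverse T) T (inverse T)"
  define D where "D = {([gy, gx], [gx, gy], inverse T), ([gz, gx], [gx, gz], T), ([gz, gy], [gy, gz], inverse T)}"
  have R: "?R = (\<lambda>(u, v, c). single u 1 - single v c) ` D"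
    by (simp add: skew_poly_rels_def D_def)
  have D: "length u = length v" "wi.al u = wi.al v" "kaw T (\<lambda>a. a) wi.al u = c * kaw T (\<lambda>a. a) wi.al v" "c \<noteq> 0"
    if "(u, v, c) \<in> D" for u v c
  proof -
    have "u = [gy, gx] \<and> v = [gx, gy] \<and> c = inverse T \<or> u = [gz, gx] \<and> v = [gx, gz] \<and> c = T \<or>
      u = [gz, gy] \<and> v = [gy, gz] \<and> c = inverse T"
      using that unfolding D_def by blast
    then show "length u = length v" "wi.al u = wi.al v" "kaw T (\<lambda>a. a) wi.al u = c * kaw T (\<lambda>a. a) wi.al v" "c \<noteq> 0"
      by (elim disjE conjE; simp add: assms)+
  qed
  show "\<exists>u v c. length u = length v \<and> wi.al u = wi.al v \<and> kaw T (\<lambda>a. a) wi.al u = c * kaw T (\<lambda>a. a) wi.al v \<and>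
      r = single u 1 - single v c" if r: "r \<in> ?R" for r
  proof -
    obtain u v c where uv: "(u, v, c) \<in> D" "r = single u 1 - single v c" using r unfolding R by auto
    show ?thesis by (intro exI[of _ u] exI[of _ v] exI[of _ c] conjI D(1-3)[OF uv(1)] uv(2))
  qed
  show "\<exists>c. c \<noteq> 0 \<and> (single u 1 - single v c \<in> ?R \<or> single v 1 - single u c \<in> ?R)"
    if l: "length u = 2" "length v = 2" "wi.al u = wi.al v" "u \<noteq> v" for u v
  proof -
    obtain g h g' h' where uv: "u = [g, h]" "v = [g', h']" using l(1,2) unfolding length_2 by blast
    have "\<exists>c. (u, v, c) \<in> D \<or> (v, u, c) \<in> D"
      using l(3,4) unfolding uv D_def by (cases g; cases h; cases g'; cases h'; simp)
    then obtain c where c: "(u, v, c) \<in> D \<or> (v, u, c) \<in> D" by blast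
    then have "single u 1 - single v c \<in> ?R \<or> single v 1 - single u c \<in> ?R"
      unfolding R by (metis (mono_tags, lifting) case_prod_conv image_eqI)
    then show ?thesis using c D(4) by (intro exI[of _ c]) blast
  qed
  show "kaw T (\<lambda>a. a) wi.al (g # w) = chq T (ev g) (wi.al w) * kaw T (\<lambda>a. a) wi.al w" for g w
    by (rule kaw.simps)
qed (rule HOL.refl kaw.simps)+

section \<open>Words of trivial degree in the grading group, and the identity component\<close>

section \<open>The grading group\<close>

abbreviation pos :: "gen list \<Rightarrow> (gen \<times> bool) list"
  where "pos \<equiv> map (\<lambda>g. (g, True))"

lemma Delta_degree_word: "Delta_degree n w = pres_rel (Delta_rels n) `` {pos w}"
proof (induction w)
  case Nil
  show ?case by (simp add: word_degree_def Delta_def presented_group_def)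
next
  case (Cons g w)
  have "Delta_degree n (g # w) = Delta_gen n g \<otimes>\<^bsub>Delta n\<^esub> Delta_degree n w" by (simp add: word_degree_def)
  also have "\<dots> = pres_rel (Delta_rels n) `` {[(g, True)] @ pos w}"
    unfolding Cons Delta_gen_def unfolding Delta_def by (rule presented_group_mult)
  finally show ?case by simp
qed

lemma Delta_degree_one: "Delta_degree n w = \<one>\<^bsub>Delta n\<^esub> \<longleftrightarrow> pres_eq (Delta_rels n) (pos w) []"
proof -
  have "\<one>\<^bsub>Delta n\<^esub> = pres_rel (Delta_rels n) `` {[]}" by (simp add: Delta_def presented_group_def)
  then show ?thesis unfolding Delta_degree_word by (simp add: pres_rel_class_eq_iff)
qed

lemma pres_eq_Cons: "pres_eq R u v \<Longrightarrow> pres_eq R (a # u) (a # v)"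
  using pres_eq.cong[of R u v "[a]" "[]"] by simp

lemma pres_eq_swap:
  assumes "length u = 2" "length v = 2" "wr.al u = wr.al v"
  shows "pres_eq (Delta_rels n) (pos (u @ w)) (pos (v @ w))"
proof (cases "u = v")
  case True
  then show ?thesis by (simp add: pres_eq.refl)
next
  case False
  obtain g h g' h' where uv: "u = [g, h]" "v = [g', h']" using assms(1,2) unfolding length_2 by blast
  have "(pos u, pos v) \<in> Delta_rels n \<or> (pos v, pos u) \<in> Delta_rels n"
    using assms(3) False unfolding uv Delta_rels_def
    by (cases g; cases h; cases g'; cases h'; simp)
  then have "pres_eq (Delta_rels n) (pos u) (pos v)" by (blast intro: pres_eq.rel pres_eq.sym)
  from pres_eq.cong[OF this, of "[]" "pos w"] show ?thesis by simp
qed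

lemma pres_eq_al: "wr.al w = wr.al w' \<Longrightarrow> pres_eq (Delta_rels n) (pos w) (pos w')"
proof (rule wr.al_eq_induct[of "\<lambda>w w'. pres_eq (Delta_rels n) (pos w) (pos w')"])
  show "pres_eq (Delta_rels n) (pos u) (pos w)"
    if "pres_eq (Delta_rels n) (pos u) (pos v)" "pres_eq (Delta_rels n) (pos v) (pos w)" for u v w
    using that by (rule pres_eq.trans)
qed (simp_all add: pres_eq.refl pres_eq_Cons pres_eq_swap del: map_append)

lemma concat_replicate_rotate: "concat (replicate k (g # w)) @ [g] = g # concat (replicate k (w @ [g]))"
  by (induction k) simp_all

text \<open>Conjugation by the first letter rotates the word cyclically under the power.\<close>

lemma pres_eq_conjugate:
  assumes "pres_eq R (concat (replicate k ((g, True) # w))) []"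
  shows "pres_eq R (concat (replicate k (w @ [(g, True)]))) []"
proof -
  have c: "pres_eq R [(g, False), (g, True)] []" using pres_eq.cancel[of R g False] by simp
  let ?u = "concat (replicate k (w @ [(g, True)]))"
  have "[(g, False)] @ concat (replicate k ((g, True) # w)) @ [(g, True)] = [(g, False), (g, True)] @ ?u"
    by (simp add: concat_replicate_rotate)
  then have "pres_eq R ([(g, False), (g, True)] @ ?u) [(g, False), (g, True)]"
    using pres_eq.cong[OF assms, of "[(g, False)]" "[(g, True)]"] by simp
  moreover have "pres_eq R ?u ([(g, False), (g, True)] @ ?u)"
    using pres_eq.sym[OF pres_eq.cong[OF c, of "[]" ?u]] by simp
  ultimately show ?thesis using c pres_eq.trans by blast
qed

text \<open>The three words are the cyclic rotations of \<open>xzy\<close>, which has degree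
  \<open>acb\<close>, so the single relation on \<open>acb\<close> makes all their n-th powers
  trivial.\<close>

definition uw :: "gen \<Rightarrow> gen list"
  where "uw g = (case g of gx \<Rightarrow> [gx, gz, gy] | gy \<Rightarrow> [gy, gx, gz] | gz \<Rightarrow> [gz, gy, gx])"

lemma uw_trivial: "pres_eq (Delta_rels n) (pos (concat (replicate n (uw g)))) []"
proof -
  have p: "pos (concat (replicate n w)) = concat (replicate n (pos w))" for w
    by (simp add: map_concat)
  have x: "pres_eq (Delta_rels n) (concat (replicate n [(gx, True), (gz, True), (gy, True)])) []"
    by (rule pres_eq.rel) (simp add: Delta_rels_def)
  have z: "pres_eq (Delta_rels n) (concat (replicate n [(gz, True), (gy, True), (gx, True)])) []"
    using pres_eq_conjugate[OF x] by simp
  have y: "pres_eq (Delta_rels n) (concat (replicate n [(gy, True), (gx, True), (gz, True)])) []"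
    using pres_eq_conjugate[OF z] by simp
  show ?thesis unfolding p using x y z by (cases g) (simp_all add: uw_def)
qed

lemma length_uw: "length (uw g) = 3"
  by (cases g) (simp_all add: uw_def)

lemma rot3: "(rot ^^ 3) a = a"
  by (cases a) (simp add: eval_nat_numeral)

lemma al_uw: "wr.al (uw g) = mulv 3 (ev g)"
  by (cases g) (simp_all add: uw_def mulv_def zero_prod_def)

lemma al_uw_append: "wr.al (uw g @ v) = mulv 3 (ev g) + wr.al v"
  by (simp add: wr.al_append length_uw rot3 al_uw)

lemma al_uw_power: "wr.al (concat (replicate k (uw g)) @ v) = mulv (3 * k) (ev g) + wr.al v"
proof (induction k)
  case 0
  have "mulv 0 a = 0" for a by (cases a) (simp add: mulv_def zero_prod_def)
  then show ?case by simp
next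
  case (Suc k)
  have "wr.al (concat (replicate (Suc k) (uw g)) @ v) = mulv 3 (ev g) + (mulv (3 * k) (ev g) + wr.al v)"
    using Suc by (simp add: al_uw_append)
  also have "\<dots> = mulv (3 * Suc k) (ev g) + wr.al v"
    by (cases g) (simp_all add: mulv_def add.assoc[symmetric])
  finally show ?case .
qed

text \<open>Products of n-th powers of the words \<open>uw g\<close> are trivial in the group and
  realise every vector in the range of \<open>mulv (3 * n)\<close>; words with equal vectors agree
  in the group.\<close>

lemma degree_one_if: "wr.al w = mulv (3 * n) b \<Longrightarrow> pres_eq (Delta_rels n) (pos w) []"
proof -
  have "\<exists>v. wr.al v = mulv (3 * n) b \<and> pres_eq (Delta_rels n) (pos v) []"
  proof (induction "tdeg b" arbitrary: b)
    case 0
    then show ?case by (intro exI[of _ "[]"]) (simp add: tdeg_eq_0 pres_eq.refl)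
  next
    case (Suc m)
    then obtain g c where gc: "b = ev g + c" "tdeg c = m" using tdeg_pos[of b m] by auto
    then obtain v where v: "wr.al v = mulv (3 * n) c" "pres_eq (Delta_rels n) (pos v) []" using Suc(1) by blast
    have "pres_eq (Delta_rels n) (pos (concat (replicate n (uw g)) @ v)) []"
      using pres_eq_append[OF uw_trivial v(2)] by simp
    then show ?case
      by (intro exI[of _ "concat (replicate n (uw g)) @ v"]) (simp add: al_uw_power v(1) gc(1) mulv_add)
  qed
  then obtain v where v: "wr.al v = mulv (3 * n) b" "pres_eq (Delta_rels n) (pos v) []" by blast
  assume "wr.al w = mulv (3 * n) b"
  then show ?thesis using pres_eq_al[of w v n] v pres_eq.trans by metis
qed

text \<open>The group acts on \<open>(\<int>/3n)\<^sup>3\<close> by affine maps, and a positive word moves the origin to its exponent vector.\<close>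

fun iev :: "gen \<Rightarrow> int \<times> int \<times> int" where
  "iev gx = (1, 0, 0)" | "iev gy = (0, 1, 0)" | "iev gz = (0, 0, 1)"

fun affine :: "gen \<times> bool \<Rightarrow> int \<times> int \<times> int \<Rightarrow> int \<times> int \<times> int" where
  "affine (g, True) (a, b, c) = iev g + (c, a, b)"
| "affine (g, False) a = (case a - iev g of (x, y, z) \<Rightarrow> (y, z, x))"

text \<open>The residue ring is not constructed: the letters act on integer triples, and equality is
  replaced by this congruence.\<close>

definition cgt :: "int \<Rightarrow> int \<times> int \<times> int \<Rightarrow> int \<times> int \<times> int \<Rightarrow> bool"
  where "cgt m = (\<lambda>(a, b, c) (x, y, z). m dvd a - x \<and> m dvd b - y \<and> m dvd c - z)"

lemma cgt_refl: "cgt m a a"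
  by (cases a) (simp add: cgt_def)

lemma cgt_sym: "cgt m a b \<Longrightarrow> cgt m b a"
proof -
  have "m dvd y - x" if "m dvd x - y" for x y :: int
    using that by (subst dvd_diff_commute)
  then show "cgt m a b \<Longrightarrow> cgt m b a" by (cases a; cases b) (simp add: cgt_def)
qed

lemma cgt_trans: "cgt m a b \<Longrightarrow> cgt m b c \<Longrightarrow> cgt m a c"
proof -
  have tr: "m dvd x - z" if "m dvd x - y" "m dvd y - z" for x y z :: int
    using dvd_add[OF that] by simp
  then show "cgt m a b \<Longrightarrow> cgt m b c \<Longrightarrow> cgt m a c" 
    unfolding cgt_def case_prod_beta by (elim conjE, intro conjI) (erule (1) tr)+
qed

lemma cgt_affine: "cgt m a b \<Longrightarrow> cgt m (affine l a) (affine l b)"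
proof (cases l)
  case (Pair g s)
  assume "cgt m a b"
  then show ?thesis by (cases a; cases b; cases g; cases s) (simp_all add: Pair cgt_def)
qed

lemma cgt_word: "cgt m a b \<Longrightarrow> cgt m (foldr affine w a) (foldr affine w b)"
  by (induction w) (simp_all add: cgt_affine)

lemma affine_cancel: "affine (g, b) (affine (g, \<not> b) a) = a"
  by (cases a; cases g; cases b) simp_all

lemma pres_eq_affine:
  "pres_eq (Delta_rels n) u v \<Longrightarrow> cgt (int (3 * n)) (foldr affine u a) (foldr affine v a)"
proof (induction arbitrary: a rule: pres_eq.induct)
  case (refl u)
  show ?case by (rule cgt_refl)
next
  case (sym u v)
  then show ?case using cgt_sym by blast
next
  case (trans u v w)
  then show ?case using cgt_trans by blast
next
  case (cong u v xs ys)
  show ?case using cgt_word[OF cong.IH[of "foldr affine ys a"], of xs] by simp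
next
  case (cancel g b)
  show ?case using affine_cancel[of g b a] cgt_refl[of "int (3 * n)" a] by simp
next
  case (rel u v)
  obtain x y z where a: "a = (x, y, z)" by (cases a)
  \<comment> \<open>Each factor \<open>acb\<close> translates the first coordinate by 3, so its n-th
    power acts trivially modulo \<open>3 * n\<close>; the other three relations already hold on
    integer triples.\<close>
  have acb: "foldr affine (concat (replicate k [(gx, True), (gz, True), (gy, True)])) (x, y, z) = (x + 3 * int k, y, z)" for k
    by (induction k) simp_all
  from rel consider
      "u = [(gx, True), (gy, True)]" "v = [(gz, True), (gz, True)]"
    | "u = [(gy, True), (gz, True)]" "v = [(gx, True), (gx, True)]"
    | "u = [(gz, True), (gx, True)]" "v = [(gy, True), (gy, True)]"
    | "u = concat (replicate n [(gx, True), (gz, True), (gy, True)])" "v = []"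
    unfolding Delta_rels_def by blast
  then show ?case
  proof cases
    case 4
    then show ?thesis using acb[of n] by (simp add: a cgt_def)
  qed (simp_all add: a cgt_def)
qed

text \<open>\<open>foldr\<close> applies the first letter last, which matches the recursion of
  \<open>al\<close>.\<close>

lemma affine_pos: "foldr affine (pos w) 0 = map_prod int (map_prod int int) (wr.al w)"
proof (induction w)
  case (Cons g w)
  obtain a b c where "wr.al w = (a, b, c)" by (cases "wr.al w")
  then show ?case using Cons by (cases g) simp_all
qed (simp add: zero_prod_def)

lemma degree_one_only_if:
  assumes "pres_eq (Delta_rels n) (pos w) []"
  shows "wr.al w \<in> range (mulv (3 * n))"
proof -
  obtain a b c where al: "wr.al w = (a, b, c)" by (cases "wr.al w")
  have "cgt (int (3 * n)) (int a, int b, int c) 0"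
    using pres_eq_affine[OF assms, of 0] affine_pos[of w] al by simp
  then have "3 * n dvd a" "3 * n dvd b" "3 * n dvd c"
    by (simp_all only: cgt_def zero_prod_def split diff_0_right int_dvd_int_iff)
  then obtain x y z where "a = 3 * n * x" "b = 3 * n * y" "c = 3 * n * z" by (auto elim!: dvdE)
  then show ?thesis by (intro image_eqI[of _ _ "(x, y, z)"]) (simp_all add: al mulv_def)
qed

lemma degree_one_al: "{wr.al w |w. Delta_degree n w = \<one>\<^bsub>Delta n\<^esub>} = range (mulv (3 * n))"
proof (intro equalityI subsetI)
  fix a assume "a \<in> range (mulv (3 * n))"
  then obtain b where b: "a = mulv (3 * n) b" by blast
  obtain w where w: "wr.al w = a" using wr.al_surj by blast
  have "Delta_degree n w = \<one>\<^bsub>Delta n\<^esub>" unfolding Delta_degree_one by (rule degree_one_if) (simp add: w b)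
  then show "a \<in> {wr.al w |w. Delta_degree n w = \<one>\<^bsub>Delta n\<^esub>}" using w by blast
qed (use degree_one_only_if in \<open>auto simp: Delta_degree_one\<close>)

section \<open>The identity component\<close>

locale skly =
  fixes q :: "'k::field" and n :: nat
  assumes q: "q \<noteq> 0" and n: "n > 0"
begin

sublocale S: pwords rot "chq (- q)" "skly_rels q" "kaw (- q) rot wr.al"
  by (rule pwords_skly[OF q])

lemma S_e_carrier: "carrier (S_e q n) = S.cls ` {f. keys f \<subseteq> range (mulv (3 * n))}"
  by (simp add: S_e_def component_def S.k_span_words degree_one_al)

lemma S_e_eq: "S_e q n = (S_alg q)\<lparr>carrier := S.cls ` {f. keys f \<subseteq> range (mulv (3 * n))}\<rparr>"
  using S_e_carrier by (simp add: S_e_def)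

abbreviation "repS \<equiv> \<lambda>f. S.cls (emb (3 * n) f)"

abbreviation "TT \<equiv> (- q) ^ ((3 * n) ^ 2)"

sublocale E: gqalg "chq TT" "S_e q n" repS "3 * n"
proof (intro gqalg.intro gqalg_axioms.intro)
  show "qalg (chq TT) (S_e q n) repS"
    unfolding S_e_eq
  proof (rule S.qalg_sub)
    show "0 < 3 * n" using n by simp
    show "(rot ^^ (3 * n * k)) a = a" for k a using wr.funpow_sg_3[of "n * k" a] by (simp add: mult.assoc)
    show "chq TT a b = chq (- q) (mulv (3 * n) a) (mulv (3 * n) b)" for a b by (simp only: chq_mulv)
  qed
  show "3 * n > 0" using n by simp
qed

text \<open>The length of a word is the total degree of its vector, so both components are spans of
  monomials and their intersection is taken exponent by exponent.\<close>

lemma S_e_grading_eq: "S_e_grading q n = E.G"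
proof
  fix m
  have al: "{wr.al w |w. length w = m} = {a. tdeg a = m}"
  proof (intro equalityI subsetI)
    fix a assume "a \<in> {a. tdeg a = m}"
    moreover obtain w where "wr.al w = a" using wr.al_surj by blast
    ultimately show "a \<in> {wr.al w |w. length w = m}" using wr.tdeg_al[of w] by auto
  next
    fix a assume "a \<in> {wr.al w |w. length w = m}"
    then obtain w where "a = wr.al w" "length w = m" by blast
    then show "a \<in> {a. tdeg a = m}" by (simp add: wr.tdeg_al)
  qed
  have "S_e_grading q n m = S.cls ` {f. keys f \<subseteq> {a. tdeg a = m}} \<inter> S.cls ` {f. keys f \<subseteq> range (mulv (3 * n))}"
    by (simp add: S_e_grading_def component_def S.k_span_words al S_e_carrier)
  also have "\<dots> = S.cls ` {f. keys f \<subseteq> {a. tdeg a = m} \<and> keys f \<subseteq> range (mulv (3 * n))}"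
  proof -
    have "inj S.cls" by (rule injI) simp
    then show ?thesis by (simp only: image_Int[symmetric] Collect_conj_eq)
  qed
  also have "\<dots> = E.G m"
  proof (intro equalityI subsetI)
    fix x assume "x \<in> S.cls ` {f. keys f \<subseteq> {a. tdeg a = m} \<and> keys f \<subseteq> range (mulv (3 * n))}"
    then obtain f where f: "x = S.cls f" "keys f \<subseteq> {a. tdeg a = m}" "keys f \<subseteq> range (mulv (3 * n))"
      by (elim imageE CollectE conjE)
    obtain g where g: "f = emb (3 * n) g" using emb_image[OF E.N_pos f(3)] by blast
    have "g \<in> hom (3 * n) m" using f(2) unfolding g keys_emb[OF E.N_pos] by (auto simp: hom_def tdeg_mulv)
    then show "x \<in> E.G m" unfolding E.G_def f(1) g by (rule imageI)
  next
    fix x assume "x \<in> E.G m"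
    then obtain g where g: "x = repS g" "g \<in> hom (3 * n) m" unfolding E.G_def by blast
    have "keys (emb (3 * n) g) \<subseteq> {a. tdeg a = m}" "keys (emb (3 * n) g) \<subseteq> range (mulv (3 * n))"
      using g(2) unfolding keys_emb[OF E.N_pos] by (auto simp: hom_def tdeg_mulv)
    then show "x \<in> S.cls ` {f. keys f \<subseteq> {a. tdeg a = m} \<and> keys f \<subseteq> range (mulv (3 * n))}"
      unfolding g(1) by (intro imageI CollectI conjI)
  qed
  finally show "S_e_grading q n m = E.G m" .
qed

lemma uw_power: "word_class (skly_rels q) (uw g) [^]\<^bsub>S_alg q\<^esub> n =
    repS (single (ev g) (kaw (- q) rot wr.al (concat (replicate n (uw g)))))"
  unfolding S.word_class_pow unfolding S.word_class_cls
  using al_uw_power[of n g "[]"] by (simp add: emb_single)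

lemma generated:
  "subalgebra_generated (S_e q n) (range (\<lambda>g. word_class (skly_rels q) (uw g) [^]\<^bsub>S_alg q\<^esub> n)) = carrier (S_e q n)"
proof
  interpret A: k_algebra "S_e q n" by (rule E.k_algebra_A)
  have sub: "subring (carrier (S_e q n)) (S_e q n)" by (rule A.carrier_is_subring)
  have mod: "submodule (carrier (S_e q n)) base (S_e q n)" by (rule A.carrier_is_submodule)
  show "subalgebra_generated (S_e q n) (range (\<lambda>g. word_class (skly_rels q) (uw g) [^]\<^bsub>S_alg q\<^esub> n)) \<subseteq> carrier (S_e q n)"
    unfolding subalgebra_generated_def uw_power using sub mod by (intro Inter_lower) auto
  show "carrier (S_e q n) \<subseteq> subalgebra_generated (S_e q n) (range (\<lambda>g. word_class (skly_rels q) (uw g) [^]\<^bsub>S_alg q\<^esub> n))"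
    unfolding subalgebra_generated_def uw_power
  proof (rule Inter_greatest)
    fix B assume B: "B \<in> {B. subring B (S_e q n) \<and> submodule B base (S_e q n) \<and>
      range (\<lambda>g. repS (single (ev g) (kaw (- q) rot wr.al (concat (replicate n (uw g)))))) \<subseteq> B}"
    show "carrier (S_e q n) \<subseteq> B"
      by (rule E.generated_by_variables[where k = "\<lambda>g. kaw (- q) rot wr.al (concat (replicate n (uw g)))"])
        (use B in auto)
  qed
qed

text \<open>With the identity as twist and \<open>m = 1\<close>, \<open>qalg_sub\<close> puts
  coordinates on all of \<open>A_rst\<close>; two algebras with coordinates for the same bicharacter
  are isomorphic.\<close>

lemma iso: "\<exists>\<phi>. k_algebra_iso (S_e q n) (A_rst (inverse TT) TT (inverse TT)) \<phi>"
proof -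
  have T: "TT \<noteq> 0" using q by simp
  interpret B: pwords "\<lambda>a. a" "chq TT" "skew_poly_rels (inverse TT) TT (inverse TT)" "kaw TT (\<lambda>a. a) wi.al"
    by (rule pwords_skew[OF T])
  have id: "((\<lambda>a. a) ^^ k) a = a" for k and a :: expo by (induction k) simp_all
  have m1: "mulv 1 a = a" for a by (cases a) (simp add: mulv_def)
  have "mulv 1 = (\<lambda>a. a)" by (rule ext) (rule m1)
  then have "{f. keys f \<subseteq> range (mulv 1)} = (UNIV :: (expo \<Rightarrow>\<^sub>0 'k) set)" by simp
  then have e: "B.PA\<lparr>carrier := B.cls ` {f. keys f \<subseteq> range (mulv 1)}\<rparr> = B.PA" using B.PA_carrier by simp
  have "qalg (chq TT) (B.PA\<lparr>carrier := B.cls ` {f. keys f \<subseteq> range (mulv 1)}\<rparr>) (\<lambda>f. B.cls (emb 1 f))"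
  proof (rule B.qalg_sub)
    show "0 < (1 :: nat)" by simp
    show "((\<lambda>a. a) ^^ (1 * k)) a = a" for k and a :: expo by (rule id)
    show "chq TT a b = chq TT (mulv 1 a) (mulv 1 b)" for a b by (simp only: m1)
  qed
  from qalg_iso[OF E.qalg_axioms this[unfolded e]] show ?thesis .
qed

end

lemma range_gen: "range F = {F gx, F gy, F gz}" for F :: "gen \<Rightarrow> 'b"
proof -
  have U: "UNIV = {gx, gy, gz}" using gen.exhaust by blast
  show ?thesis unfolding U by simp
qed

theorem corollary6p7:
  fixes q p :: "'k::{alg_closed_field, field_char_0}"
    and n :: nat
    and \<iota> :: "'k \<Rightarrow> 'u"
    and u v w :: "(gen list \<Rightarrow>\<^sub>0 'k) set"
  assumes "q \<noteq> 0"
    and "n > 0"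
    and "inj \<iota>"  \<comment> \<open>modules are taken in an arbitrary type \<^typ>\<open>'u\<close> at least as large as the field\<close>
    and "u = word_class (skly_rels q) [gx, gz, gy]"
    and "v = word_class (skly_rels q) [gy, gx, gz]"
    and "w = word_class (skly_rels q) [gz, gy, gx]"
    and "p = - (q powi (-9))"
  shows "subalgebra_generated (S_e q n)
           {u [^]\<^bsub>S_alg q\<^esub> n, v [^]\<^bsub>S_alg q\<^esub> n, w [^]\<^bsub>S_alg q\<^esub> n} = carrier (S_e q n) \<and>
         (\<exists>\<phi>. k_algebra_iso (S_e q n)
           (A_rst (p powi (int n ^ 2)) (p powi (- (int n ^ 2))) (p powi (int n ^ 2))) \<phi>) \<and>
         (\<exists>d. AS_regular TYPE('u) (S_e q n) (S_e_grading q n) d)"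
proof (intro conjI)
  interpret skly q n by unfold_locales (use assms in auto)
  have U: "range (\<lambda>g. word_class (skly_rels q) (uw g) [^]\<^bsub>S_alg q\<^esub> n) =
      {u [^]\<^bsub>S_alg q\<^esub> n, v [^]\<^bsub>S_alg q\<^esub> n, w [^]\<^bsub>S_alg q\<^esub> n}"
  proof -
    show ?thesis unfolding range_gen uw_def by (simp only: gen.case assms(4-6))
  qed
  show "subalgebra_generated (S_e q n)
      {u [^]\<^bsub>S_alg q\<^esub> n, v [^]\<^bsub>S_alg q\<^esub> n, w [^]\<^bsub>S_alg q\<^esub> n} = carrier (S_e q n)"
    using generated unfolding U .
  \<comment> \<open>The sign moves inside the power because 9 is odd.\<close>
  have p: "p = inverse ((- q) ^ 9)"
    using assms(7) by (simp add: power_int_minus)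
  have n2: "int n ^ 2 = int (n ^ 2)" by simp
  have n9: "9 * n ^ 2 = (3 * n) ^ 2" by (simp add: power_mult_distrib)
  have e: "((- q) ^ 9) ^ (n ^ 2) = TT" by (simp only: power_mult[symmetric] n9)
  have "p powi (int n ^ 2) = inverse TT"
    unfolding p n2 power_int_of_nat power_inverse e ..
  moreover have "p powi (- (int n ^ 2)) = TT"
    unfolding p n2 power_int_minus power_int_of_nat power_inverse e inverse_inverse_eq ..
  ultimately show "\<exists>\<phi>. k_algebra_iso (S_e q n)
      (A_rst (p powi (int n ^ 2)) (p powi (- (int n ^ 2))) (p powi (int n ^ 2))) \<phi>"
    using iso by simp
  show "\<exists>d. AS_regular TYPE('u) (S_e q n) (S_e_grading q n) d"
    using gqalg_AS_regular[OF E.gqalg_axioms assms(3)] unfolding S_e_grading_eq by blast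
qed

end
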